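(* Let $1\le p<\infty$ and let $(X,d,\mu)$ be a metric measure space, where $\mu$ is a Radon measure with $0<\mu(B)<\infty$ for every ball $B\subset X$. Suppose that $\mu$ is doubling and that $(X,d,\mu)$ supports a $p$-Poincaré inequality. Then the homogeneous Newton-Sobolev space $HN^{1,p}(X)$ is a Banach space. If moreover $1<p<\infty$, then every bounded sequence in $HN^{1,p}(X)$ has a convex-combination subsequence that converges in (the norm of) $HN^{1,p}(X)$.
   Context: Balls are $B(x,r)=\{y\in X: d(x,y)<r\}$, $x\in X$, $0<r<\infty$. The measure $\mu$ is doubling if there is $C\ge 1$ with $\mu(B(x,2r))\le C\,\mu(B(x,r))$ for all $x\in X$, $r>0$. For measurable $A$ with $0<\mu(A)<\infty$, write $f_A=\frac{1}{\mu(A)}\int_A f\,d\mu$, also denoted by the average integral $\frac{1}{\mu(A)}\int_A$. Upper gradients: a Borel function $g:X\to[0,\infty]$ is an upper gradient of $f:X\to[-\infty,\infty]$ if $|f(\gamma(b))-f(\gamma(a))|\le\int_\gamma g\,ds$ for every non-constant rectifiable curve $\gamma:[a,b]\to X$, $a<b$, where the inequality is interpreted as $\int_\gamma g\,ds=\infty$ whenever at least one of $f(\gamma(a)),f(\gamma(b))$ is not finite. Poincaré inequality: $(X,d,\mu)$ supports a $p$-Poincaré inequality if there are constants $C>0$, $\lambda\ge1$ such that for every measurable function $f$ on $X$, every upper gradient $g$ of $f$, and every ball $B=B(x,r)$, $$\frac{1}{\mu(B)}\int_{B}|f-f_B|\,d\mu\le C\,r\left(\frac{1}{\mu(B(x,\lambda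 r))}\int_{B(x,\lambda r)}g^p\,d\mu\right)^{1/p};$$ this is understood to include that $f$ is integrable on $B$ whenever the right-hand side is finite. Homogeneous space: $D^{1,p}(X)$ is the collection of all ($\mu$-measurable) functions $f:X\to[-\infty,\infty]$ that have an upper gradient $g$ with $\int_X g^p\,d\mu<\infty$, with seminorm $\Vert f\Vert_{D^{1,p}(X)}=\inf_g\left(\int_X g^p\,d\mu\right)^{1/p}$, the infimum being over all upper gradients $g$ of $f$. Linear combinations are taken pointwise, with value $0$ where the expression is of the undefined form $\infty-\infty$. For $f_1,f_2\in D^{1,p}(X)$, $f_1\sim f_2$ means $\Vert f_1-f_2\Vert_{D^{1,p}(X)}=0$. Then $HN^{1,p}(X):=D^{1,p}(X)/\sim$, normed by the norm inherited from the seminorm $\Vert\cdot\Vert_{D^{1,p}(X)}$. A convex-combination subsequence of a sequence $(u_k)_{k\in\mathbb{N}}$ is a sequence $(w_k)_{k\in\mathbb{N}}$ such that for each $k$ there are a nonnegative integer $N_k$ and nonnegative real numbers $\lambda_{j,k}$, $j=0,\dots,N_k$, with $\sum_{j=0}^{N_k}\lambda_{j,k}=1$ and $w_k=\sum_{j=0}^{N_k}\lambda_{j,k}\,u_{k+j}$. *)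

theory Defs
  imports "HOL-Analysis.Analysis" "HOL-Algebra.Module"
begin

section \<open>Metric measure spaces\<close>

text \<open>
  A metric measure space is a type of class \<open>metric_space\<close> together with a Borel measure \<open>M\<close>
  (\<open>sets M = sets borel\<close>).  A function is \<open>\<mu>\<close>-measurable if it is measurable with respect to
  the completion of \<open>M\<close>.
\<close>

definition radon_measure :: "'a::metric_space measure \<Rightarrow> bool" where
  "radon_measure M \<longleftrightarrow>
     sets M = sets borel \<and>
     (\<forall>K. compact K \<longrightarrow> emeasure M K < \<infinity>) \<and>
     (\<forall>U. open U \<longrightarrow> emeasure M U = (SUP K\<in>{K. compact K \<and> K \<subseteq> U}. emeasure M K)) \<and>
     (\<forall>A\<in>sets borel. emeasure M A = (INF U\<in>{U. open U \<and> A \<subseteq> U}. emeasure M U))"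

definition doubling_measure :: "'a::metric_space measure \<Rightarrow> bool" where
  "doubling_measure M \<longleftrightarrow>
     (\<exists>C::real. C \<ge> 1 \<and>
        (\<forall>x r. 0 < r \<longrightarrow> emeasure M (ball x (2 * r)) \<le> ennreal C * emeasure M (ball x r)))"

text \<open>Only used for exponents \<open>p > 0\<close>.\<close>

definition ennreal_powr :: "ennreal \<Rightarrow> real \<Rightarrow> ennreal" where
  "ennreal_powr a p = (if a = \<infinity> then \<infinity> else ennreal (enn2real a powr p))"

section \<open>Curves and upper gradients\<close>

definition curve_length :: "(real \<Rightarrow> 'a::metric_space) \<Rightarrow> real \<Rightarrow> real \<Rightarrow> ennreal" where
  "curve_length \<gamma> a b =
     (SUP (n, t) \<in> {(n :: nat, t). mono_on {..n} t \<and> t 0 = a \<and> t n = b}.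
        \<Sum>i<n. ennreal (dist (\<gamma> (t i)) (\<gamma> (t (Suc i)))))"

definition rectifiable_curve :: "(real \<Rightarrow> 'a::metric_space) \<Rightarrow> real \<Rightarrow> real \<Rightarrow> bool" where
  "rectifiable_curve \<gamma> a b \<longleftrightarrow> a < b \<and> continuous_on {a..b} \<gamma> \<and> curve_length \<gamma> a b < \<infinity>"

text \<open>
  The arc-length parametrization of \<open>\<gamma>\<close> on \<open>[a, b]\<close>: for \<open>s\<close> between \<open>0\<close> and the length of \<open>\<gamma>\<close>,
  the value \<open>\<gamma> \<tau>\<close> is the same for all \<open>\<tau>\<close> at which the length of \<open>\<gamma>\<close> on \<open>[a, \<tau>]\<close> equals \<open>s\<close>.
\<close>

definition arclength_param :: "(real \<Rightarrow> 'a::metric_space) \<Rightarrow> real \<Rightarrow> real \<Rightarrow> real \<Rightarrow> 'a" where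
  "arclength_param \<gamma> a b s =
     (THE y. \<exists>\<tau>\<in>{a..b}. curve_length \<gamma> a \<tau> = ennreal s \<and> y = \<gamma> \<tau>)"

definition curve_integral ::
    "('a::metric_space \<Rightarrow> ennreal) \<Rightarrow> (real \<Rightarrow> 'a) \<Rightarrow> real \<Rightarrow> real \<Rightarrow> ennreal" where
  "curve_integral g \<gamma> a b =
     (\<integral>\<^sup>+s\<in>{0..enn2real (curve_length \<gamma> a b)}. g (arclength_param \<gamma> a b s) \<partial>lborel)"

definition upper_gradient ::
    "('a::metric_space \<Rightarrow> ennreal) \<Rightarrow> ('a \<Rightarrow> ereal) \<Rightarrow> bool" where
  "upper_gradient g f \<longleftrightarrow>
     g \<in> borel_measurable borel \<and>
     (\<forall>\<gamma> a b. rectifiable_curve \<gamma> a b \<and> \<not> \<gamma> constant_on {a..b} \<longrightarrow>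
        (if \<bar>f (\<gamma> a)\<bar> \<noteq> \<infinity> \<and> \<bar>f (\<gamma> b)\<bar> \<noteq> \<infinity>
         then e2ennreal \<bar>f (\<gamma> b) - f (\<gamma> a)\<bar> \<le> curve_integral g \<gamma> a b
         else curve_integral g \<gamma> a b = \<infinity>))"

section \<open>Poincare inequality\<close>

definition integrable_on_set :: "'a measure \<Rightarrow> 'a set \<Rightarrow> ('a \<Rightarrow> ereal) \<Rightarrow> bool" where
  "integrable_on_set M A f \<longleftrightarrow>
     f \<in> borel_measurable (completion M) \<and> (\<integral>\<^sup>+x\<in>A. e2ennreal \<bar>f x\<bar> \<partial>completion M) < \<infinity>"

text \<open>
  An extended real function that is integrable on \<open>A\<close> is finite almost everywhere on \<open>A\<close>, so
  the passage to \<open>real_of_ereal\<close> does not change the average.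
\<close>

definition average :: "'a measure \<Rightarrow> 'a set \<Rightarrow> ('a \<Rightarrow> ereal) \<Rightarrow> real" where
  "average M A f =
     (LINT x:A|completion M. real_of_ereal (f x)) / measure (completion M) A"

definition nn_average :: "'a measure \<Rightarrow> 'a set \<Rightarrow> ('a \<Rightarrow> ennreal) \<Rightarrow> ennreal" where
  "nn_average M A h = (\<integral>\<^sup>+x\<in>A. h x \<partial>completion M) / emeasure (completion M) A"

definition supports_poincare :: "'a::metric_space measure \<Rightarrow> real \<Rightarrow> bool" where
  "supports_poincare M p \<longleftrightarrow>
     (\<exists>C l :: real. 0 < C \<and> 1 \<le> l \<and>
       (\<forall>f g x r. f \<in> borel_measurable (completion M) \<and> upper_gradient g f \<and> 0 < r \<longrightarrow>
         (let lhs = nn_average M (ball x r)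
                      (\<lambda>y. e2ennreal \<bar>f y - ereal (average M (ball x r) f)\<bar>);
              rhs = ennreal (C * r) *
                    ennreal_powr (nn_average M (ball x (l * r)) (\<lambda>y. ennreal_powr (g y) p)) (1 / p)
          in (rhs < \<infinity> \<longrightarrow> integrable_on_set M (ball x r) f) \<and> lhs \<le> rhs)))"

section \<open>The homogeneous Newton-Sobolev space\<close>

definition D_space :: "'a::metric_space measure \<Rightarrow> real \<Rightarrow> ('a \<Rightarrow> ereal) set" where
  "D_space M p =
     {f \<in> borel_measurable (completion M).
        \<exists>g. upper_gradient g f \<and> (\<integral>\<^sup>+x. ennreal_powr (g x) p \<partial>M) < \<infinity>}"

definition D_seminorm :: "'a::metric_space measure \<Rightarrow> real \<Rightarrow> ('a \<Rightarrow> ereal) \<Rightarrow> ennreal" where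
  "D_seminorm M p f =
     (INF g\<in>{g. upper_gradient g f}. ennreal_powr (\<integral>\<^sup>+x. ennreal_powr (g x) p \<partial>M) (1 / p))"

definition D_add :: "('a \<Rightarrow> ereal) \<Rightarrow> ('a \<Rightarrow> ereal) \<Rightarrow> 'a \<Rightarrow> ereal" where
  "D_add f g = (\<lambda>x. if \<bar>f x\<bar> = \<infinity> \<and> g x = - f x then 0 else f x + g x)"

definition D_scale :: "real \<Rightarrow> ('a \<Rightarrow> ereal) \<Rightarrow> 'a \<Rightarrow> ereal" where
  "D_scale c f = (\<lambda>x. ereal c * f x)"

definition D_rel :: "'a::metric_space measure \<Rightarrow> real \<Rightarrow> (('a \<Rightarrow> ereal) \<times> ('a \<Rightarrow> ereal)) set" where
  "D_rel M p =
     {(f, g). f \<in> D_space M p \<and> g \<in> D_space M p \<and>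
              D_seminorm M p (D_add f (D_scale (-1) g)) = 0}"

text \<open>
  The vector space operations and the norm on the quotient are induced by representatives.  The
  \<open>mult\<close> and \<open>one\<close> fields, which the record type of modules inherits from rings, play no role.
\<close>

definition HN :: "'a::metric_space measure \<Rightarrow> real \<Rightarrow> (real, ('a \<Rightarrow> ereal) set) module" where
  "HN M p =
     \<lparr>carrier = D_space M p // D_rel M p,
      mult = undefined, one = undefined,
      zero = D_rel M p `` {\<lambda>_. 0},
      add = (\<lambda>U V. \<Union>f\<in>U. \<Union>g\<in>V. D_rel M p `` {D_add f g}),
      smult = (\<lambda>c U. \<Union>f\<in>U. D_rel M p `` {D_scale c f})\<rparr>"

definition HN_norm :: "'a::metric_space measure \<Rightarrow> real \<Rightarrow> ('a \<Rightarrow> ereal) set \<Rightarrow> real" where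
  "HN_norm M p U = the_elem ((\<lambda>f. enn2real (D_seminorm M p f)) ` U)"

section \<open>Banach spaces with explicit carrier\<close>

definition real_ring :: "real ring" where
  "real_ring = \<lparr>carrier = UNIV, mult = (*), one = 1, zero = 0, add = (+)\<rparr>"

definition normed_space_on :: "(real, 'b) module \<Rightarrow> ('b \<Rightarrow> real) \<Rightarrow> bool" where
  "normed_space_on V N \<longleftrightarrow>
     module real_ring V \<and>
     (\<forall>x\<in>carrier V. 0 \<le> N x \<and> (N x = 0 \<longleftrightarrow> x = \<zero>\<^bsub>V\<^esub>)) \<and>
     (\<forall>c. \<forall>x\<in>carrier V. N (c \<odot>\<^bsub>V\<^esub> x) = \<bar>c\<bar> * N x) \<and>
     (\<forall>x\<in>carrier V. \<forall>y\<in>carrier V. N (x \<oplus>\<^bsub>V\<^esub> y) \<le> N x + N y)"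

definition norm_converges ::
    "(real, 'b) module \<Rightarrow> ('b \<Rightarrow> real) \<Rightarrow> (nat \<Rightarrow> 'b) \<Rightarrow> 'b \<Rightarrow> bool" where
  "norm_converges V N u v \<longleftrightarrow> v \<in> carrier V \<and> (\<lambda>k. N (u k \<ominus>\<^bsub>V\<^esub> v)) \<longlonglongrightarrow> 0"

definition banach_space_on :: "(real, 'b) module \<Rightarrow> ('b \<Rightarrow> real) \<Rightarrow> bool" where
  "banach_space_on V N \<longleftrightarrow>
     normed_space_on V N \<and>
     (\<forall>u. range u \<subseteq> carrier V \<and>
          (\<forall>e>0. \<exists>n. \<forall>i\<ge>n. \<forall>j\<ge>n. N (u i \<ominus>\<^bsub>V\<^esub> u j) < e) \<longrightarrow>
          (\<exists>v. norm_converges V N u v))"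

definition convex_combination_subseq ::
    "(real, 'b) module \<Rightarrow> (nat \<Rightarrow> 'b) \<Rightarrow> (nat \<Rightarrow> 'b) \<Rightarrow> bool" where
  "convex_combination_subseq V u w \<longleftrightarrow>
     (\<forall>k. \<exists>n. \<exists>l :: nat \<Rightarrow> real.
        (\<forall>j\<le>n. 0 \<le> l j) \<and> (\<Sum>j\<le>n. l j) = 1 \<and>
        w k = (\<Oplus>\<^bsub>V\<^esub>j\<in>{..n}. l j \<odot>\<^bsub>V\<^esub> u (k + j)))"

end

theory Submission
  imports Defs
begin

text \<open>
  Every class has a real-valued representative, since a function of \<open>D_space M p\<close> is finite at the
  end points of every curve on which the line integral of one of its upper gradients is finite.

  Completeness.  For a rapidly Cauchy sequence normalized to mean zero on a fixed ball, the Poincare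
  inequality makes the series of differences converge absolutely almost everywhere.  Outside a
  null set \<open>E\<close> the sum is a limit, and the function \<open>\<infinity>\<close> on \<open>E\<close>, which has norm zero, forces a
  curve to leave \<open>E\<close>; convergence at one point of a curve propagates along it by the upper
  gradient inequality.

  Convex combinations.  Discrete energies of the averages over a net of mesh \<open>2\<^sup>-\<^sup>n\<close> are
  uniformly convex functionals for \<open>p > 1\<close>, uniformly in \<open>n\<close>.  By the Poincare inequality they are bounded
  by a multiple of the norm, and conversely the norm is bounded by the lower limit of the energies,
  because the discrete gradients act as upper gradients on scales above the mesh and a Mazur sequence
  of them converges in the Lp norm.  Hence convex combinations that nearly minimize the upper
  limit of the energies form a Cauchy sequence for the norm, and no weak compactness is needed.
\<close>

text \<open>The seminorm is an infimum over upper gradients, and these do not depend linearly on the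
  function: from upper gradients of \<open>u\<close>, \<open>v\<close> and their midpoint little
  more than a triangle inequality follows for \<open>u - v\<close>, so the norm shows no uniform
  convexity by itself. Averages over net balls are linear in the function. Each discrete energy is
  the \<open>p\<close>-th power of an Lp norm of a linear image, and a scalar inequality passes to
  it term by term. The energies need not converge as the mesh shrinks, hence the upper limits. The
  energy of a difference is known to be small only for infinitely many meshes, hence the bound of
  the norm by a lower limit. An upper gradient has to work on every curve, whereas averages see a
  function only almost everywhere. Both limit arguments therefore start at points of the curve
  outside an exceptional set and need a second device to reach its end points: the gradients of the
  differences in one case, a small multiple of a given upper gradient in the other.\<close>

hide_const (open) Order.top

section \<open>Rectifiable curves\<close>

lemma curve_length_partition_le:
  assumes "mono_on {..n} t" "t 0 = a" "t n = b"
  shows "(\<Sum>i<n. ennreal (dist (\<gamma> (t i)) (\<gamma> (t (Suc i))))) \<le> curve_length \<gamma> a b"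
  unfolding curve_length_def by (rule SUP_upper2[of "(n, t)"]) (use assms in auto)

lemma curve_length_leI:
  assumes "\<And>n t. mono_on {..n} t \<Longrightarrow> t 0 = a \<Longrightarrow> t n = b \<Longrightarrow>
    (\<Sum>i<n. ennreal (dist (\<gamma> (t i)) (\<gamma> (t (Suc i))))) \<le> B"
  shows "curve_length \<gamma> a b \<le> B"
  unfolding curve_length_def
proof (rule SUP_least)
  fix P assume "P \<in> {(n :: nat, t). mono_on {..n} t \<and> t 0 = a \<and> t n = b}"
  then obtain n t where "P = (n, t)" "mono_on {..n} t" "t 0 = a" "t n = b" by blast
  with assms[of n t]
  show "(case P of (n, t) \<Rightarrow> \<Sum>i<n. ennreal (dist (\<gamma> (t i)) (\<gamma> (t (Suc i))))) \<le> B" by simp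
qed

lemma dist_le_curve_length:
  assumes "a \<le> b"
  shows "ennreal (dist (\<gamma> a) (\<gamma> b)) \<le> curve_length \<gamma> a b"
  using curve_length_partition_le[of 1 "\<lambda>i. if i = 0 then a else b" a b \<gamma>] assms
  by (auto simp: monotone_on_def)

lemma curve_length_refl [simp]: "curve_length \<gamma> a a = 0"
proof -
  have "curve_length \<gamma> a a \<le> 0"
  proof (rule curve_length_leI)
    fix n and t :: "nat \<Rightarrow> real"
    assume t: "mono_on {..n} t" "t 0 = a" "t n = a"
    have "t i = a" if "i \<le> n" for i
      using monotone_onD[OF t(1), of 0 i] monotone_onD[OF t(1), of i n] t that by auto
    then show "(\<Sum>i<n. ennreal (dist (\<gamma> (t i)) (\<gamma> (t (Suc i))))) \<le> 0"
      by simp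
  qed
  then show ?thesis by simp
qed

lemma mono_on_min_max:
  fixes t :: "'b::linorder \<Rightarrow> 'c::linorder"
  assumes "mono_on A t"
  shows "mono_on A (\<lambda>i. min (t i) c)" "mono_on A (\<lambda>i. max (t i) c)"
  using assms unfolding monotone_on_def by (meson min.mono max.mono order_refl)+

text \<open>For the upper bound a partition is not refined by \<open>c\<close> but truncated at
  \<open>c\<close> from both sides with \<open>min\<close> and \<open>max\<close>: the number of
  nodes is unchanged, and only a step across \<open>c\<close> uses the triangle inequality. For the
  lower bound, partitions of the two pieces are concatenated.\<close>

lemma curve_length_add:
  assumes "a \<le> c" "c \<le> b"
  shows "curve_length \<gamma> a b = curve_length \<gamma> a c + curve_length \<gamma> c b"
proof (rule antisym)
  let ?P = "\<lambda>a b. {(n :: nat, t). mono_on {..n} t \<and> t 0 = a \<and> t n = b}"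
  let ?S = "\<lambda>(n, t). \<Sum>i<n. ennreal (dist (\<gamma> (t i)) (\<gamma> (t (Suc i))))"
  show "curve_length \<gamma> a b \<le> curve_length \<gamma> a c + curve_length \<gamma> c b"
  proof (rule curve_length_leI)
    fix n and t :: "nat \<Rightarrow> real"
    assume t: "mono_on {..n} t" "t 0 = a" "t n = b"
    let ?lo = "\<lambda>i. min (t i) c" and ?hi = "\<lambda>i. max (t i) c"
    have "(\<Sum>i<n. ennreal (dist (\<gamma> (t i)) (\<gamma> (t (Suc i))))) \<le>
        (\<Sum>i<n. ennreal (dist (\<gamma> (?lo i)) (\<gamma> (?lo (Suc i)))) + ennreal (dist (\<gamma> (?hi i)) (\<gamma> (?hi (Suc i)))))"
    proof (rule sum_mono)
      fix i assume "i \<in> {..<n}"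
      then have "t i \<le> t (Suc i)"
        using monotone_onD[OF t(1), of i "Suc i"] by auto
      then have "dist (\<gamma> (t i)) (\<gamma> (t (Suc i))) \<le>
          dist (\<gamma> (?lo i)) (\<gamma> (?lo (Suc i))) + dist (\<gamma> (?hi i)) (\<gamma> (?hi (Suc i)))"
        using dist_triangle[of "\<gamma> (t i)" "\<gamma> (t (Suc i))" "\<gamma> c"] by (auto simp: min_def max_def)
      then show "ennreal (dist (\<gamma> (t i)) (\<gamma> (t (Suc i)))) \<le>
          ennreal (dist (\<gamma> (?lo i)) (\<gamma> (?lo (Suc i)))) + ennreal (dist (\<gamma> (?hi i)) (\<gamma> (?hi (Suc i))))"
        by (simp flip: ennreal_plus)
    qed
    also have "\<dots> = (\<Sum>i<n. ennreal (dist (\<gamma> (?lo i)) (\<gamma> (?lo (Suc i))))) +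
        (\<Sum>i<n. ennreal (dist (\<gamma> (?hi i)) (\<gamma> (?hi (Suc i)))))"
      by (rule sum.distrib)
    also have "\<dots> \<le> curve_length \<gamma> a c + curve_length \<gamma> c b"
    proof (rule add_mono; rule curve_length_partition_le)
      show "mono_on {..n} ?lo" "mono_on {..n} ?hi"
        using mono_on_min_max[OF t(1)] by auto
    qed (use t assms in auto)
    finally show "(\<Sum>i<n. ennreal (dist (\<gamma> (t i)) (\<gamma> (t (Suc i))))) \<le> curve_length \<gamma> a c + curve_length \<gamma> c b" .
  qed
  have ne: "?P x y \<noteq> {}" if "x \<le> y" for x y :: real
  proof -
    have "(1, \<lambda>i. if i = 0 then x else y) \<in> ?P x y" using that by (auto simp: monotone_on_def)
    then show ?thesis by blast
  qed
  have cat: "?S P + ?S Q \<le> curve_length \<gamma> a b" if PQ: "P \<in> ?P a c" "Q \<in> ?P c b" for P Q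
  proof -
    obtain n t m r where P: "P = (n, t)" and Q: "Q = (m, r)" by force
    from PQ have t: "mono_on {..n} t" "t 0 = a" "t n = c" and r: "mono_on {..m} r" "r 0 = c" "r m = b"
      by (auto simp: P Q)
    define q where "q i = (if i \<le> n then t i else r (i - n))" for i
    have tc: "t i \<le> c" if "i \<le> n" for i using monotone_onD[OF t(1), of i n] t that by auto
    have rc: "c \<le> r i" if "i \<le> m" for i using monotone_onD[OF r(1), of 0 i] r that by auto
    \<comment> \<open>At \<open>i = 0\<close> the two branches of \<open>q\<close> agree, because
      \<open>t n = c = r 0\<close>.\<close>
    have qn: "q (n + i) = r i" for i by (cases i) (auto simp: q_def t r)
    have "mono_on {..n + m} q"
    proof (rule monotone_onI)
      fix i j assume ij: "i \<in> {..n + m}" "j \<in> {..n + m}" "i \<le> j"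
      consider "j \<le> n" | "i \<le> n" "n < j" | "n < i" using ij by linarith
      then show "q i \<le> q j"
      proof cases
        case 1 then show ?thesis using monotone_onD[OF t(1), of i j] ij by (simp add: q_def)
      next
        case 2 then show ?thesis using order.trans[OF tc[of i] rc[of "j - n"]] ij by (simp add: q_def)
      next
        case 3 then show ?thesis using monotone_onD[OF r(1), of "i - n" "j - n"] ij by (simp add: q_def)
      qed
    qed
    moreover have "q 0 = a" "q (n + m) = b" by (simp add: q_def t, simp add: qn r)
    ultimately have "(\<Sum>i<n + m. ennreal (dist (\<gamma> (q i)) (\<gamma> (q (Suc i))))) \<le> curve_length \<gamma> a b"
      by (rule curve_length_partition_le)
    moreover have "(\<Sum>i<n + m. ennreal (dist (\<gamma> (q i)) (\<gamma> (q (Suc i))))) =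
        (\<Sum>i<n. ennreal (dist (\<gamma> (q i)) (\<gamma> (q (Suc i))))) +
        (\<Sum>i<m. ennreal (dist (\<gamma> (q (n + i))) (\<gamma> (q (n + Suc i)))))"
      by (induction m) (simp_all add: add.assoc)
    moreover have "(\<Sum>i<n. ennreal (dist (\<gamma> (q i)) (\<gamma> (q (Suc i))))) = ?S P"
      by (simp add: P q_def)
    moreover have "(\<Sum>i<m. ennreal (dist (\<gamma> (q (n + i))) (\<gamma> (q (n + Suc i))))) = ?S Q"
      unfolding qn by (simp add: Q)
    ultimately show ?thesis by simp
  qed
  have "curve_length \<gamma> a c + curve_length \<gamma> c b = (SUP P\<in>?P a c. ?S P + curve_length \<gamma> c b)"
    unfolding curve_length_def[of \<gamma> a c] by (rule ennreal_SUP_add_left[symmetric]) (rule ne[OF assms(1)])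
  also have "\<dots> \<le> curve_length \<gamma> a b"
  proof (rule SUP_least)
    fix P assume P: "P \<in> ?P a c"
    have "?S P + curve_length \<gamma> c b = (SUP Q\<in>?P c b. ?S P + ?S Q)"
      unfolding curve_length_def[of \<gamma> c b] by (rule ennreal_SUP_add_right) (rule ne[OF assms(2)])
    also have "\<dots> \<le> curve_length \<gamma> a b" using cat[OF P] by (intro SUP_least)
    finally show "?S P + curve_length \<gamma> c b \<le> curve_length \<gamma> a b" .
  qed
  finally show "curve_length \<gamma> a c + curve_length \<gamma> c b \<le> curve_length \<gamma> a b" .
qed

text \<open>Intermediate values of the length function. The witness is the supremum \<open>c\<close>
  of the parameters reached with length at most \<open>s\<close>. Length is a supremum of sums that
  depend continuously on the truncation point, so upper bounds for it survive limits: from the left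
  they bound the length before \<open>c\<close>, from the right the length after
  \<open>c\<close>.\<close>

lemma curve_length_surj:
  assumes rc: "rectifiable_curve \<gamma> a b" and s: "0 \<le> s" "ennreal s \<le> curve_length \<gamma> a b"
  obtains \<tau> where "\<tau> \<in> {a..b}" "curve_length \<gamma> a \<tau> = ennreal s"
proof -
  from rc have ab: "a < b" and cont: "continuous_on {a..b} \<gamma>" and fin: "curve_length \<gamma> a b < \<infinity>"
    by (auto simp: rectifiable_curve_def)
  define A where "A = {\<tau>\<in>{a..b}. curve_length \<gamma> a \<tau> \<le> ennreal s}"
  define c where "c = Sup A"
  have aA: "a \<in> A" using ab by (simp add: A_def)
  have bdd: "bdd_above A" by (auto simp: A_def intro!: bdd_aboveI[of _ b])
  have cab: "a \<le> c" "c \<le> b"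
    unfolding c_def using aA by (rule cSup_upper[OF _ bdd], intro cSup_least) (auto simp: A_def)
  have cl: "c \<in> closure A" unfolding c_def using aA bdd by (intro closure_contains_Sup) auto
  have clA: "closure A \<subseteq> {a..b}" by (rule closure_minimal) (auto simp: A_def)
  have cont_min: "continuous_on {a..b} (\<lambda>\<tau>. \<gamma> (min x \<tau>))"
    and cont_max: "continuous_on {a..b} (\<lambda>\<tau>. \<gamma> (max x \<tau>))" if "x \<in> {a..b}" for x
    using that by (intro continuous_on_compose2[OF cont] continuous_intros; auto)+
  have cont_lo: "continuous_on {a..b} (\<lambda>\<tau>. \<Sum>i<n. dist (\<gamma> (min (t i) \<tau>)) (\<gamma> (min (t (Suc i)) \<tau>)))"
    and cont_hi: "continuous_on {a..b} (\<lambda>\<tau>. \<Sum>i<n. dist (\<gamma> (max (t i) \<tau>)) (\<gamma> (max (t (Suc i)) \<tau>)))"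
    if t: "\<And>i. i \<le> n \<Longrightarrow> t i \<in> {a..b}" for n and t :: "nat \<Rightarrow> real"
    by (rule continuous_on_sum, rule continuous_on_dist;
        (rule cont_min cont_max), (use t in auto))+
  have le: "curve_length \<gamma> a c \<le> ennreal s"
  proof (rule curve_length_leI)
    fix n and t :: "nat \<Rightarrow> real"
    assume t: "mono_on {..n} t" "t 0 = a" "t n = c"
    have tr: "t i \<in> {a..c}" if "i \<le> n" for i
      using monotone_onD[OF t(1), of 0 i] monotone_onD[OF t(1), of i n] t that by auto
    have "(\<Sum>i<n. dist (\<gamma> (min (t i) c)) (\<gamma> (min (t (Suc i)) c))) \<le> s"
    proof (rule continuous_le_on_closure[OF _ cl])
      show "continuous_on (closure A) (\<lambda>\<tau>. \<Sum>i<n. dist (\<gamma> (min (t i) \<tau>)) (\<gamma> (min (t (Suc i)) \<tau>)))"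
        by (rule continuous_on_subset[OF cont_lo clA]) (use tr cab in force)
    next
      fix \<tau> assume \<tau>: "\<tau> \<in> A"
      then have "\<tau> \<le> c" using bdd by (simp add: c_def cSup_upper)
      then have "(\<Sum>i<n. ennreal (dist (\<gamma> (min (t i) \<tau>)) (\<gamma> (min (t (Suc i)) \<tau>)))) \<le> curve_length \<gamma> a \<tau>"
        using t \<tau> by (intro curve_length_partition_le mono_on_min_max) (auto simp: A_def)
      also have "\<dots> \<le> ennreal s" using \<tau> by (simp add: A_def)
      finally show "(\<Sum>i<n. dist (\<gamma> (min (t i) \<tau>)) (\<gamma> (min (t (Suc i)) \<tau>))) \<le> s"
        using s by simp
    qed
    moreover have "(\<Sum>i<n. dist (\<gamma> (min (t i) c)) (\<gamma> (min (t (Suc i)) c))) =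
        (\<Sum>i<n. dist (\<gamma> (t i)) (\<gamma> (t (Suc i))))"
      using tr by (intro sum.cong) (auto simp: min_absorb1)
    ultimately show "(\<Sum>i<n. ennreal (dist (\<gamma> (t i)) (\<gamma> (t (Suc i))))) \<le> ennreal s"
      using s by simp
  qed
  have "ennreal s \<le> curve_length \<gamma> a c"
  proof (cases "c = b")
    case False
    define L where "L = enn2real (curve_length \<gamma> a b)"
    have L: "curve_length \<gamma> a b = ennreal L" using fin by (simp add: L_def)
    have "0 \<le> L" by (simp add: L_def)
    then have sL: "s \<le> L" using s L by simp
    \<comment> \<open>Beyond \<open>c\<close> the length from \<open>a\<close> exceeds
      \<open>s\<close>, so at most \<open>L - s\<close> remains up to \<open>b\<close>; letting the
      parameter decrease to \<open>c\<close> preserves this bound. The lower bound for the length up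
      to \<open>c\<close> then follows by subtraction.\<close>
    have "curve_length \<gamma> c b \<le> ennreal (L - s)"
    proof (rule curve_length_leI)
      fix n and t :: "nat \<Rightarrow> real"
      assume t: "mono_on {..n} t" "t 0 = c" "t n = b"
      have tr: "t i \<in> {c..b}" if "i \<le> n" for i
        using monotone_onD[OF t(1), of 0 i] monotone_onD[OF t(1), of i n] t that by auto
      have cb: "closure {c<..<b} = {c..b}" using cab False by (intro closure_greaterThanLessThan) auto
      have cl': "c \<in> closure {c<..<b}" using cab False by (simp add: cb)
      have "(\<Sum>i<n. dist (\<gamma> (max (t i) c)) (\<gamma> (max (t (Suc i)) c))) \<le> L - s"
      proof (rule continuous_le_on_closure[OF _ cl'])
        show "continuous_on (closure {c<..<b}) (\<lambda>\<tau>. \<Sum>i<n. dist (\<gamma> (max (t i) \<tau>)) (\<gamma> (max (t (Suc i)) \<tau>)))"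
          by (rule continuous_on_subset[OF cont_hi]) (use tr cab in \<open>force simp: cb\<close>)+
      next
        fix \<tau> assume \<tau>: "\<tau> \<in> {c<..<b}"
        then have "\<tau> \<notin> A" using bdd cSup_upper[of \<tau> A] by (auto simp: c_def)
        then have gt: "ennreal s < curve_length \<gamma> a \<tau>" using \<tau> cab by (auto simp: A_def)
        have "ennreal s + curve_length \<gamma> \<tau> b \<le> curve_length \<gamma> a \<tau> + curve_length \<gamma> \<tau> b"
          using gt by (intro add_right_mono) auto
        also have "\<dots> = ennreal L" using \<tau> cab by (simp flip: L curve_length_add)
        finally have "curve_length \<gamma> \<tau> b \<le> ennreal (L - s)"
          using s sL by (cases "curve_length \<gamma> \<tau> b") (auto simp flip: ennreal_plus simp: top_unique)
        moreover have "(\<Sum>i<n. ennreal (dist (\<gamma> (max (t i) \<tau>)) (\<gamma> (max (t (Suc i)) \<tau>)))) \<le> curve_length \<gamma> \<tau> b"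
          using t \<tau> by (intro curve_length_partition_le mono_on_min_max) auto
        ultimately have "(\<Sum>i<n. ennreal (dist (\<gamma> (max (t i) \<tau>)) (\<gamma> (max (t (Suc i)) \<tau>)))) \<le> ennreal (L - s)"
          by (rule order.trans[rotated])
        then show "(\<Sum>i<n. dist (\<gamma> (max (t i) \<tau>)) (\<gamma> (max (t (Suc i)) \<tau>))) \<le> L - s"
          using sL by simp
      qed
      moreover have "(\<Sum>i<n. dist (\<gamma> (max (t i) c)) (\<gamma> (max (t (Suc i)) c))) =
          (\<Sum>i<n. dist (\<gamma> (t i)) (\<gamma> (t (Suc i))))"
        using tr by (intro sum.cong) (auto simp: max_absorb1)
      ultimately show "(\<Sum>i<n. ennreal (dist (\<gamma> (t i)) (\<gamma> (t (Suc i))))) \<le> ennreal (L - s)"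
        using sL by simp
    qed
    then have "ennreal L \<le> curve_length \<gamma> a c + ennreal (L - s)"
      using curve_length_add[of a c b \<gamma>] cab L by (simp add: add_left_mono)
    then show ?thesis
      using s sL by (cases "curve_length \<gamma> a c") (auto simp flip: ennreal_plus)
  qed (use s in simp)
  with le that cab show thesis by (metis antisym atLeastAtMost_iff)
qed

text \<open>The piece between the two parameters has length zero, by cancellation of a finite
  length, and so has equal end points. This makes the definite description in
  \<open>arclength_param\<close> unambiguous.\<close>

lemma curve_length_eq_imp_eq:
  assumes "curve_length \<gamma> a \<tau> = curve_length \<gamma> a \<tau>'" "curve_length \<gamma> a \<tau> < \<infinity>" "a \<le> \<tau>" "a \<le> \<tau>'"
  shows "\<gamma> \<tau> = \<gamma> \<tau>'"
  using assms
proof (induction \<tau> \<tau>' rule: linorder_wlog)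
  case (le \<tau> \<tau>')
  then have "curve_length \<gamma> a \<tau> + curve_length \<gamma> \<tau> \<tau>' = curve_length \<gamma> a \<tau> + 0"
    using curve_length_add[of a \<tau> \<tau>' \<gamma>] by simp
  then have "curve_length \<gamma> \<tau> \<tau>' = 0"
    using le.prems(2) by (auto simp: ennreal_add_left_cancel)
  then show ?case using dist_le_curve_length[of \<tau> \<tau>' \<gamma>] le by simp
qed auto

lemma arclength_param_curve_length:
  assumes "\<tau> \<in> {a..b}" "curve_length \<gamma> a \<tau> = ennreal s"
  shows "arclength_param \<gamma> a b s = \<gamma> \<tau>"
  unfolding arclength_param_def
proof (rule the_equality)
  show "\<exists>\<tau>'\<in>{a..b}. curve_length \<gamma> a \<tau>' = ennreal s \<and> \<gamma> \<tau> = \<gamma> \<tau>'" using assms by blast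
  show "y = \<gamma> \<tau>" if "\<exists>\<tau>\<in>{a..b}. curve_length \<gamma> a \<tau> = ennreal s \<and> y = \<gamma> \<tau>" for y
    using that assms curve_length_eq_imp_eq[of \<gamma> a \<tau>] by (force simp: less_top)
qed

lemma arclength_param_ex:
  assumes "rectifiable_curve \<gamma> a b" "0 \<le> s" "s \<le> enn2real (curve_length \<gamma> a b)"
  obtains \<tau> where "\<tau> \<in> {a..b}" "curve_length \<gamma> a \<tau> = ennreal s" "arclength_param \<gamma> a b s = \<gamma> \<tau>"
proof -
  have "ennreal s \<le> ennreal (enn2real (curve_length \<gamma> a b))" using assms by (intro ennreal_leI)
  also have "\<dots> = curve_length \<gamma> a b" using assms(1) by (simp add: rectifiable_curve_def)
  finally obtain \<tau> where \<tau>: "\<tau> \<in> {a..b}" "curve_length \<gamma> a \<tau> = ennreal s"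
    using curve_length_surj[OF assms(1,2)] by blast
  then show thesis using that arclength_param_curve_length[OF \<tau>] by blast
qed

text \<open>Upper gradients are tested on whole curves. By additivity of length the arc between the
  lengths \<open>s\<close> and \<open>t\<close> is itself a rectifiable curve whose arc-length
  parametrization is a translate of the given one, so the test also applies to it.\<close>

lemma rectifiable_subcurve:
  assumes rc: "rectifiable_curve \<gamma> a b" and st: "0 \<le> s" "s < t" "t \<le> enn2real (curve_length \<gamma> a b)"
  obtains \<alpha> \<beta> where "rectifiable_curve \<gamma> \<alpha> \<beta>" "curve_length \<gamma> \<alpha> \<beta> = ennreal (t - s)"
    "\<gamma> \<alpha> = arclength_param \<gamma> a b s" "\<gamma> \<beta> = arclength_param \<gamma> a b t"
    "\<And>x. 0 \<le> x \<Longrightarrow> x \<le> t - s \<Longrightarrow> arclength_param \<gamma> \<alpha> \<beta> x = arclength_param \<gamma> a b (s + x)"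
proof -
  have s: "0 \<le> s" "s \<le> enn2real (curve_length \<gamma> a b)" and t: "0 \<le> t" using st by simp_all
  obtain \<alpha> where \<alpha>: "\<alpha> \<in> {a..b}" "curve_length \<gamma> a \<alpha> = ennreal s" "arclength_param \<gamma> a b s = \<gamma> \<alpha>"
    using arclength_param_ex[OF rc s] by blast
  obtain \<beta> where \<beta>: "\<beta> \<in> {a..b}" "curve_length \<gamma> a \<beta> = ennreal t" "arclength_param \<gamma> a b t = \<gamma> \<beta>"
    using arclength_param_ex[OF rc t st(3)] by blast
  have "\<alpha> < \<beta>"
  proof (rule ccontr)
    assume "\<not> \<alpha> < \<beta>"
    then have "curve_length \<gamma> a \<beta> \<le> curve_length \<gamma> a \<alpha>"
      using curve_length_add[of a \<beta> \<alpha> \<gamma>] \<beta> by simp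
    then show False using \<alpha> \<beta> st by simp
  qed
  have split: "ennreal s + curve_length \<gamma> \<alpha> \<tau> = curve_length \<gamma> a \<tau>" if "\<alpha> \<le> \<tau>" for \<tau>
    using curve_length_add[of a \<alpha> \<tau> \<gamma>] \<alpha> that by simp
  have len: "curve_length \<gamma> \<alpha> \<beta> = ennreal (t - s)"
    using split[of \<beta>] \<beta> st \<open>\<alpha> < \<beta>\<close>
    by (cases "curve_length \<gamma> \<alpha> \<beta>") (auto simp flip: ennreal_plus)
  have rc': "rectifiable_curve \<gamma> \<alpha> \<beta>"
    unfolding rectifiable_curve_def
  proof (intro conjI)
    show "continuous_on {\<alpha>..\<beta>} \<gamma>"
      using rc \<alpha> \<beta> by (auto simp: rectifiable_curve_def intro: continuous_on_subset)
  qed (use \<open>\<alpha> < \<beta>\<close> in \<open>auto simp: len\<close>)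
  show thesis
  proof (rule that[OF rc' len])
    fix x assume x: "0 \<le> x" "x \<le> t - s"
    have "x \<le> enn2real (curve_length \<gamma> \<alpha> \<beta>)" using st x by (simp add: len)
    then obtain \<tau> where \<tau>: "\<tau> \<in> {\<alpha>..\<beta>}" "curve_length \<gamma> \<alpha> \<tau> = ennreal x"
      "arclength_param \<gamma> \<alpha> \<beta> x = \<gamma> \<tau>"
      using arclength_param_ex[OF rc' x(1)] by blast
    have "arclength_param \<gamma> a b (s + x) = \<gamma> \<tau>"
      using \<tau> \<alpha> \<beta> split[of \<tau>] st x by (intro arclength_param_curve_length) auto
    with \<tau> show "arclength_param \<gamma> \<alpha> \<beta> x = arclength_param \<gamma> a b (s + x)" by simp
  qed (use \<alpha> \<beta> in simp_all)
qed

lemma dist_arclength_param: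
  assumes rc: "rectifiable_curve \<gamma> a b" and st: "0 \<le> s" "s \<le> t" "t \<le> enn2real (curve_length \<gamma> a b)"
  shows "dist (arclength_param \<gamma> a b s) (arclength_param \<gamma> a b t) \<le> t - s"
proof (cases "s = t")
  case False
  with st have "s < t" by simp
  from rectifiable_subcurve[OF rc st(1) this st(3)] obtain \<alpha> \<beta> where
    *: "rectifiable_curve \<gamma> \<alpha> \<beta>" "curve_length \<gamma> \<alpha> \<beta> = ennreal (t - s)"
    "\<gamma> \<alpha> = arclength_param \<gamma> a b s" "\<gamma> \<beta> = arclength_param \<gamma> a b t"
    "\<And>x. 0 \<le> x \<Longrightarrow> x \<le> t - s \<Longrightarrow> arclength_param \<gamma> \<alpha> \<beta> x = arclength_param \<gamma> a b (s + x)"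
    by blast
  have "\<alpha> \<le> \<beta>" using *(1) by (simp add: rectifiable_curve_def)
  from dist_le_curve_length[OF this, of \<gamma>] show ?thesis unfolding *(2-4) using st by simp
qed simp

section \<open>Upper gradients along arc-length parametrizations\<close>

text \<open>
  An arc-length parametrization, extended to the line by its end points.  The last clause is all
  that is needed about subcurves.
\<close>

definition unit_speed :: "(real \<Rightarrow> 'a::metric_space) \<Rightarrow> real \<Rightarrow> bool" where
  "unit_speed c L \<longleftrightarrow> 0 < L \<and> 1-lipschitz_on UNIV c \<and>
     (\<forall>g (u :: 'a \<Rightarrow> real) s t. upper_gradient g (\<lambda>x. ereal (u x)) \<and> 0 \<le> s \<and> s \<le> t \<and> t \<le> L \<longrightarrow>
        ennreal \<bar>u (c t) - u (c s)\<bar> \<le> (\<integral>\<^sup>+x\<in>{s..t}. g (c x) \<partial>lborel))"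

lemma unit_speed_measurable:
  assumes "unit_speed c L"
  shows "c \<in> borel_measurable borel"
proof -
  have "1-lipschitz_on UNIV c" using assms by (simp only: unit_speed_def)
  then show ?thesis by (intro borel_measurable_continuous_onI lipschitz_on_continuous_on)
qed

lemma nn_integral_Icc_shift:
  fixes f :: "real \<Rightarrow> ennreal"
  assumes [measurable]: "f \<in> borel_measurable borel"
  shows "(\<integral>\<^sup>+x\<in>{0..t - s}. f (s + x) \<partial>lborel) = (\<integral>\<^sup>+x\<in>{s..t}. f x \<partial>lborel)"
proof -
  have "(\<integral>\<^sup>+x\<in>{s..t}. f x \<partial>lborel) =
      ennreal \<bar>1\<bar> * (\<integral>\<^sup>+x. f (s + 1 * x) * indicator {s..t} (s + 1 * x) \<partial>lborel)"
    by (rule nn_integral_real_affine) auto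
  also have "\<dots> = (\<integral>\<^sup>+x\<in>{0..t - s}. f (s + x) \<partial>lborel)"
    by (auto intro!: nn_integral_cong simp: indicator_def)
  finally show ?thesis by simp
qed

lemma upper_gradient_real_iff:
  "upper_gradient g (\<lambda>x. ereal (u x)) \<longleftrightarrow> g \<in> borel_measurable borel \<and>
    (\<forall>\<gamma> a b. rectifiable_curve \<gamma> a b \<and> \<not> \<gamma> constant_on {a..b} \<longrightarrow>
      ennreal \<bar>u (\<gamma> b) - u (\<gamma> a)\<bar> \<le> curve_integral g \<gamma> a b)"
  by (simp add: upper_gradient_def flip: ennreal.abs_eq)

text \<open>All later curve arguments pass through this reduction: a curve integral becomes a
  Lebesgue integral over \<open>{0..L}\<close> along a Lipschitz map. A non-constant curve has
  \<open>L > 0\<close>, since length zero would make all its points equal.\<close>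

lemma rectifiable_unit_speed:
  fixes \<gamma> :: "real \<Rightarrow> 'a::metric_space"
  assumes rc: "rectifiable_curve \<gamma> a b" and nc: "\<not> \<gamma> constant_on {a..b}"
  obtains c L where "unit_speed c L" "c 0 = \<gamma> a" "c L = \<gamma> b"
    "\<And>g. curve_integral g \<gamma> a b = (\<integral>\<^sup>+x\<in>{0..L}. g (c x) \<partial>lborel)"
proof -
  define L where "L = enn2real (curve_length \<gamma> a b)"
  \<comment> \<open>Clamping the parameter makes \<open>c\<close> Lipschitz on the whole line, hence
    continuous and Borel measurable, without changing it on \<open>{0..L}\<close>.\<close>
  define c where "c s = arclength_param \<gamma> a b (max 0 (min L s))" for s
  have ab: "a < b" and lenL: "curve_length \<gamma> a b = ennreal L"
    using rc by (auto simp: L_def rectifiable_curve_def)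
  have L0: "0 \<le> L" by (simp add: L_def)
  have c_eq: "c s = arclength_param \<gamma> a b s" if "0 \<le> s" "s \<le> L" for s
    using that by (simp add: c_def)
  have "L \<noteq> 0"
  proof
    assume "L = 0"
    have "\<gamma> \<tau> = \<gamma> a" if "\<tau> \<in> {a..b}" for \<tau>
    proof (rule curve_length_eq_imp_eq)
      have "curve_length \<gamma> a \<tau> \<le> curve_length \<gamma> a b"
        using curve_length_add[of a \<tau> b \<gamma>] that by simp
      then show "curve_length \<gamma> a \<tau> = curve_length \<gamma> a a" "curve_length \<gamma> a \<tau> < \<infinity>"
        using lenL \<open>L = 0\<close> by simp_all
    qed (use that in auto)
    then show False using nc unfolding constant_on_def by blast
  qed
  with L0 have Lpos: "0 < L" by simp
  have c0: "c 0 = \<gamma> a" using Lpos ab by (simp add: c_eq) (rule arclength_param_curve_length; simp)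
  have cL: "c L = \<gamma> b" using Lpos ab lenL by (simp add: c_eq) (rule arclength_param_curve_length; simp)
  have lip: "1-lipschitz_on UNIV c"
  proof (rule lipschitz_onI)
    fix s t :: real
    show "dist (c s) (c t) \<le> 1 * dist s t"
    proof (induction s t rule: linorder_wlog)
      case (le s t)
      have "dist (c s) (c t) \<le> max 0 (min L t) - max 0 (min L s)"
        unfolding c_def by (rule dist_arclength_param[OF rc]) (use le Lpos in \<open>auto simp flip: L_def\<close>)
      then show ?case using le by (simp add: dist_real_def)
    qed (simp add: dist_commute)
  qed simp
  then have cm [measurable]: "c \<in> borel_measurable borel"
    by (intro borel_measurable_continuous_onI lipschitz_on_continuous_on)
  have int: "curve_integral g \<gamma> a b = (\<integral>\<^sup>+x\<in>{0..L}. g (c x) \<partial>lborel)" for g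
    unfolding curve_integral_def L_def[symmetric]
    by (intro nn_integral_cong) (auto simp: indicator_def c_eq)
  have ug: "ennreal \<bar>u (c t) - u (c s)\<bar> \<le> (\<integral>\<^sup>+x\<in>{s..t}. g (c x) \<partial>lborel)"
    if g: "upper_gradient g (\<lambda>x. ereal (u x))" and st: "0 \<le> s" "s \<le> t" "t \<le> L"
    for g and u :: "'a \<Rightarrow> real" and s t
  \<comment> \<open>The definition of an upper gradient speaks of non-constant curves only. If the
    end points coincide the left side is zero; otherwise the subcurve is not constant.\<close>
  proof (cases "c s = c t")
    case False
    then have "s < t" using st by (cases "s = t") auto
    from rectifiable_subcurve[OF rc st(1) this] st(3) obtain \<alpha> \<beta> where
      sub: "rectifiable_curve \<gamma> \<alpha> \<beta>" "curve_length \<gamma> \<alpha> \<beta> = ennreal (t - s)"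
      "\<gamma> \<alpha> = arclength_param \<gamma> a b s" "\<gamma> \<beta> = arclength_param \<gamma> a b t"
      "\<And>x. 0 \<le> x \<Longrightarrow> x \<le> t - s \<Longrightarrow> arclength_param \<gamma> \<alpha> \<beta> x = arclength_param \<gamma> a b (s + x)"
      unfolding L_def by blast
    have [measurable]: "g \<in> borel_measurable borel" using g by (simp add: upper_gradient_def)
    have ends: "\<gamma> \<alpha> = c s" "\<gamma> \<beta> = c t" using sub st \<open>s < t\<close> by (simp_all add: c_eq)
    have "\<alpha> < \<beta>" using sub(1) by (simp add: rectifiable_curve_def)
    then have "\<not> \<gamma> constant_on {\<alpha>..\<beta>}"
      using False ends by (metis atLeastAtMost_iff constant_on_def less_imp_le order_refl)
    then have "ennreal \<bar>u (\<gamma> \<beta>) - u (\<gamma> \<alpha>)\<bar> \<le> curve_integral g \<gamma> \<alpha> \<beta>"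
      using g sub(1) by (simp add: upper_gradient_real_iff)
    also have "\<dots> = (\<integral>\<^sup>+x\<in>{0..t - s}. g (c (s + x)) \<partial>lborel)"
      unfolding curve_integral_def sub(2)
      using st \<open>s < t\<close> by (intro nn_integral_cong) (auto simp: indicator_def c_eq sub(5))
    also have "\<dots> = (\<integral>\<^sup>+x\<in>{s..t}. g (c x) \<partial>lborel)"
      by (rule nn_integral_Icc_shift) simp
    finally show ?thesis by (simp add: ends)
  qed simp
  have "unit_speed c L" unfolding unit_speed_def using Lpos lip ug by blast
  then show thesis using c0 cL int that by blast
qed

text \<open>Curves with an infinite integral satisfy the inequality trivially, so finiteness may be
  assumed. Through this a summand \<open>top * indicator E\<close> in \<open>g\<close> removes every
  curve that spends positive length in \<open>E\<close>.\<close>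

lemma upper_gradientI_unit_speed:
  fixes u :: "'a::metric_space \<Rightarrow> real"
  assumes "g \<in> borel_measurable borel"
    and "\<And>c L. unit_speed c L \<Longrightarrow> (\<integral>\<^sup>+x\<in>{0..L}. g (c x) \<partial>lborel) < \<infinity> \<Longrightarrow>
      ennreal \<bar>u (c L) - u (c 0)\<bar> \<le> (\<integral>\<^sup>+x\<in>{0..L}. g (c x) \<partial>lborel)"
  shows "upper_gradient g (\<lambda>x. ereal (u x))"
  unfolding upper_gradient_real_iff
proof (intro conjI allI impI assms(1))
  fix \<gamma> :: "real \<Rightarrow> 'a" and a b assume "rectifiable_curve \<gamma> a b \<and> \<not> \<gamma> constant_on {a..b}"
  with rectifiable_unit_speed[of \<gamma> a b] obtain c L where "unit_speed c L" "c 0 = \<gamma> a" "c L = \<gamma> b"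
    "curve_integral g \<gamma> a b = (\<integral>\<^sup>+x\<in>{0..L}. g (c x) \<partial>lborel)"
    by metis
  then show "ennreal \<bar>u (\<gamma> b) - u (\<gamma> a)\<bar> \<le> curve_integral g \<gamma> a b"
    using assms(2)[of c L] by (cases "curve_integral g \<gamma> a b < \<infinity>") (auto simp flip: top.not_eq_extremum)
qed

lemma upper_gradient_unit_speed:
  assumes "upper_gradient g (\<lambda>x. ereal (u x))" "unit_speed c L" "0 \<le> s" "s \<le> t" "t \<le> L"
  shows "ennreal \<bar>u (c t) - u (c s)\<bar> \<le> (\<integral>\<^sup>+x\<in>{s..t}. g (c x) \<partial>lborel)"
  using assms unfolding unit_speed_def by blast

section \<open>Powers and Lp norms of extended nonnegative functions\<close>

lemma ennreal_powr_top [simp]: "ennreal_powr top p = top"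
  by (simp add: ennreal_powr_def)

lemma ennreal_powr_ennreal [simp]: "0 \<le> x \<Longrightarrow> ennreal_powr (ennreal x) p = ennreal (x powr p)"
  by (simp add: ennreal_powr_def)

lemma ennreal_powr_0 [simp]: "ennreal_powr 0 p = 0"
  by (simp add: ennreal_powr_def)

lemma ennreal_powr_eq_0_iff [simp]: "ennreal_powr a p = 0 \<longleftrightarrow> a = 0"
  by (cases a) auto

lemma ennreal_powr_less_top_iff [simp]: "ennreal_powr a p < top \<longleftrightarrow> a < top"
  by (cases a) auto

lemma ennreal_powr_eq_top_iff [simp]: "ennreal_powr a p = top \<longleftrightarrow> a = top"
  by (cases a) auto

lemma ennreal_powr_mono:
  assumes "0 \<le> p" "a \<le> b"
  shows "ennreal_powr a p \<le> ennreal_powr b p"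
  using assms by (cases a; cases b) (auto intro!: ennreal_leI powr_mono2 simp: top_unique)

lemma ennreal_powr_mult: "ennreal_powr (a * b) p = ennreal_powr a p * ennreal_powr b p"
proof (cases "a = 0 \<or> b = 0")
  case False
  then show ?thesis
    by (cases a; cases b) (auto simp: ennreal_top_mult ennreal_mult_top powr_mult ennreal_mult[symmetric])
qed auto

lemma ennreal_powr_powr: "ennreal_powr (ennreal_powr a p) q = ennreal_powr a (p * q)"
  by (cases a) (auto simp: powr_powr)

lemma ennreal_powr_one [simp]: "ennreal_powr a 1 = a"
  by (cases a) auto

lemma ennreal_powr_inverse:
  assumes "0 < p"
  shows "ennreal_powr (ennreal_powr a p) (1 / p) = a" "ennreal_powr (ennreal_powr a (1 / p)) p = a"
  using assms by (simp_all add: ennreal_powr_powr)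

lemma ennreal_powr_le_iff:
  assumes "0 < p"
  shows "ennreal_powr a p \<le> ennreal_powr b p \<longleftrightarrow> a \<le> b"
  using ennreal_powr_mono[of p a b] ennreal_powr_mono[of "1 / p" "ennreal_powr a p" "ennreal_powr b p"] assms
  by (auto simp: ennreal_powr_inverse)

text \<open>For \<open>p > 0\<close> the power is an order isomorphism of the extended half-line
  with inverse the power \<open>1 / p\<close>.\<close>

lemma ennreal_powr_SUP:
  assumes "0 < p"
  shows "ennreal_powr (SUP i\<in>I. f i) p = (SUP i\<in>I. ennreal_powr (f i) p)"
proof (rule antisym)
  have "(SUP i\<in>I. f i) \<le> ennreal_powr (SUP i\<in>I. ennreal_powr (f i) p) (1 / p)"
  proof (rule SUP_least)
    fix i assume "i \<in> I"
    then have "ennreal_powr (ennreal_powr (f i) p) (1 / p) \<le> ennreal_powr (SUP i\<in>I. ennreal_powr (f i) p) (1 / p)"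
      using assms by (intro ennreal_powr_mono SUP_upper) auto
    then show "f i \<le> ennreal_powr (SUP i\<in>I. ennreal_powr (f i) p) (1 / p)"
      using assms by (simp add: ennreal_powr_inverse)
  qed
  then have "ennreal_powr (SUP i\<in>I. f i) p \<le> ennreal_powr (ennreal_powr (SUP i\<in>I. ennreal_powr (f i) p) (1 / p)) p"
    using assms by (intro ennreal_powr_mono) auto
  then show "ennreal_powr (SUP i\<in>I. f i) p \<le> (SUP i\<in>I. ennreal_powr (f i) p)"
    using assms by (simp add: ennreal_powr_inverse)
  show "(SUP i\<in>I. ennreal_powr (f i) p) \<le> ennreal_powr (SUP i\<in>I. f i) p"
    using assms by (intro SUP_least ennreal_powr_mono SUP_upper) auto
qed

lemma ennreal_powr_measurable [measurable]:
  "f \<in> borel_measurable M \<Longrightarrow> (\<lambda>x. ennreal_powr (f x) p) \<in> borel_measurable M"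
proof -
  assume [measurable]: "f \<in> borel_measurable M"
  have "{x \<in> space M. f x = \<infinity>} \<in> sets M" by measurable
  then show ?thesis unfolding ennreal_powr_def by (intro measurable_If) auto
qed

text \<open>For positive \<open>x\<close> and \<open>y\<close> this is the convexity of the power;
  if one of them is zero, it reduces to \<open>r powr p \<le> r\<close> for
  \<open>0 \<le> r \<le> 1\<close>.\<close>

lemma powr_convex_nonneg:
  fixes x y s t p :: real
  assumes "1 \<le> p" "0 \<le> x" "0 \<le> y" "0 \<le> s" "0 \<le> t" "s + t = 1"
  shows "(s * x + t * y) powr p \<le> s * x powr p + t * y powr p"
proof -
  have *: "(r * z) powr p \<le> r * z powr p" if "0 \<le> r" "r \<le> 1" "0 \<le> z" for r z :: real
  proof -
    have "r powr p \<le> r powr 1" using that assms by (intro powr_mono') auto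
    then show ?thesis using that by (simp add: powr_mult mult_right_mono)
  qed
  have "s = 1 - t" using assms by simp
  consider "x = 0" | "y = 0" | "0 < x" "0 < y" using assms by linarith
  then show ?thesis
  proof cases
    case 3
    then show ?thesis
      using convex_onD[OF powr_convex[OF assms(1)], of t x y] assms(4-6) by (simp flip: \<open>s = 1 - t\<close>)
  qed (use *[of t y] *[of s x] assms in auto)
qed

definition Lp_norm :: "'a measure \<Rightarrow> real \<Rightarrow> ('a \<Rightarrow> ennreal) \<Rightarrow> ennreal" where
  "Lp_norm M p g = ennreal_powr (\<integral>\<^sup>+x. ennreal_powr (g x) p \<partial>M) (1 / p)"

lemma Lp_norm_powr: "0 < p \<Longrightarrow> ennreal_powr (Lp_norm M p g) p = (\<integral>\<^sup>+x. ennreal_powr (g x) p \<partial>M)"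
  by (simp add: Lp_norm_def ennreal_powr_inverse)

lemma Lp_norm_less_top_iff: "Lp_norm M p g < top \<longleftrightarrow> (\<integral>\<^sup>+x. ennreal_powr (g x) p \<partial>M) < top"
  by (simp add: Lp_norm_def)

lemma Lp_norm_le_iff:
  assumes "0 < p"
  shows "Lp_norm M p g \<le> a \<longleftrightarrow> (\<integral>\<^sup>+x. ennreal_powr (g x) p \<partial>M) \<le> ennreal_powr a p"
  using ennreal_powr_le_iff[OF assms, of "Lp_norm M p g" a] Lp_norm_powr[OF assms, of M g] by simp

lemma Lp_norm_mono_AE:
  assumes "0 < p" "AE x in M. f x \<le> g x"
  shows "Lp_norm M p f \<le> Lp_norm M p g"
  unfolding Lp_norm_def using assms
  by (intro ennreal_powr_mono nn_integral_mono_AE) (auto elim!: eventually_mono intro: ennreal_powr_mono)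

lemma Lp_norm_cmult:
  assumes "0 < p" and [measurable]: "g \<in> borel_measurable M"
  shows "Lp_norm M p (\<lambda>x. c * g x) = c * Lp_norm M p g"
  by (simp add: Lp_norm_def ennreal_powr_mult nn_integral_cmult ennreal_powr_inverse assms)

lemma Lp_norm_null:
  assumes "0 < p" "N \<in> null_sets M"
  shows "Lp_norm M p (\<lambda>x. top * indicator N x) = 0"
proof -
  have "Lp_norm M p (\<lambda>x. top * indicator N x) \<le> Lp_norm M p (\<lambda>x. 0)"
    using assms(2) by (intro Lp_norm_mono_AE assms(1)) (auto dest!: AE_not_in elim!: eventually_mono)
  then show ?thesis by (simp add: Lp_norm_def)
qed

text \<open>Minkowski's inequality from convexity. For \<open>a > A\<close> and \<open>b > B\<close>
  the sum \<open>(f + g) / (a + b)\<close> is the convex combination of \<open>f / a\<close> and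
  \<open>g / b\<close> with weights \<open>a / (a + b)\<close> and \<open>b / (a + b)\<close>;
  integrating the convexity inequality bounds the norm of the sum by \<open>a + b\<close>. Strict
  majorants \<open>a\<close>, \<open>b\<close> are positive even if a norm vanishes.\<close>

lemma Lp_norm_triangle:
  assumes p: "1 \<le> p" and [measurable]: "f \<in> borel_measurable M" "g \<in> borel_measurable M"
  shows "Lp_norm M p (\<lambda>x. f x + g x) \<le> Lp_norm M p f + Lp_norm M p g"
proof (cases "Lp_norm M p f = top \<or> Lp_norm M p g = top")
  case False
  then obtain A B where A: "Lp_norm M p f = ennreal A" "0 \<le> A" and B: "Lp_norm M p g = ennreal B" "0 \<le> B"
    by (cases "Lp_norm M p f"; cases "Lp_norm M p g") auto
  have *: "Lp_norm M p (\<lambda>x. f x + g x) \<le> ennreal (a + b)" if ab: "A < a" "B < b" for a b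
  proof -
    have pos: "0 < a" "0 < b" using that A B by linarith+
    \<comment> \<open>The coefficients of \<open>x powr p\<close> and \<open>y powr p\<close> after
      the convexity inequality is multiplied by \<open>(a + b) powr p\<close>. They satisfy
      \<open>c * a powr p + d * b powr p = (a + b) powr p\<close>.\<close>
    define c d where "c = (a + b) powr p * (a / (a + b)) / a powr p"
      and "d = (a + b) powr p * (b / (a + b)) / b powr p"
    have cd0: "0 \<le> c" "0 \<le> d" using pos by (simp_all add: c_def d_def)
    have real: "(x + y) powr p \<le> c * x powr p + d * y powr p" if "0 \<le> x" "0 \<le> y" for x y
    proof -
      have "(a / (a + b) * (x / a) + b / (a + b) * (y / b)) powr p \<le>
          a / (a + b) * (x / a) powr p + b / (a + b) * (y / b) powr p"
        using p pos that by (intro powr_convex_nonneg) (auto simp flip: add_divide_distrib)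
      moreover have "a / (a + b) * (x / a) + b / (a + b) * (y / b) = (x + y) / (a + b)"
        using pos by (simp add: add_divide_distrib)
      ultimately have "(x + y) powr p / (a + b) powr p \<le>
          a / (a + b) * (x powr p / a powr p) + b / (a + b) * (y powr p / b powr p)"
        using pos that by (simp add: powr_divide)
      then have "(x + y) powr p \<le> (a / (a + b) * (x powr p / a powr p) + b / (a + b) * (y powr p / b powr p)) * (a + b) powr p"
        using pos by (subst (asm) pos_divide_le_eq) auto
      then show ?thesis by (simp add: c_def d_def algebra_simps)
    qed
    have pw: "ennreal_powr (x + y) p \<le> ennreal c * ennreal_powr x p + ennreal d * ennreal_powr y p" for x y
    proof (cases "x = top \<or> y = top")
      case True
      then show ?thesis using pos by (auto simp: c_def d_def ennreal_mult_top)
    next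
      case False
      then show ?thesis using real cd0
        by (cases x; cases y) (auto simp flip: ennreal_plus ennreal_mult intro!: ennreal_leI)
    qed
    have "(\<integral>\<^sup>+x. ennreal_powr (f x + g x) p \<partial>M) \<le>
        (\<integral>\<^sup>+x. ennreal c * ennreal_powr (f x) p + ennreal d * ennreal_powr (g x) p \<partial>M)"
      by (intro nn_integral_mono pw)
    also have "\<dots> = ennreal c * (\<integral>\<^sup>+x. ennreal_powr (f x) p \<partial>M) + ennreal d * (\<integral>\<^sup>+x. ennreal_powr (g x) p \<partial>M)"
      by (simp add: nn_integral_add nn_integral_cmult)
    also have "\<dots> = ennreal c * ennreal_powr (Lp_norm M p f) p + ennreal d * ennreal_powr (Lp_norm M p g) p"
      using p by (simp add: Lp_norm_powr)
    also have "\<dots> \<le> ennreal c * ennreal (a powr p) + ennreal d * ennreal (b powr p)"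
      using ab A B p by (intro add_mono mult_left_mono) (auto intro!: ennreal_leI powr_mono2)
    also have "\<dots> = ennreal (c * a powr p + d * b powr p)"
      using cd0 by (simp add: ennreal_mult ennreal_plus)
    also have "c * a powr p + d * b powr p = (a + b) powr p"
    proof -
      have "c * a powr p + d * b powr p = (a + b) powr p * (a / (a + b) + b / (a + b))"
        using pos by (simp add: c_def d_def distrib_left)
      also have "a / (a + b) + b / (a + b) = 1" using pos by (simp flip: add_divide_distrib)
      finally show ?thesis by simp
    qed
    finally show ?thesis using p pos by (simp add: Lp_norm_le_iff del: ennreal_plus)
  qed
  show ?thesis unfolding A B
  proof (rule ennreal_le_epsilon)
    fix e :: real assume "0 < e"
    then have "Lp_norm M p (\<lambda>x. f x + g x) \<le> ennreal ((A + e / 2) + (B + e / 2))" by (intro *) auto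
    then show "Lp_norm M p (\<lambda>x. f x + g x) \<le> ennreal A + ennreal B + ennreal e"
      using A B \<open>0 < e\<close> by (simp flip: ennreal_plus add: algebra_simps)
  qed
qed auto

lemma Lp_norm_suminf:
  assumes p: "1 \<le> p" and [measurable]: "\<And>i. g i \<in> borel_measurable M"
  shows "Lp_norm M p (\<lambda>x. \<Sum>i. g i x) \<le> (\<Sum>i. Lp_norm M p (g i))"
proof -
  have p0: "0 < p" using p by simp
  have fin: "Lp_norm M p (\<lambda>x. \<Sum>i<n. g i x) \<le> (\<Sum>i<n. Lp_norm M p (g i))" for n
  proof (induction n)
    case (Suc n)
    have "Lp_norm M p (\<lambda>x. \<Sum>i<Suc n. g i x) \<le> Lp_norm M p (\<lambda>x. \<Sum>i<n. g i x) + Lp_norm M p (g n)"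
      using Lp_norm_triangle[OF p, of "\<lambda>x. \<Sum>i<n. g i x" M "g n"] by simp
    with Suc show ?case by (simp add: add_right_mono order.trans)
  qed (simp add: Lp_norm_def)
  have inc: "incseq (\<lambda>n x. \<Sum>i<n. g i x)"
    by (auto simp: incseq_def le_fun_def intro!: sum_mono2)
  have "(\<integral>\<^sup>+x. ennreal_powr (\<Sum>i. g i x) p \<partial>M) = (\<integral>\<^sup>+x. (SUP n. ennreal_powr (\<Sum>i<n. g i x) p) \<partial>M)"
    using p0 by (simp add: suminf_eq_SUP ennreal_powr_SUP)
  also have "\<dots> = (SUP n. \<integral>\<^sup>+x. ennreal_powr (\<Sum>i<n. g i x) p \<partial>M)"
    using inc p0 by (intro nn_integral_monotone_convergence_SUP)
      (auto simp: incseq_def le_fun_def intro!: ennreal_powr_mono)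
  finally have "Lp_norm M p (\<lambda>x. \<Sum>i. g i x) = (SUP n. Lp_norm M p (\<lambda>x. \<Sum>i<n. g i x))"
    using p0 by (simp add: Lp_norm_def ennreal_powr_SUP)
  also have "\<dots> \<le> (\<Sum>i. Lp_norm M p (g i))"
    by (intro SUP_least order.trans[OF fin] sum_le_suminf) auto
  finally show ?thesis .
qed

section \<open>Uniform convexity and convex combinations\<close>

text \<open>The mean value theorem on each half of the interval compares the two increments: the
  derivative is strictly increasing because \<open>p > 1\<close>, so the right half rises more. Only
  interior derivatives enter, which admits \<open>x = 0\<close>.\<close>

lemma powr_strict_midpoint:
  fixes x y p :: real
  assumes "1 < p" "0 \<le> x" "x < y"
  shows "((x + y) / 2) powr p < (x powr p + y powr p) / 2"
proof -
  define m where "m = (x + y) / 2"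
  have m: "x < m" "m < y" "m - x = (y - x) / 2" "y - m = (y - x) / 2" using assms by (auto simp: m_def field_simps)
  have mvt: "\<exists>z>a. z < b \<and> b powr p - a powr p = (b - a) * (p * z powr (p - 1))" if "0 \<le> a" "a < b" for a b
  proof -
    have d: "((\<lambda>z. z powr p) has_real_derivative p * z powr (p - 1)) (at z)" if "a < z" for z
      using that \<open>0 \<le> a\<close> by (intro has_real_derivative_powr) auto
    have "\<exists>l z. a < z \<and> z < b \<and> ((\<lambda>z. z powr p) has_real_derivative l) (at z) \<and> b powr p - a powr p = (b - a) * l"
      using that assms d by (intro MVT continuous_on_powr' continuous_intros) (auto simp: real_differentiable_def)
    then show ?thesis using d DERIV_unique by blast
  qed
  obtain z1 where z1: "x < z1" "z1 < m" "m powr p - x powr p = (m - x) * (p * z1 powr (p - 1))"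
    using mvt[of x m] assms m by auto
  obtain z2 where z2: "m < z2" "z2 < y" "y powr p - m powr p = (y - m) * (p * z2 powr (p - 1))"
    using mvt[of m y] assms m by auto
  have "z1 powr (p - 1) < z2 powr (p - 1)" using z1 z2 assms by (intro powr_less_mono2) auto
  then have "(m - x) * (p * z1 powr (p - 1)) < (y - m) * (p * z2 powr (p - 1))"
    using assms m by (simp only: m) simp
  then have "m powr p - x powr p < y powr p - m powr p" by (simp only: z1(3) z2(3))
  then show ?thesis unfolding m_def[symmetric] by (simp add: field_simps)
qed

lemma powr_abs_strict_midpoint:
  fixes a b p :: real
  assumes "1 < p" "a \<noteq> b"
  shows "\<bar>(a + b) / 2\<bar> powr p < (\<bar>a\<bar> powr p + \<bar>b\<bar> powr p) / 2"
proof (cases "\<bar>a\<bar> = \<bar>b\<bar>")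
  case True
  then have "b = - a" "a \<noteq> 0" using assms by (auto simp: abs_if split: if_splits)
  then show ?thesis by simp
next
  case False
  have "\<bar>(a + b) / 2\<bar> powr p \<le> ((\<bar>a\<bar> + \<bar>b\<bar>) / 2) powr p"
    using assms by (intro powr_mono2) auto
  also have "\<dots> < (\<bar>a\<bar> powr p + \<bar>b\<bar> powr p) / 2"
    using False powr_strict_midpoint[of p "\<bar>a\<bar>" "\<bar>b\<bar>"] powr_strict_midpoint[of p "\<bar>b\<bar>" "\<bar>a\<bar>"] assms
    by (cases "\<bar>a\<bar> < \<bar>b\<bar>") (simp_all add: add.commute)
  finally show ?thesis .
qed

text \<open>In terms of the midpoint defect \<open>D\<close> the claim is that
  \<open>\<bar>a - b\<bar> powr p\<close> is at most
  \<open>e * (\<bar>a\<bar> powr p + \<bar>b\<bar> powr p)\<close> plus \<open>K\<close> times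
  \<open>D\<close>. Both sides are homogeneous of degree \<open>p\<close>, so the sum of powers may
  be taken to be 1. Where \<open>\<bar>a - b\<bar> powr p < e\<close> the first term suffices; the
  remaining pairs form the compact set \<open>T\<close>, on which strict convexity keeps
  \<open>D\<close> away from zero. This additive form can be summed and integrated with the same
  \<open>K\<close>.\<close>

lemma powr_abs_uniformly_convex:
  fixes p e :: real
  assumes p: "1 < p" and e: "0 < e"
  obtains K where "0 < K" "\<And>a b. \<bar>a - b\<bar> powr p + K * \<bar>(a + b) / 2\<bar> powr p \<le> (e + K / 2) * (\<bar>a\<bar> powr p + \<bar>b\<bar> powr p)"
proof -
  define D :: "real \<times> real \<Rightarrow> real" where
    "D = (\<lambda>z. (\<bar>fst z\<bar> powr p + \<bar>snd z\<bar> powr p) / 2 - \<bar>(fst z + snd z) / 2\<bar> powr p)"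
  define T :: "(real \<times> real) set" where
    "T = {z. \<bar>fst z\<bar> powr p + \<bar>snd z\<bar> powr p = 1} \<inter> {z. e \<le> \<bar>fst z - snd z\<bar> powr p}"
  have D0: "0 \<le> D (a, b)" for a b
    using powr_abs_strict_midpoint[OF p, of a b] by (cases "a = b") (auto simp: D_def abs_mult)
  have cp: "continuous_on UNIV (\<lambda>z. \<bar>f z\<bar> powr p)" if "continuous_on UNIV f" for f :: "real \<times> real \<Rightarrow> real"
    using p that by (intro continuous_on_powr' continuous_on_rabs continuous_on_const) auto
  have contD: "continuous_on UNIV D"
    unfolding D_def by (intro continuous_on_add continuous_on_diff continuous_on_divide cp
      continuous_on_fst continuous_on_snd continuous_on_id continuous_on_const) auto
  have le1: "\<bar>x\<bar> \<le> 1" if "\<bar>x\<bar> powr p \<le> 1" for x :: real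
  proof (rule ccontr)
    assume "\<not> \<bar>x\<bar> \<le> 1"
    then have "1 powr p < \<bar>x\<bar> powr p" using p by (intro powr_less_mono2) auto
    then show False using that by simp
  qed
  have clT: "closed T" unfolding T_def
    by (intro closed_Int closed_Collect_eq closed_Collect_le cp continuous_on_add continuous_on_diff
      continuous_on_fst continuous_on_snd continuous_on_id continuous_on_const)
  have "T \<subseteq> {-1..1} \<times> {-1..1}"
  proof
    fix z assume "z \<in> T"
    then have "\<bar>fst z\<bar> powr p + \<bar>snd z\<bar> powr p = 1" by (simp add: T_def)
    then have "\<bar>fst z\<bar> powr p \<le> 1" "\<bar>snd z\<bar> powr p \<le> 1"
      using powr_ge_zero[of "\<bar>fst z\<bar>" p] powr_ge_zero[of "\<bar>snd z\<bar>" p] by linarith+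
    then have "\<bar>fst z\<bar> \<le> 1" "\<bar>snd z\<bar> \<le> 1" using le1 by blast+
    then show "z \<in> {-1..1} \<times> {-1..1}" unfolding mem_Times_iff atLeastAtMost_iff by (intro conjI) linarith+
  qed
  then have "T = ({-1..1} \<times> {-1..1}) \<inter> T" by blast
  moreover have "compact (({-1..1} \<times> {-1..1}) \<inter> T)"
    by (intro compact_Int_closed clT compact_Times compact_Icc)
  ultimately have "compact T" by metis
  have "\<exists>\<delta>>0. \<forall>z\<in>T. \<delta> \<le> D z"
  proof (cases "T = {}")
    case False
    then obtain z where z: "z \<in> T" "\<And>y. y \<in> T \<Longrightarrow> D z \<le> D y"
      using continuous_attains_inf[OF \<open>compact T\<close> False continuous_on_subset[OF contD subset_UNIV]] by blast
    have "fst z \<noteq> snd z" using z e p by (auto simp: T_def)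
    then have "0 < D z" using powr_abs_strict_midpoint[OF p, of "fst z" "snd z"] by (simp add: D_def)
    then show ?thesis using z by blast
  qed (use zero_less_one in blast)
  then obtain \<delta> where \<delta>: "0 < \<delta>" "\<And>z. z \<in> T \<Longrightarrow> \<delta> \<le> D z" by blast
  \<comment> \<open>On normalized pairs both entries have absolute value at most 1, so
    \<open>2 powr p\<close> bounds \<open>\<bar>a - b\<bar> powr p\<close>, and
    \<open>K * \<delta>\<close> equals that bound.\<close>
  define K where "K = 2 powr p / \<delta>"
  have K: "0 < K" using \<delta> by (simp add: K_def)
  have unit: "\<bar>a - b\<bar> powr p \<le> e + K * D (a, b)" if ab: "\<bar>a\<bar> powr p + \<bar>b\<bar> powr p = 1" for a b
  proof (cases "e \<le> \<bar>a - b\<bar> powr p")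
    case True
    have "\<bar>a\<bar> powr p \<le> 1" "\<bar>b\<bar> powr p \<le> 1"
      using ab powr_ge_zero[of "\<bar>a\<bar>" p] powr_ge_zero[of "\<bar>b\<bar>" p] by linarith+
    from le1[OF this(1)] le1[OF this(2)] have "\<bar>a - b\<bar> powr p \<le> 2 powr p"
      using p by (intro powr_mono2) auto
    also have "\<dots> = K * \<delta>" using \<delta> by (simp add: K_def)
    also have "\<dots> \<le> K * D (a, b)"
      using \<delta>(2)[of "(a, b)"] True ab K by (intro mult_left_mono) (auto simp: T_def)
    finally show ?thesis using e by simp
  qed (use K D0[of a b] in \<open>simp add: add_increasing2\<close>)
  show thesis
  proof (rule that[OF K])
    fix a b :: real
    define s where "s = \<bar>a\<bar> powr p + \<bar>b\<bar> powr p"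
    show "\<bar>a - b\<bar> powr p + K * \<bar>(a + b) / 2\<bar> powr p \<le> (e + K / 2) * (\<bar>a\<bar> powr p + \<bar>b\<bar> powr p)"
    proof (cases "s = 0")
      case True
      then have "\<bar>a\<bar> powr p = 0" "\<bar>b\<bar> powr p = 0"
        using powr_ge_zero[of "\<bar>a\<bar>" p] powr_ge_zero[of "\<bar>b\<bar>" p] unfolding s_def by linarith+
      then show ?thesis using p by simp
    next
      case False
      then have s: "0 < s" by (simp add: s_def add_nonneg_nonneg order_less_le)
      \<comment> \<open>Division by \<open>r\<close> brings a general pair to the normalization of
        \<open>unit\<close>.\<close>
      define r where "r = s powr (1 / p)"
      have r: "0 < r" "r powr p = s" using s p by (simp_all add: r_def powr_powr)
      have sc: "\<bar>x / r\<bar> powr p = \<bar>x\<bar> powr p / s" for x :: real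
        using r by (simp add: abs_divide powr_divide)
      have "\<bar>a / r - b / r\<bar> powr p \<le> e + K * D (a / r, b / r)"
        using s by (intro unit) (simp only: sc, simp flip: add_divide_distrib s_def)
      moreover have "D (a / r, b / r) = (s / 2 - \<bar>(a + b) / 2\<bar> powr p) / s"
      proof -
        have "(a / r + b / r) / 2 = ((a + b) / 2) / r" by (simp add: add_divide_distrib)
        then have "D (a / r, b / r) = (\<bar>a\<bar> powr p / s + \<bar>b\<bar> powr p / s) / 2 - \<bar>(a + b) / 2\<bar> powr p / s"
          unfolding D_def fst_conv snd_conv by (simp only: sc)
        then show ?thesis by (simp add: diff_divide_distrib flip: add_divide_distrib s_def)
      qed
      moreover have "a / r - b / r = (a - b) / r" by (simp add: diff_divide_distrib)
      ultimately have "\<bar>a - b\<bar> powr p / s \<le> e + K * ((s / 2 - \<bar>(a + b) / 2\<bar> powr p) / s)"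
        using sc[of "a - b"] by simp
      then have "\<bar>a - b\<bar> powr p \<le> (e + K * ((s / 2 - \<bar>(a + b) / 2\<bar> powr p) / s)) * s"
        using s by (simp add: pos_divide_le_eq)
      also have "\<dots> = e * s + K * (s / 2 - \<bar>(a + b) / 2\<bar> powr p)" using s by (simp add: distrib_right)
      finally show ?thesis by (simp add: s_def algebra_simps add_divide_distrib)
    qed
  qed
qed

text \<open>
  Let \<open>d k\<close> be the infimum over \<open>C k\<close> of the upper limit of the \<open>E n\<close>.  A sequence that
  almost attains these infima is Cauchy with respect to the lower limit of the \<open>Q n\<close>, because
  midpoints stay in \<open>C k\<close>.
\<close>

lemma uniformly_convex_minimizing_sequence:
  fixes E :: "nat \<Rightarrow> 'v \<Rightarrow> real" and Q :: "nat \<Rightarrow> 'v \<Rightarrow> 'v \<Rightarrow> real"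
    and mid :: "'v \<Rightarrow> 'v \<Rightarrow> 'v" and C :: "nat \<Rightarrow> 'v set"
  assumes ne: "\<And>k. C k \<noteq> {}" and dec: "\<And>k. C (Suc k) \<subseteq> C k"
    and mid: "\<And>k x y. x \<in> C k \<Longrightarrow> y \<in> C k \<Longrightarrow> mid x y \<in> C k"
    and E0: "\<And>n x. x \<in> C 0 \<Longrightarrow> 0 \<le> E n x" and EB: "\<And>n x. x \<in> C 0 \<Longrightarrow> E n x \<le> B"
    and conv: "\<And>e. 0 < e \<Longrightarrow> \<exists>K>0. \<forall>n. \<forall>x\<in>C 0. \<forall>y\<in>C 0.
      Q n x y + K * E n (mid x y) \<le> (e + K / 2) * (E n x + E n y)"
  obtains w where "\<And>k. w k \<in> C k"
    "\<And>e. 0 < e \<Longrightarrow> \<exists>m. \<forall>i\<ge>m. \<forall>j\<ge>m. \<exists>\<^sub>F n in sequentially. Q n (w i) (w j) \<le> e"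
proof -
  \<comment> \<open>This is the upper limit of \<open>E n x\<close> in \<open>n\<close>, taken as
    the infimum of the eventual upper bounds; the bounds 0 and \<open>B\<close> make the infimum
    meaningful in the reals.\<close>
  define N where "N x = Inf {b. \<forall>\<^sub>F n in sequentially. E n x \<le> b}" for x
  define d where "d k = Inf (N ` C k)" for k
  have C_mono: "C j \<subseteq> C i" if "i \<le> j" for i j
    using lift_Suc_antimono_le[of C, OF dec that] .
  have C0: "x \<in> C 0" if "x \<in> C k" for x k using C_mono[of 0 k] that by auto
  have Nset: "B \<in> {b. \<forall>\<^sub>F n in sequentially. E n x \<le> b}" if "x \<in> C 0" for x
    using EB[OF that] by simp
  have Nbdd: "0 \<le> b" if "x \<in> C 0" "\<forall>\<^sub>F n in sequentially. E n x \<le> b" for x b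
    using eventually_happens[OF that(2)] E0[OF that(1)] by (meson order.trans sequentially_bot)
  have bb: "bdd_below {b. \<forall>\<^sub>F n in sequentially. E n x \<le> b}" if "x \<in> C 0" for x
    using Nbdd[OF that] by (intro bdd_belowI[of _ 0]) auto
  have N0: "0 \<le> N x" if "x \<in> C 0" for x
    unfolding N_def using Nset[OF that] Nbdd[OF that] by (intro cInf_greatest) auto
  have NB: "N x \<le> B" if "x \<in> C 0" for x
    unfolding N_def using Nset[OF that] bb[OF that] by (rule cInf_lower)
  have N_ev: "\<forall>\<^sub>F n in sequentially. E n x \<le> N x + \<delta>" if x: "x \<in> C 0" "0 < \<delta>" for x \<delta>
  proof -
    have "N x < N x + \<delta>" using x by simp
    then obtain b where "\<forall>\<^sub>F n in sequentially. E n x \<le> b" "b < N x + \<delta>"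
      using cInf_lessD[of "{b. \<forall>\<^sub>F n in sequentially. E n x \<le> b}" "N x + \<delta>"] Nset[OF x(1)]
      unfolding N_def by blast
    then show ?thesis by (auto elim!: eventually_mono)
  qed
  have N_fr: "\<exists>\<^sub>F n in sequentially. N x - \<delta> < E n x" if "x \<in> C 0" "0 < \<delta>" for x \<delta>
  proof (rule ccontr)
    assume "\<not> ?thesis"
    then have "\<forall>\<^sub>F n in sequentially. E n x \<le> N x - \<delta>" by (simp add: frequently_def not_less)
    then have "N x \<le> N x - \<delta>" using cInf_lower[OF _ bb[OF that(1)]] unfolding N_def by simp
    then show False using that by simp
  qed
  have bbN: "bdd_below (N ` C k)" for k
    using N0 C0 by (intro bdd_belowI2[of _ 0]) blast
  have d_le: "d k \<le> N x" if "x \<in> C k" for k x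
    unfolding d_def using bbN that by (intro cInf_lower) auto
  have d_mono: "d i \<le> d j" if "i \<le> j" for i j
    unfolding d_def using ne bbN C_mono[OF that] by (intro cInf_superset_mono) auto
  have d_nonneg: "0 \<le> d k" for k
    unfolding d_def using ne N0 C0 by (intro cInf_greatest) auto
  have d_B: "d k \<le> B" for k
    using ne[of k] d_le[of _ k] NB C0 by (metis ex_in_conv order.trans)
  have B0: "0 \<le> B" using d_nonneg d_B order.trans by blast
  have "\<exists>x\<in>C k. N x < d k + 1 / (real k + 1)" for k
  proof -
    have "Inf (N ` C k) < d k + 1 / (real k + 1)" by (simp add: d_def)
    then show ?thesis using cInf_lessD[of "N ` C k"] ne by blast
  qed
  then obtain w where w: "\<And>k. w k \<in> C k" "\<And>k. N (w k) < d k + 1 / (real k + 1)"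
    by metis
  \<comment> \<open>The sets \<open>C k\<close> shrink, so the infima \<open>d k\<close> increase to
    \<open>D\<close>. Far out, the points \<open>w i\<close> have upper limit close to
    \<open>D\<close>, while every point of \<open>C m\<close> has upper limit at least
    \<open>d m\<close>, also close to \<open>D\<close>.\<close>
  define D where "D = (SUP k. d k)"
  have bda: "bdd_above (range d)" using d_B by (intro bdd_aboveI2)
  have dD: "d k \<le> D" for k unfolding D_def using bda by (intro cSUP_upper) auto
  have DB: "D \<le> B" unfolding D_def using d_B by (intro cSUP_least) auto
  show thesis
  proof (rule that[OF w(1)])
    fix e :: real assume e: "0 < e"
    \<comment> \<open>The final estimate is
      \<open>e' * (2 * D + 4 * \<delta>) + 4 * (K * \<delta>)\<close>. With \<open>D \<le> B\<close>
      and \<open>\<delta> \<le> 1\<close> the choice of \<open>e'\<close> makes the first term at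
      most \<open>e / 2\<close>, and \<open>K * \<delta> \<le> e / 16\<close> makes the second at
      most \<open>e / 4\<close>.\<close>
    define e' where "e' = e / (4 * (B + 2))"
    have e': "0 < e'" using e B0 by (simp add: e'_def)
    from conv[OF e'] obtain K where K: "0 < K" "\<And>n x y. x \<in> C 0 \<Longrightarrow> y \<in> C 0 \<Longrightarrow>
        Q n x y + K * E n (mid x y) \<le> (e' + K / 2) * (E n x + E n y)" by blast
    define \<delta> where "\<delta> = min 1 (e / (16 * K))"
    have \<delta>: "0 < \<delta>" "\<delta> \<le> 1" "K * \<delta> \<le> e / 16"
    proof -
      have "K * \<delta> \<le> K * (e / (16 * K))" unfolding \<delta>_def using K by (intro mult_left_mono) auto
      then show "K * \<delta> \<le> e / 16" using K by simp
    qed (use e K in \<open>auto simp: \<delta>_def\<close>)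
    have "D - \<delta> < (SUP k. d k)" using \<delta> by (simp add: D_def)
    then obtain m1 where m1: "D - \<delta> < d m1"
      using less_cSUP_iff[OF UNIV_not_empty bda] by blast
    obtain m2 :: nat where "1 / \<delta> < real m2" using reals_Archimedean2 by blast
    then have m2: "1 / (real m2 + 1) < \<delta>" using \<delta> by (simp add: field_simps)
    define m where "m = max m1 m2"
    have dm: "D - \<delta> < d m" using m1 d_mono[of m1 m] by (simp add: m_def)
    have Nw: "N (w i) \<le> D + \<delta>" if "m \<le> i" for i
    proof -
      have "1 / (real i + 1) \<le> 1 / (real m2 + 1)" using that by (intro divide_left_mono) (auto simp: m_def)
      then show ?thesis using w(2)[of i] dD[of i] m2 by linarith
    qed
    show "\<exists>m. \<forall>i\<ge>m. \<forall>j\<ge>m. \<exists>\<^sub>F n in sequentially. Q n (w i) (w j) \<le> e"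
    proof (intro exI[of _ m] allI impI)
      fix i j assume ij: "m \<le> i" "m \<le> j"
      have wC: "w i \<in> C m" "w j \<in> C m" using w(1) C_mono ij by blast+
      note mC = mid[OF this]
      \<comment> \<open>An upper limit is nearly attained only for infinitely many \<open>n\<close>,
        while it bounds \<open>E n\<close> from above for almost all \<open>n\<close>. The lower
        bound is wanted at the midpoint and the upper bounds at \<open>w i\<close> and
        \<open>w j\<close>, so the two kinds of statement combine.\<close>
      have "\<exists>\<^sub>F n in sequentially. N (mid (w i) (w j)) - \<delta> < E n (mid (w i) (w j)) \<and>
          (E n (w i) \<le> N (w i) + \<delta> \<and> E n (w j) \<le> N (w j) + \<delta>)"
        by (intro frequently_eventually_frequently N_fr eventually_conj N_ev C0[OF mC] C0[OF w(1)] \<delta>)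
      then show "\<exists>\<^sub>F n in sequentially. Q n (w i) (w j) \<le> e"
      proof (rule frequently_mono[rotated], intro allI impI, elim conjE)
        fix n assume h: "N (mid (w i) (w j)) - \<delta> < E n (mid (w i) (w j))"
          "E n (w i) \<le> N (w i) + \<delta>" "E n (w j) \<le> N (w j) + \<delta>"
        have lo: "D - 2 * \<delta> \<le> E n (mid (w i) (w j))" using h(1) d_le[OF mC] dm by linarith
        have hi: "E n (w i) + E n (w j) \<le> 2 * D + 4 * \<delta>" using h Nw ij by (smt (verit))
        have "Q n (w i) (w j) \<le> (e' + K / 2) * (E n (w i) + E n (w j)) - K * E n (mid (w i) (w j))"
          using K(2)[OF C0[OF w(1)] C0[OF w(1)], of n i j] by linarith
        also have "\<dots> \<le> (e' + K / 2) * (2 * D + 4 * \<delta>) - K * (D - 2 * \<delta>)"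
          using lo hi K(1) e' by (intro diff_mono mult_left_mono) auto
        also have "\<dots> = e' * (2 * D + 4 * \<delta>) + 4 * (K * \<delta>)" by (simp add: algebra_simps)
        also have "\<dots> \<le> e' * (2 * (B + 2)) + 4 * (e / 16)"
          using e' DB \<delta> by (intro add_mono mult_left_mono) auto
        also have "e' * (2 * (B + 2)) = e / 2" using B0 by (simp add: e'_def field_simps)
        finally show "Q n (w i) (w j) \<le> e" using e by simp
      qed
    qed
  qed
qed

section \<open>Convex combinations of the tails of a sequence of functions\<close>

definition conv_tail :: "(nat \<Rightarrow> 'a \<Rightarrow> real) \<Rightarrow> nat \<Rightarrow> ('a \<Rightarrow> real) set" where
  "conv_tail f k = {w. \<exists>n l. (\<forall>j\<le>n. 0 \<le> l j) \<and> (\<Sum>j\<le>n. l j) = 1 \<and> w = (\<lambda>x. \<Sum>j\<le>n. l j * f (k + j) x)}"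

text \<open>Extending the weights by zero beyond \<open>n\<close> lets combinations of different
  lengths be padded to a common length, as for midpoints.\<close>

lemma conv_tailE:
  assumes "w \<in> conv_tail f k"
  obtains n l where "\<And>j. 0 \<le> l j" "\<And>j. n < j \<Longrightarrow> l j = 0" "(\<Sum>j\<le>n. l j) = 1"
    "w = (\<lambda>x. \<Sum>j\<le>n. l j * f (k + j) x)"
proof -
  from assms obtain n l where l: "\<forall>j\<le>n. 0 \<le> l j" "(\<Sum>j\<le>n. l j) = 1" "w = (\<lambda>x. \<Sum>j\<le>n. l j * f (k + j) x)"
    unfolding conv_tail_def by blast
  show thesis
    by (rule that[of "\<lambda>j. if j \<le> n then l j else 0" n]) (use l in \<open>auto intro!: ext sum.cong\<close>)
qed

lemma conv_tailI:
  assumes "\<And>j. j \<le> n \<Longrightarrow> 0 \<le> l j" "(\<Sum>j\<le>n. l j) = 1" "w = (\<lambda>x. \<Sum>j\<le>n. l j * f (k + j) x)"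
  shows "w \<in> conv_tail f k"
  using assms unfolding conv_tail_def by blast

lemma conv_tail_self: "f k \<in> conv_tail f k"
  by (rule conv_tailI[of 0 "\<lambda>_. 1"]) auto

lemma conv_tail_Suc: "conv_tail f (Suc k) \<subseteq> conv_tail f k"
proof
  fix w assume "w \<in> conv_tail f (Suc k)"
  then obtain n l where l: "\<And>j. 0 \<le> l j" "\<And>j. n < j \<Longrightarrow> l j = 0" "(\<Sum>j\<le>n. l j) = 1"
    "w = (\<lambda>x. \<Sum>j\<le>n. l j * f (Suc k + j) x)" by (rule conv_tailE) (rule that)
  show "w \<in> conv_tail f k"
    by (rule conv_tailI[of "Suc n" "case_nat 0 l"])
      (use l in \<open>auto simp: sum.atMost_Suc_shift simp del: sum.atMost_Suc split: nat.split\<close>)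
qed

lemma conv_tail_mid:
  assumes "u \<in> conv_tail f k" "v \<in> conv_tail f k"
  shows "(\<lambda>x. (u x + v x) / 2) \<in> conv_tail f k"
proof -
  obtain n l where l: "\<And>j. 0 \<le> l j" "\<And>j. n < j \<Longrightarrow> l j = 0" "(\<Sum>j\<le>n. l j) = 1"
    "u = (\<lambda>x. \<Sum>j\<le>n. l j * f (k + j) x)" using assms(1) by (rule conv_tailE) (rule that)
  obtain m r where r: "\<And>j. 0 \<le> r j" "\<And>j. m < j \<Longrightarrow> r j = 0" "(\<Sum>j\<le>m. r j) = 1"
    "v = (\<lambda>x. \<Sum>j\<le>m. r j * f (k + j) x)" using assms(2) by (rule conv_tailE) (rule that)
  have ext: "(\<Sum>j\<le>i. c j * g j) = (\<Sum>j\<le>max n m. c j * g j)"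
    if "\<And>j. i < j \<Longrightarrow> c j = 0" "i \<le> max n m" for c g :: "nat \<Rightarrow> real" and i
    by (rule sum.mono_neutral_left) (use that in auto)
  have 1: "(\<Sum>j\<le>max n m. l j) = 1" "(\<Sum>j\<le>max n m. r j) = 1"
    using ext[of n l "\<lambda>_. 1"] ext[of m r "\<lambda>_. 1"] l r by simp_all
  show ?thesis
  proof (rule conv_tailI[of "max n m" "\<lambda>j. (l j + r j) / 2"])
    show "(\<Sum>j\<le>max n m. (l j + r j) / 2) = 1"
      using 1 by (simp add: sum.distrib flip: sum_divide_distrib)
    show "(\<lambda>x. (u x + v x) / 2) = (\<lambda>x. \<Sum>j\<le>max n m. (l j + r j) / 2 * f (k + j) x)"
    proof
      fix x
      have "u x = (\<Sum>j\<le>max n m. l j * f (k + j) x)" unfolding l(4) by (rule ext) (use l(2) in auto)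
      moreover have "v x = (\<Sum>j\<le>max n m. r j * f (k + j) x)" unfolding r(4) by (rule ext) (use r(2) in auto)
      ultimately show "(u x + v x) / 2 = (\<Sum>j\<le>max n m. (l j + r j) / 2 * f (k + j) x)"
        by (simp add: add_divide_distrib distrib_right sum.distrib sum_divide_distrib)
    qed
  qed (use l(1) r(1) in auto)
qed

section \<open>The homogeneous space through real-valued representatives\<close>

text \<open>Additivity of the integral needs a measurable integrand along the curve, which the
  unit-speed parametrization supplies.\<close>

lemma curve_integral_linear:
  assumes rc: "rectifiable_curve \<gamma> a b" "\<not> \<gamma> constant_on {a..b}"
    and [measurable]: "g \<in> borel_measurable borel" "h \<in> borel_measurable borel"
  shows "curve_integral (\<lambda>x. g x + h x) \<gamma> a b = curve_integral g \<gamma> a b + curve_integral h \<gamma> a b"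
    and "curve_integral (\<lambda>x. k * g x) \<gamma> a b = k * curve_integral g \<gamma> a b"
proof -
  obtain c L where c: "unit_speed c L"
    and int: "\<And>g. curve_integral g \<gamma> a b = (\<integral>\<^sup>+x\<in>{0..L}. g (c x) \<partial>lborel)"
    using rectifiable_unit_speed[OF rc] by metis
  have [measurable]: "c \<in> borel_measurable borel" using c by (rule unit_speed_measurable)
  show "curve_integral (\<lambda>x. g x + h x) \<gamma> a b = curve_integral g \<gamma> a b + curve_integral h \<gamma> a b"
    unfolding int by (subst nn_integral_add[symmetric]) (auto simp: distrib_right)
  show "curve_integral (\<lambda>x. k * g x) \<gamma> a b = k * curve_integral g \<gamma> a b"
    unfolding int by (subst nn_integral_cmult[symmetric]) (auto simp: mult.assoc)
qed

lemma upper_gradient_add: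
  assumes "upper_gradient g (\<lambda>x. ereal (u x))" "upper_gradient h (\<lambda>x. ereal (v x))"
  shows "upper_gradient (\<lambda>x. g x + h x) (\<lambda>x. ereal (u x + v x))"
  unfolding upper_gradient_real_iff
proof (intro conjI allI impI)
  have [measurable]: "g \<in> borel_measurable borel" "h \<in> borel_measurable borel"
    using assms by (simp_all add: upper_gradient_def)
  show "(\<lambda>x. g x + h x) \<in> borel_measurable borel" by measurable
  fix \<gamma> :: "real \<Rightarrow> 'a" and a b assume \<gamma>: "rectifiable_curve \<gamma> a b \<and> \<not> \<gamma> constant_on {a..b}"
  have "ennreal \<bar>u (\<gamma> b) + v (\<gamma> b) - (u (\<gamma> a) + v (\<gamma> a))\<bar> \<le>
      ennreal \<bar>u (\<gamma> b) - u (\<gamma> a)\<bar> + ennreal \<bar>v (\<gamma> b) - v (\<gamma> a)\<bar>"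
    by (simp flip: ennreal_plus)
  also have "\<dots> \<le> curve_integral g \<gamma> a b + curve_integral h \<gamma> a b"
    using assms \<gamma> by (intro add_mono) (simp_all add: upper_gradient_real_iff)
  also have "\<dots> = curve_integral (\<lambda>x. g x + h x) \<gamma> a b"
    using \<gamma> by (subst curve_integral_linear) auto
  finally show "ennreal \<bar>u (\<gamma> b) + v (\<gamma> b) - (u (\<gamma> a) + v (\<gamma> a))\<bar> \<le> curve_integral (\<lambda>x. g x + h x) \<gamma> a b" .
qed

lemma upper_gradient_scale:
  assumes "upper_gradient g (\<lambda>x. ereal (u x))"
  shows "upper_gradient (\<lambda>x. ennreal \<bar>k\<bar> * g x) (\<lambda>x. ereal (k * u x))"
  unfolding upper_gradient_real_iff
proof (intro conjI allI impI)
  have [measurable]: "g \<in> borel_measurable borel" using assms by (simp add: upper_gradient_def)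
  show "(\<lambda>x. ennreal \<bar>k\<bar> * g x) \<in> borel_measurable borel" by measurable
  fix \<gamma> :: "real \<Rightarrow> 'a" and a b assume \<gamma>: "rectifiable_curve \<gamma> a b \<and> \<not> \<gamma> constant_on {a..b}"
  have "ennreal \<bar>k * u (\<gamma> b) - k * u (\<gamma> a)\<bar> = ennreal \<bar>k\<bar> * ennreal \<bar>u (\<gamma> b) - u (\<gamma> a)\<bar>"
    by (simp add: abs_mult flip: ennreal_mult right_diff_distrib)
  also have "\<dots> \<le> ennreal \<bar>k\<bar> * curve_integral g \<gamma> a b"
    using assms \<gamma> by (intro mult_left_mono) (simp_all add: upper_gradient_real_iff)
  also have "\<dots> = curve_integral (\<lambda>x. ennreal \<bar>k\<bar> * g x) \<gamma> a b"
    using \<gamma> curve_integral_linear(2)[of \<gamma> a b g g] by simp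
  finally show "ennreal \<bar>k * u (\<gamma> b) - k * u (\<gamma> a)\<bar> \<le> curve_integral (\<lambda>x. ennreal \<bar>k\<bar> * g x) \<gamma> a b" .
qed

lemma upper_gradient_const: "upper_gradient (\<lambda>_. 0) (\<lambda>_. ereal k)"
  by (simp add: upper_gradient_real_iff)

definition D_fun :: "'a::metric_space measure \<Rightarrow> real \<Rightarrow> ('a \<Rightarrow> real) set" where
  "D_fun M p = {u. (\<lambda>x. ereal (u x)) \<in> D_space M p}"

definition D_norm :: "'a::metric_space measure \<Rightarrow> real \<Rightarrow> ('a \<Rightarrow> real) \<Rightarrow> real" where
  "D_norm M p u = enn2real (D_seminorm M p (\<lambda>x. ereal (u x)))"

definition D_class :: "'a::metric_space measure \<Rightarrow> real \<Rightarrow> ('a \<Rightarrow> real) \<Rightarrow> ('a \<Rightarrow> ereal) set" where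
  "D_class M p u = D_rel M p `` {\<lambda>x. ereal (u x)}"

lemma D_seminorm_le: "upper_gradient g f \<Longrightarrow> D_seminorm M p f \<le> Lp_norm M p g"
  unfolding D_seminorm_def Lp_norm_def by (rule INF_lower) simp

lemma D_seminorm_lessE:
  assumes "D_seminorm M p f < a"
  obtains g where "upper_gradient g f" "Lp_norm M p g < a"
  using assms unfolding D_seminorm_def Lp_norm_def INF_less_iff by blast

lemma D_seminorm_geI: "(\<And>g. upper_gradient g f \<Longrightarrow> a \<le> Lp_norm M p g) \<Longrightarrow> a \<le> D_seminorm M p f"
  unfolding D_seminorm_def Lp_norm_def by (rule INF_greatest) simp

lemma D_space_iff: "f \<in> D_space M p \<longleftrightarrow> f \<in> borel_measurable (completion M) \<and> D_seminorm M p f < top"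
proof -
  have "(\<exists>g. upper_gradient g f \<and> (\<integral>\<^sup>+x. ennreal_powr (g x) p \<partial>M) < \<infinity>) \<longleftrightarrow> D_seminorm M p f < top"
    unfolding D_seminorm_def INF_less_iff by auto
  then show ?thesis by (simp add: D_space_def)
qed

lemma D_fun_iff: "u \<in> D_fun M p \<longleftrightarrow>
    u \<in> borel_measurable (completion M) \<and> D_seminorm M p (\<lambda>x. ereal (u x)) < top"
  unfolding D_fun_def D_space_iff by (auto dest: borel_measurable_ereal borel_measurable_real_of_ereal)

locale borel_exponent =
  fixes M :: "'a::metric_space measure" and p :: real
  assumes p1: "1 \<le> p" and sets_M [measurable_cong]: "sets M = sets borel"
begin

lemma p0: "0 < p" using p1 by simp

lemma upper_gradient_measurable: "upper_gradient g f \<Longrightarrow> g \<in> borel_measurable M"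
  unfolding upper_gradient_def using measurable_cong_sets[OF sets_M refl] by blast

text \<open>Upper gradients \<open>h\<close>, \<open>h'\<close> of \<open>f\<close>,
  \<open>f'\<close> with finite norm have infinite integral on every non-constant rectifiable curve
  that ends at an infinite value of \<open>f\<close> or \<open>f'\<close>. Adding
  \<open>e * (h + h')\<close> to an upper gradient of \<open>v'\<close> thus yields one of
  \<open>v\<close>: on the other curves \<open>v\<close> and \<open>v'\<close> agree at both ends.
  The added norm tends to zero with \<open>e\<close>. This justifies real-valued representatives and
  shows that the convention for undefined sums does not influence the seminorm.\<close>

lemma D_seminorm_le_off_infinities:
  assumes "f \<in> D_space M p" "f' \<in> D_space M p"
    and eq: "\<And>x. \<bar>f x\<bar> \<noteq> \<infinity> \<Longrightarrow> \<bar>f' x\<bar> \<noteq> \<infinity> \<Longrightarrow> v x = v' x"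
  shows "D_seminorm M p v \<le> D_seminorm M p v'"
proof (rule D_seminorm_geI)
  fix g assume g: "upper_gradient g v'"
  obtain h where h: "upper_gradient h f" "Lp_norm M p h < top"
    using assms(1) by (auto simp: D_space_iff elim: D_seminorm_lessE)
  obtain h' where h': "upper_gradient h' f'" "Lp_norm M p h' < top"
    using assms(2) by (auto simp: D_space_iff elim: D_seminorm_lessE)
  note [measurable] = upper_gradient_measurable[OF g] upper_gradient_measurable[OF h(1)]
    upper_gradient_measurable[OF h'(1)]
  have borel: "g \<in> borel_measurable borel" "h \<in> borel_measurable borel" "h' \<in> borel_measurable borel"
    using g h h' by (simp_all add: upper_gradient_def)
  define C where "C = enn2real (Lp_norm M p h + Lp_norm M p h')"
  have C: "Lp_norm M p h + Lp_norm M p h' = ennreal C" "0 \<le> C" using h h' by (simp_all add: C_def)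
  have ug: "upper_gradient (\<lambda>x. g x + ennreal e * (h x + h' x)) v" if "0 < e" for e
    unfolding upper_gradient_def
  proof (intro conjI allI impI)
    show "(\<lambda>x. g x + ennreal e * (h x + h' x)) \<in> borel_measurable borel" using borel by measurable
    fix \<gamma> :: "real \<Rightarrow> 'a" and a b assume \<gamma>: "rectifiable_curve \<gamma> a b \<and> \<not> \<gamma> constant_on {a..b}"
    let ?I = "\<lambda>g. curve_integral g \<gamma> a b"
    have I: "?I (\<lambda>x. g x + ennreal e * (h x + h' x)) = ?I g + ennreal e * (?I h + ?I h')"
    proof -
      have "?I (\<lambda>x. g x + ennreal e * (h x + h' x)) = ?I g + ?I (\<lambda>x. ennreal e * (h x + h' x))"
        using \<gamma> borel by (intro curve_integral_linear) measurable
      also have "?I (\<lambda>x. ennreal e * (h x + h' x)) = ennreal e * ?I (\<lambda>x. h x + h' x)"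
        using \<gamma> borel by (intro curve_integral_linear) measurable
      also have "?I (\<lambda>x. h x + h' x) = ?I h + ?I h'"
        using \<gamma> borel by (intro curve_integral_linear) measurable
      finally show ?thesis .
    qed
    show "if \<bar>v (\<gamma> a)\<bar> \<noteq> \<infinity> \<and> \<bar>v (\<gamma> b)\<bar> \<noteq> \<infinity>
        then e2ennreal \<bar>v (\<gamma> b) - v (\<gamma> a)\<bar> \<le> ?I (\<lambda>x. g x + ennreal e * (h x + h' x))
        else ?I (\<lambda>x. g x + ennreal e * (h x + h' x)) = \<infinity>"
    proof (cases "?I h = \<infinity> \<or> ?I h' = \<infinity>")
      case True
      then have "?I (\<lambda>x. g x + ennreal e * (h x + h' x)) = \<infinity>"
        unfolding I using \<open>0 < e\<close> by (auto simp: ennreal_mult_top)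
      then show ?thesis by simp
    next
      case False
      then have fin: "\<bar>f (\<gamma> a)\<bar> \<noteq> \<infinity>" "\<bar>f (\<gamma> b)\<bar> \<noteq> \<infinity>" "\<bar>f' (\<gamma> a)\<bar> \<noteq> \<infinity>" "\<bar>f' (\<gamma> b)\<bar> \<noteq> \<infinity>"
        using h(1) h'(1) \<gamma> unfolding upper_gradient_def by metis+
      have "v (\<gamma> a) = v' (\<gamma> a)" "v (\<gamma> b) = v' (\<gamma> b)" using eq[OF fin(1,3)] eq[OF fin(2,4)] by simp_all
      moreover have "?I g \<le> ?I (\<lambda>x. g x + ennreal e * (h x + h' x))" unfolding I by simp
      moreover have "if \<bar>v' (\<gamma> a)\<bar> \<noteq> \<infinity> \<and> \<bar>v' (\<gamma> b)\<bar> \<noteq> \<infinity>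
        then e2ennreal \<bar>v' (\<gamma> b) - v' (\<gamma> a)\<bar> \<le> ?I g else ?I g = \<infinity>"
        using g \<gamma> unfolding upper_gradient_def by blast
      ultimately show ?thesis by (auto split: if_splits simp: top_unique)
    qed
  qed
  have le: "D_seminorm M p v \<le> Lp_norm M p g + ennreal e * ennreal C" if "0 < e" for e
  proof -
    have "D_seminorm M p v \<le> Lp_norm M p (\<lambda>x. g x + ennreal e * (h x + h' x))"
      using ug[OF that] by (rule D_seminorm_le)
    also have "\<dots> \<le> Lp_norm M p g + Lp_norm M p (\<lambda>x. ennreal e * (h x + h' x))"
      using p1 by (intro Lp_norm_triangle) auto
    also have "Lp_norm M p (\<lambda>x. ennreal e * (h x + h' x)) = ennreal e * Lp_norm M p (\<lambda>x. h x + h' x)"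
      using p0 by (intro Lp_norm_cmult) auto
    also have "Lp_norm M p (\<lambda>x. h x + h' x) \<le> ennreal C"
      unfolding C(1)[symmetric] using p1 by (intro Lp_norm_triangle) auto
    finally show ?thesis by (simp add: add_left_mono mult_left_mono)
  qed
  show "D_seminorm M p v \<le> Lp_norm M p g"
  proof (rule ennreal_le_epsilon)
    fix e :: real assume e: "0 < e"
    \<comment> \<open>The denominator \<open>C + 1\<close> also covers \<open>C = 0\<close>.\<close>
    have "D_seminorm M p v \<le> Lp_norm M p g + ennreal (e / (C + 1)) * ennreal C"
      using e C by (intro le) auto
    also have "ennreal (e / (C + 1)) * ennreal C = ennreal (e / (C + 1) * C)"
      using e C by (subst ennreal_mult[symmetric]) auto
    also have "\<dots> \<le> ennreal e" using e C by (intro ennreal_leI) (simp add: field_simps)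
    finally show "D_seminorm M p v \<le> Lp_norm M p g + ennreal e" by (simp add: add_left_mono)
  qed
qed

lemma D_seminorm_cong_off_infinities:
  assumes "f \<in> D_space M p" "f' \<in> D_space M p"
    and "\<And>x. \<bar>f x\<bar> \<noteq> \<infinity> \<Longrightarrow> \<bar>f' x\<bar> \<noteq> \<infinity> \<Longrightarrow> v x = v' x"
  shows "D_seminorm M p v = D_seminorm M p v'"
  by (intro antisym D_seminorm_le_off_infinities[OF assms(1,2)]) (simp_all add: assms(3))

lemma D_seminorm_add_le:
  "D_seminorm M p (\<lambda>x. ereal (u x + v x)) \<le> D_seminorm M p (\<lambda>x. ereal (u x)) + D_seminorm M p (\<lambda>x. ereal (v x))"
proof (cases "D_seminorm M p (\<lambda>x. ereal (u x)) = top \<or> D_seminorm M p (\<lambda>x. ereal (v x)) = top")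
  case False
  show ?thesis
  proof (rule ennreal_le_epsilon)
    fix e :: real assume e: "0 < e"
    have *: "\<exists>g. upper_gradient g (\<lambda>x. ereal (w x)) \<and> Lp_norm M p g < D_seminorm M p (\<lambda>x. ereal (w x)) + ennreal (e / 2)"
      if "D_seminorm M p (\<lambda>x. ereal (w x)) \<noteq> top" for w
    proof -
      have "D_seminorm M p (\<lambda>x. ereal (w x)) < D_seminorm M p (\<lambda>x. ereal (w x)) + ennreal (e / 2)"
        using that e by (cases "D_seminorm M p (\<lambda>x. ereal (w x))") (auto simp flip: ennreal_plus intro!: ennreal_lessI)
      then show ?thesis using D_seminorm_lessE by metis
    qed
    obtain g where g: "upper_gradient g (\<lambda>x. ereal (u x))" "Lp_norm M p g < D_seminorm M p (\<lambda>x. ereal (u x)) + ennreal (e / 2)"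
      using *[of u] False by blast
    obtain h where h: "upper_gradient h (\<lambda>x. ereal (v x))" "Lp_norm M p h < D_seminorm M p (\<lambda>x. ereal (v x)) + ennreal (e / 2)"
      using *[of v] False by blast
    have "D_seminorm M p (\<lambda>x. ereal (u x + v x)) \<le> Lp_norm M p (\<lambda>x. g x + h x)"
      using upper_gradient_add[OF g(1) h(1)] by (rule D_seminorm_le)
    also have "\<dots> \<le> Lp_norm M p g + Lp_norm M p h"
      using p1 upper_gradient_measurable[OF g(1)] upper_gradient_measurable[OF h(1)] by (rule Lp_norm_triangle)
    also have "\<dots> \<le> (D_seminorm M p (\<lambda>x. ereal (u x)) + ennreal (e / 2)) + (D_seminorm M p (\<lambda>x. ereal (v x)) + ennreal (e / 2))"
      using g(2) h(2) by (intro add_mono) auto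
    also have "\<dots> = D_seminorm M p (\<lambda>x. ereal (u x)) + D_seminorm M p (\<lambda>x. ereal (v x)) + (ennreal (e / 2) + ennreal (e / 2))"
      by (simp only: ac_simps)
    also have "ennreal (e / 2) + ennreal (e / 2) = ennreal e" using e by (simp flip: ennreal_plus)
    finally show "D_seminorm M p (\<lambda>x. ereal (u x + v x)) \<le>
      D_seminorm M p (\<lambda>x. ereal (u x)) + D_seminorm M p (\<lambda>x. ereal (v x)) + ennreal e" .
  qed
qed auto

lemma D_seminorm_const: "D_seminorm M p (\<lambda>_. ereal k) = 0"
proof -
  have "D_seminorm M p (\<lambda>_. ereal k) \<le> Lp_norm M p (\<lambda>_. 0)"
    by (rule D_seminorm_le[OF upper_gradient_const])
  then show ?thesis by (simp add: Lp_norm_def)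
qed

text \<open>The factor is moved to the left side by its inverse, because there each upper gradient
  of \<open>u\<close> can be treated separately. The opposite inequality is the same statement for
  \<open>1 / k\<close>.\<close>

lemma D_seminorm_scale_le:
  assumes "k \<noteq> 0"
  shows "D_seminorm M p (\<lambda>x. ereal (k * u x)) \<le> ennreal \<bar>k\<bar> * D_seminorm M p (\<lambda>x. ereal (u x))"
proof -
  have inv: "ennreal \<bar>k\<bar> * (ennreal (1 / \<bar>k\<bar>) * a) = a" for a
    using assms by (simp flip: ennreal_mult mult.assoc)
  have "ennreal (1 / \<bar>k\<bar>) * D_seminorm M p (\<lambda>x. ereal (k * u x)) \<le> D_seminorm M p (\<lambda>x. ereal (u x))"
  proof (rule D_seminorm_geI)
    fix g assume g: "upper_gradient g (\<lambda>x. ereal (u x))"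
    have "D_seminorm M p (\<lambda>x. ereal (k * u x)) \<le> Lp_norm M p (\<lambda>x. ennreal \<bar>k\<bar> * g x)"
      using upper_gradient_scale[OF g] by (rule D_seminorm_le)
    also have "\<dots> = ennreal \<bar>k\<bar> * Lp_norm M p g"
      using p0 upper_gradient_measurable[OF g] by (rule Lp_norm_cmult)
    finally have "ennreal (1 / \<bar>k\<bar>) * D_seminorm M p (\<lambda>x. ereal (k * u x)) \<le>
        ennreal (1 / \<bar>k\<bar>) * (ennreal \<bar>k\<bar> * Lp_norm M p g)"
      by (rule mult_left_mono) simp
    also have "\<dots> = Lp_norm M p g" using inv by (simp add: mult.left_commute)
    finally show "ennreal (1 / \<bar>k\<bar>) * D_seminorm M p (\<lambda>x. ereal (k * u x)) \<le> Lp_norm M p g" .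
  qed
  then have "ennreal \<bar>k\<bar> * (ennreal (1 / \<bar>k\<bar>) * D_seminorm M p (\<lambda>x. ereal (k * u x))) \<le>
      ennreal \<bar>k\<bar> * D_seminorm M p (\<lambda>x. ereal (u x))"
    by (rule mult_left_mono) simp
  then show ?thesis unfolding inv .
qed

lemma D_seminorm_scale: "D_seminorm M p (\<lambda>x. ereal (k * u x)) = ennreal \<bar>k\<bar> * D_seminorm M p (\<lambda>x. ereal (u x))"
proof (cases "k = 0")
  case True
  then show ?thesis by (simp add: D_seminorm_const)
next
  case False
  have "D_seminorm M p (\<lambda>x. ereal (1 / k * (k * u x))) \<le> ennreal \<bar>1 / k\<bar> * D_seminorm M p (\<lambda>x. ereal (k * u x))"
    using False by (intro D_seminorm_scale_le) auto
  then have "ennreal \<bar>k\<bar> * D_seminorm M p (\<lambda>x. ereal (u x)) \<le>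
      ennreal \<bar>k\<bar> * (ennreal \<bar>1 / k\<bar> * D_seminorm M p (\<lambda>x. ereal (k * u x)))"
    using False by (intro mult_left_mono) auto
  also have "\<dots> = D_seminorm M p (\<lambda>x. ereal (k * u x))"
    using False by (simp add: abs_divide flip: ennreal_mult mult.assoc)
  finally show ?thesis using D_seminorm_scale_le[OF False] by (rule antisym[rotated])
qed

lemma D_fun_add: "u \<in> D_fun M p \<Longrightarrow> v \<in> D_fun M p \<Longrightarrow> (\<lambda>x. u x + v x) \<in> D_fun M p"
  using D_seminorm_add_le[of u v] by (auto simp: D_fun_iff order_le_less_trans)

lemma D_fun_scale: "u \<in> D_fun M p \<Longrightarrow> (\<lambda>x. k * u x) \<in> D_fun M p"
  by (auto simp: D_fun_iff D_seminorm_scale ennreal_mult_less_top)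

lemma D_fun_const: "(\<lambda>_. k) \<in> D_fun M p"
  by (simp add: D_fun_iff D_seminorm_const)

lemma D_fun_diff: "u \<in> D_fun M p \<Longrightarrow> v \<in> D_fun M p \<Longrightarrow> (\<lambda>x. u x - v x) \<in> D_fun M p"
  using D_fun_add[of u "\<lambda>x. -1 * v x"] D_fun_scale[of v "-1"] by simp

lemma D_fun_sum: "(\<And>i. i \<in> I \<Longrightarrow> f i \<in> D_fun M p) \<Longrightarrow> (\<lambda>x. \<Sum>i\<in>I. f i x) \<in> D_fun M p"
  by (induction I rule: infinite_finite_induct) (auto intro: D_fun_const D_fun_add)

lemma D_seminorm_D_norm: "u \<in> D_fun M p \<Longrightarrow> D_seminorm M p (\<lambda>x. ereal (u x)) = ennreal (D_norm M p u)"
  by (simp add: D_fun_iff D_norm_def)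

lemma D_norm_nonneg [simp]: "0 \<le> D_norm M p u"
  by (simp add: D_norm_def)

lemma D_norm_scale: "D_norm M p (\<lambda>x. k * u x) = \<bar>k\<bar> * D_norm M p u"
  by (simp add: D_norm_def D_seminorm_scale enn2real_mult)

lemma D_norm_const [simp]: "D_norm M p (\<lambda>_. k) = 0"
  by (simp add: D_norm_def D_seminorm_const)

lemma D_norm_add: "u \<in> D_fun M p \<Longrightarrow> v \<in> D_fun M p \<Longrightarrow> D_norm M p (\<lambda>x. u x + v x) \<le> D_norm M p u + D_norm M p v"
  using D_seminorm_add_le[of u v] by (simp add: D_seminorm_D_norm D_fun_add flip: ennreal_plus)

lemma D_norm_minus_commute: "D_norm M p (\<lambda>x. u x - v x) = D_norm M p (\<lambda>x. v x - u x)"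
  using D_norm_scale[of "-1" "\<lambda>x. v x - u x"] by simp

lemma D_norm_diff_triangle:
  assumes "u \<in> D_fun M p" "v \<in> D_fun M p" "w \<in> D_fun M p"
  shows "D_norm M p (\<lambda>x. u x - w x) \<le> D_norm M p (\<lambda>x. u x - v x) + D_norm M p (\<lambda>x. v x - w x)"
  using D_norm_add[OF D_fun_diff[OF assms(1,2)] D_fun_diff[OF assms(2,3)]] by simp

lemma D_norm_cong:
  assumes "u \<in> D_fun M p" "v \<in> D_fun M p" "D_norm M p (\<lambda>x. u x - v x) = 0"
  shows "D_norm M p u = D_norm M p v"
  using D_norm_add[OF D_fun_diff[OF assms(1,2)] assms(2)] D_norm_add[OF D_fun_diff[OF assms(2,1)] assms(1)]
    assms(3) D_norm_minus_commute[of u v] by simp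

lemma D_norm_le:
  assumes "upper_gradient g (\<lambda>x. ereal (u x))" "Lp_norm M p g \<le> ennreal B" "0 \<le> B"
  shows "D_norm M p u \<le> B"
  using D_seminorm_le[OF assms(1), of M p] assms(2,3) unfolding D_norm_def by (intro enn2real_leI) auto

lemma D_norm_lessE:
  assumes "u \<in> D_fun M p" "D_norm M p u < a"
  obtains g where "upper_gradient g (\<lambda>x. ereal (u x))" "Lp_norm M p g < ennreal a"
proof -
  have "D_seminorm M p (\<lambda>x. ereal (u x)) < ennreal a"
    using assms D_norm_nonneg[of u] by (simp add: D_seminorm_D_norm ennreal_less_iff)
  then show thesis using that by (rule D_seminorm_lessE)
qed

end

section \<open>The quotient operations and the norm expressed through real-valued
  representatives\<close>

lemma HN_simps:
  "carrier (HN M p) = D_space M p // D_rel M p"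
  "\<zero>\<^bsub>HN M p\<^esub> = D_rel M p `` {\<lambda>_. 0}"
  "U \<oplus>\<^bsub>HN M p\<^esub> V = (\<Union>f\<in>U. \<Union>g\<in>V. D_rel M p `` {D_add f g})"
  "c \<odot>\<^bsub>HN M p\<^esub> U = (\<Union>f\<in>U. D_rel M p `` {D_scale c f})"
  by (simp_all add: HN_def)

lemma real_ring_simps [simp]:
  "carrier real_ring = UNIV" "x \<oplus>\<^bsub>real_ring\<^esub> y = x + y" "x \<otimes>\<^bsub>real_ring\<^esub> y = x * y"
  "\<zero>\<^bsub>real_ring\<^esub> = 0" "\<one>\<^bsub>real_ring\<^esub> = 1"
  by (simp_all add: real_ring_def)

lemma cring_real_ring: "cring real_ring"
proof (rule cringI)
  show "abelian_group real_ring"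
    by (rule abelian_groupI) (auto intro: exI[of _ "- x" for x])
  show "Group.comm_monoid real_ring"
    by (rule comm_monoidI) auto
qed (auto simp: distrib_right)

lemma D_add_measurable:
  assumes [measurable]: "f \<in> borel_measurable N" "g \<in> borel_measurable N"
  shows "D_add f g \<in> borel_measurable N"
  unfolding D_add_def by measurable

context borel_exponent
begin

text \<open>\<open>real_of_ereal\<close> puts 0 in place of infinite values, which alters the
  function only at points where \<open>f\<close> itself is infinite.\<close>

lemma D_fun_real_of_ereal:
  assumes "f \<in> D_space M p"
  shows "(\<lambda>x. real_of_ereal (f x)) \<in> D_fun M p"
    and "D_norm M p (\<lambda>x. real_of_ereal (f x)) = enn2real (D_seminorm M p f)"
proof -
  have "D_seminorm M p (\<lambda>x. ereal (real_of_ereal (f x))) = D_seminorm M p f"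
    by (rule D_seminorm_cong_off_infinities[OF assms assms]) (simp add: ereal_real)
  then show "(\<lambda>x. real_of_ereal (f x)) \<in> D_fun M p"
    "D_norm M p (\<lambda>x. real_of_ereal (f x)) = enn2real (D_seminorm M p f)"
    using assms by (auto simp: D_fun_iff D_space_iff D_norm_def)
qed

lemma D_space_ereal: "u \<in> D_fun M p \<Longrightarrow> (\<lambda>x. ereal (u x)) \<in> D_space M p"
  by (simp add: D_fun_def)

text \<open>Where \<open>f\<close> and \<open>g\<close> are both finite, \<open>D_add\<close> is the
  ordinary sum. The second claim carries a subtracted \<open>u\<close> because
  \<open>D_class_iff\<close> tests membership in a class by such a difference.\<close>

lemma D_space_add:
  assumes f: "f \<in> D_space M p" and g: "g \<in> D_space M p"
  shows "D_add f g \<in> D_space M p"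
    and "u \<in> D_fun M p \<Longrightarrow> D_norm M p (\<lambda>x. real_of_ereal (D_add f g x) - u x) =
      D_norm M p (\<lambda>x. real_of_ereal (f x) + real_of_ereal (g x) - u x)"
proof -
  have "D_seminorm M p (D_add f g) = D_seminorm M p (\<lambda>x. ereal (real_of_ereal (f x) + real_of_ereal (g x)))"
    by (rule D_seminorm_cong_off_infinities[OF f g]) (auto simp: D_add_def ereal_real simp flip: plus_ereal.simps)
  also have "\<dots> < top"
    using D_fun_add[OF D_fun_real_of_ereal(1)[OF f] D_fun_real_of_ereal(1)[OF g]] by (simp add: D_fun_iff)
  finally show "D_add f g \<in> D_space M p"
    using f g by (simp add: D_space_iff D_add_measurable)
  show "D_norm M p (\<lambda>x. real_of_ereal (D_add f g x) - u x) =
      D_norm M p (\<lambda>x. real_of_ereal (f x) + real_of_ereal (g x) - u x)"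
    unfolding D_norm_def
    by (rule arg_cong[where f = enn2real], rule D_seminorm_cong_off_infinities[OF f g])
      (auto simp: D_add_def real_of_ereal_add)
qed

lemma D_space_scale:
  assumes f: "f \<in> D_space M p"
  shows "D_scale c f \<in> D_space M p"
proof -
  have "D_seminorm M p (D_scale c f) = D_seminorm M p (\<lambda>x. ereal (c * real_of_ereal (f x)))"
    by (rule D_seminorm_cong_off_infinities[OF f f]) (auto simp: D_scale_def ereal_real simp flip: times_ereal.simps(1))
  also have "\<dots> < top"
    using D_fun_scale[OF D_fun_real_of_ereal(1)[OF f], of c] by (simp add: D_fun_iff)
  finally show ?thesis
    using f by (auto simp: D_space_iff D_scale_def intro!: borel_measurable_ereal_times)
qed

lemma D_rel_iff: "(f, g) \<in> D_rel M p \<longleftrightarrow> f \<in> D_space M p \<and> g \<in> D_space M p \<and>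
    D_norm M p (\<lambda>x. real_of_ereal (f x) - real_of_ereal (g x)) = 0"
proof (cases "f \<in> D_space M p \<and> g \<in> D_space M p")
  case True
  then have f: "f \<in> D_space M p" and g: "g \<in> D_space M p" by simp_all
  let ?u = "\<lambda>x. real_of_ereal (f x) - real_of_ereal (g x)"
  have "D_seminorm M p (D_add f (D_scale (-1) g)) = D_seminorm M p (\<lambda>x. ereal (?u x))"
  proof (rule D_seminorm_cong_off_infinities[OF f g])
    fix x assume "\<bar>f x\<bar> \<noteq> \<infinity>" "\<bar>g x\<bar> \<noteq> \<infinity>"
    then show "D_add f (D_scale (-1) g) x = ereal (?u x)"
      by (cases "f x"; cases "g x") (simp_all add: D_add_def D_scale_def)
  qed
  also have "\<dots> = ennreal (D_norm M p ?u)"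
    by (intro D_seminorm_D_norm D_fun_diff D_fun_real_of_ereal f g)
  finally show ?thesis using True by (simp add: D_rel_def)
qed (auto simp: D_rel_def)

lemma D_class_iff:
  assumes "u \<in> D_fun M p"
  shows "f \<in> D_class M p u \<longleftrightarrow> f \<in> D_space M p \<and> D_norm M p (\<lambda>x. real_of_ereal (f x) - u x) = 0"
  using D_space_ereal[OF assms] D_norm_minus_commute[of u "\<lambda>x. real_of_ereal (f x)"]
  by (auto simp: D_class_def D_rel_iff)

lemma D_class_self: "u \<in> D_fun M p \<Longrightarrow> (\<lambda>x. ereal (u x)) \<in> D_class M p u"
  by (simp add: D_class_iff D_space_ereal)

lemma D_norm_zero_trans:
  assumes "u \<in> D_fun M p" "v \<in> D_fun M p" "w \<in> D_fun M p"
    and "D_norm M p (\<lambda>x. u x - v x) = 0" "D_norm M p (\<lambda>x. v x - w x) = 0"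
  shows "D_norm M p (\<lambda>x. u x - w x) = 0"
  using D_norm_diff_triangle[OF assms(1-3)] assms(4,5) D_norm_nonneg[of "\<lambda>x. u x - w x"] by simp

lemma D_class_eqI:
  assumes "u \<in> D_fun M p" "v \<in> D_fun M p" "D_norm M p (\<lambda>x. u x - v x) = 0"
  shows "D_class M p u = D_class M p v"
proof -
  have "f \<in> D_class M p u \<Longrightarrow> f \<in> D_class M p v"
    if uv: "u \<in> D_fun M p" "v \<in> D_fun M p" "D_norm M p (\<lambda>x. u x - v x) = 0" for f u v
    using that D_norm_zero_trans[OF D_fun_real_of_ereal(1) uv(1,2)] by (auto simp: D_class_iff)
  from this[OF assms] this[OF assms(2,1)] show ?thesis
    using assms(3) D_norm_minus_commute[of u v] by auto
qed

lemma D_class_eq_iff: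
  assumes "u \<in> D_fun M p" "v \<in> D_fun M p"
  shows "D_class M p u = D_class M p v \<longleftrightarrow> D_norm M p (\<lambda>x. u x - v x) = 0"
  using D_class_eqI[OF assms] D_class_self[OF assms(1)] D_class_iff[OF assms(2)] by auto

lemma D_rel_image:
  assumes "f \<in> D_space M p"
  shows "D_rel M p `` {f} = D_class M p (\<lambda>x. real_of_ereal (f x))"
  using assms D_space_ereal[OF D_fun_real_of_ereal(1)[OF assms]] by (auto simp: D_class_def D_rel_iff)

lemma HN_carrier: "carrier (HN M p) = D_class M p ` D_fun M p"
proof
  show "carrier (HN M p) \<subseteq> D_class M p ` D_fun M p"
    by (auto simp: HN_simps quotient_def D_rel_image D_fun_real_of_ereal)
  show "D_class M p ` D_fun M p \<subseteq> carrier (HN M p)"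
    by (auto simp: HN_simps quotient_def D_class_def dest: D_space_ereal)
qed

lemma HN_zero: "\<zero>\<^bsub>HN M p\<^esub> = D_class M p (\<lambda>_. 0)"
  by (simp add: HN_simps D_class_def zero_ereal_def)

text \<open>The sum of two classes is a union over all pairs of representatives. Each pair
  contributes the same class, by the triangle inequality for the errors of the two representatives,
  and the union is not empty since every class contains its own representative.\<close>

lemma HN_add:
  assumes u: "u \<in> D_fun M p" and v: "v \<in> D_fun M p"
  shows "D_class M p u \<oplus>\<^bsub>HN M p\<^esub> D_class M p v = D_class M p (\<lambda>x. u x + v x)"
proof -
  have "D_rel M p `` {D_add f g} = D_class M p (\<lambda>x. u x + v x)"
    if fg: "f \<in> D_class M p u" "g \<in> D_class M p v" for f g
  proof -
    have f: "f \<in> D_space M p" "D_norm M p (\<lambda>x. real_of_ereal (f x) - u x) = 0"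
      and g: "g \<in> D_space M p" "D_norm M p (\<lambda>x. real_of_ereal (g x) - v x) = 0"
      using fg u v by (auto simp: D_class_iff)
    note uv = D_fun_add[OF u v] and fr = D_fun_real_of_ereal(1)[OF f(1)] and gr = D_fun_real_of_ereal(1)[OF g(1)]
    have "D_norm M p (\<lambda>x. real_of_ereal (f x) + real_of_ereal (g x) - (u x + v x)) \<le> 0"
      using D_norm_add[OF D_fun_diff[OF fr u] D_fun_diff[OF gr v]] f(2) g(2) by (simp add: algebra_simps)
    then have "D_norm M p (\<lambda>x. real_of_ereal (D_add f g x) - (u x + v x)) = 0"
      using D_space_add(2)[OF f(1) g(1) uv] by (simp add: order_antisym)
    then show ?thesis
      using D_rel_image D_space_add(1)[OF f(1) g(1)] D_fun_real_of_ereal(1) uv D_class_eqI by metis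
  qed
  then show ?thesis
    using D_class_self[OF u] D_class_self[OF v] unfolding HN_simps by blast
qed

lemma HN_smult:
  assumes u: "u \<in> D_fun M p"
  shows "c \<odot>\<^bsub>HN M p\<^esub> D_class M p u = D_class M p (\<lambda>x. c * u x)"
proof -
  have "D_rel M p `` {D_scale c f} = D_class M p (\<lambda>x. c * u x)" if "f \<in> D_class M p u" for f
  proof -
    have f: "f \<in> D_space M p" "D_norm M p (\<lambda>x. real_of_ereal (f x) - u x) = 0"
      using that u by (auto simp: D_class_iff)
    have "D_norm M p (\<lambda>x. real_of_ereal (D_scale c f x) - c * u x) = 0"
      using D_norm_scale[of c "\<lambda>x. real_of_ereal (f x) - u x"] f(2)
      by (simp add: D_scale_def right_diff_distrib)
    then show ?thesis
      using D_rel_image D_space_scale[OF f(1)] D_fun_real_of_ereal(1) D_fun_scale[OF u] D_class_eqI by metis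
  qed
  then show ?thesis
    using D_class_self[OF u] unfolding HN_simps by blast
qed

lemma HN_norm_class:
  assumes u: "u \<in> D_fun M p"
  shows "HN_norm M p (D_class M p u) = D_norm M p u"
proof -
  have "enn2real (D_seminorm M p f) = D_norm M p u" if "f \<in> D_class M p u" for f
    using that D_norm_cong[OF D_fun_real_of_ereal(1) u] D_fun_real_of_ereal(2) by (simp add: D_class_iff u)
  then have "(\<lambda>f. enn2real (D_seminorm M p f)) ` D_class M p u = {D_norm M p u}"
    using D_class_self[OF u] by force
  then show ?thesis by (simp add: HN_norm_def)
qed

lemma HN_abelian_group: "abelian_group (HN M p)"
proof (rule abelian_groupI)
  fix x assume "x \<in> carrier (HN M p)"
  then obtain u where u: "u \<in> D_fun M p" "x = D_class M p u" by (auto simp: HN_carrier)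
  have "D_class M p (\<lambda>x. -1 * u x) \<oplus>\<^bsub>HN M p\<^esub> x = \<zero>\<^bsub>HN M p\<^esub>"
    unfolding u(2) HN_add[OF D_fun_scale[OF u(1)] u(1)] HN_zero by simp
  then show "\<exists>y\<in>carrier (HN M p). y \<oplus>\<^bsub>HN M p\<^esub> x = \<zero>\<^bsub>HN M p\<^esub>"
    using D_fun_scale[OF u(1)] unfolding HN_carrier by blast
qed (auto simp: HN_carrier HN_zero HN_add D_fun_add D_fun_const ac_simps)

lemma HN_module: "module real_ring (HN M p)"
  by (rule moduleI[OF cring_real_ring HN_abelian_group])
    (auto simp: HN_carrier HN_add HN_smult D_fun_add D_fun_scale distrib_left distrib_right mult.assoc)

lemma HN_normed_space: "normed_space_on (HN M p) (HN_norm M p)"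
  unfolding normed_space_on_def
proof (intro conjI ballI allI HN_module)
  fix x assume "x \<in> carrier (HN M p)"
  then obtain u where u: "u \<in> D_fun M p" "x = D_class M p u" by (auto simp: HN_carrier)
  show "0 \<le> HN_norm M p x" by (simp add: u HN_norm_class)
  show "HN_norm M p x = 0 \<longleftrightarrow> x = \<zero>\<^bsub>HN M p\<^esub>"
    using D_class_eq_iff[OF u(1) D_fun_const, of 0] by (simp add: u HN_norm_class HN_zero)
  show "HN_norm M p (c \<odot>\<^bsub>HN M p\<^esub> x) = \<bar>c\<bar> * HN_norm M p x" for c
    by (simp add: u HN_norm_class HN_smult D_fun_scale D_norm_scale)
  fix y assume "y \<in> carrier (HN M p)"
  then obtain v where v: "v \<in> D_fun M p" "y = D_class M p v" by (auto simp: HN_carrier)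
  show "HN_norm M p (x \<oplus>\<^bsub>HN M p\<^esub> y) \<le> HN_norm M p x + HN_norm M p y"
    by (simp add: u v HN_norm_class HN_add D_fun_add D_norm_add)
qed

lemma HN_minus:
  assumes u: "u \<in> D_fun M p" and v: "v \<in> D_fun M p"
  shows "D_class M p u \<ominus>\<^bsub>HN M p\<^esub> D_class M p v = D_class M p (\<lambda>x. u x - v x)"
proof -
  interpret abelian_group "HN M p" by (rule HN_abelian_group)
  have "\<ominus>\<^bsub>HN M p\<^esub> D_class M p v = D_class M p (\<lambda>x. -1 * v x)"
    by (rule minus_equality)
      (use HN_add[OF D_fun_scale[OF v] v, of "-1"] D_fun_scale[OF v, of "-1"] v in \<open>auto simp: HN_carrier HN_zero\<close>)
  then show ?thesis
    unfolding a_minus_def using HN_add[OF u D_fun_scale[OF v, of "-1"]] by simp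
qed

lemma HN_finsum:
  fixes l :: "nat \<Rightarrow> real" and f :: "nat \<Rightarrow> 'a \<Rightarrow> real"
  assumes f: "\<And>j. f j \<in> D_fun M p"
  shows "(\<Oplus>\<^bsub>HN M p\<^esub>j\<in>{..n}. l j \<odot>\<^bsub>HN M p\<^esub> D_class M p (f j)) = D_class M p (\<lambda>x. \<Sum>j\<le>n. l j * f j x)"
proof -
  interpret abelian_group "HN M p" by (rule HN_abelian_group)
  have c: "l j \<odot>\<^bsub>HN M p\<^esub> D_class M p (f j) \<in> carrier (HN M p)" for j :: nat
    using HN_smult[OF f] D_fun_scale[OF f] by (auto simp: HN_carrier)
  show ?thesis
  proof (induction n)
    case 0
    have "(\<Oplus>\<^bsub>HN M p\<^esub>j\<in>{..0}. l j \<odot>\<^bsub>HN M p\<^esub> D_class M p (f j)) = l 0 \<odot>\<^bsub>HN M p\<^esub> D_class M p (f 0)"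
      using finsum_insert[of "{}" 0 "\<lambda>j. l j \<odot>\<^bsub>HN M p\<^esub> D_class M p (f j)"] c by (simp add: Pi_def)
    then show ?case using HN_smult[OF f] by simp
  next
    case (Suc n)
    have "(\<Oplus>\<^bsub>HN M p\<^esub>j\<in>{..Suc n}. l j \<odot>\<^bsub>HN M p\<^esub> D_class M p (f j)) =
        l (Suc n) \<odot>\<^bsub>HN M p\<^esub> D_class M p (f (Suc n)) \<oplus>\<^bsub>HN M p\<^esub>
        (\<Oplus>\<^bsub>HN M p\<^esub>j\<in>{..n}. l j \<odot>\<^bsub>HN M p\<^esub> D_class M p (f j))"
      unfolding atMost_Suc by (rule finsum_insert) (use c in auto)
    also have "\<dots> = D_class M p (\<lambda>x. l (Suc n) * f (Suc n) x + (\<Sum>j\<le>n. l j * f j x))"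
      unfolding Suc.IH by (subst HN_smult[OF f]) (intro HN_add D_fun_scale D_fun_sum f)
    finally show ?case by (simp add: add.commute)
  qed
qed

end

section \<open>Completeness\<close>

lemma AE_lborel_Icc_ex:
  fixes a b :: real
  assumes "AE x in lborel. P x" "a < b"
  shows "\<exists>x\<in>{a..b}. P x"
proof (rule ccontr)
  assume "\<not> ?thesis"
  moreover obtain N where "{x \<in> space lborel. \<not> P x} \<subseteq> N" "emeasure lborel N = 0" "N \<in> sets lborel"
    using assms(1) by (rule AE_E)
  ultimately have "{a..b} \<subseteq> N" "N \<in> sets lborel" "emeasure lborel N = 0" by auto
  then have "emeasure lborel {a..b} \<le> 0" using emeasure_mono by metis
  then show False using assms(2) by simp
qed

text \<open>An integrand with the values 0 and \<open>top\<close> has a finite integral only if it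
  vanishes almost everywhere.\<close>

lemma unit_speed_AE_notin:
  assumes c: "unit_speed c L" and E [measurable]: "E \<in> sets borel"
    and fin: "(\<integral>\<^sup>+x\<in>{0..L}. top * indicator E (c x) \<partial>lborel) < \<infinity>"
  shows "AE x in lborel. x \<in> {0..L} \<longrightarrow> c x \<notin> E"
proof -
  have [measurable]: "c \<in> borel_measurable borel" using c by (rule unit_speed_measurable)
  have "AE x in lborel. top * indicator E (c x) * indicator {0..L} x \<noteq> (\<infinity>::ennreal)"
    by (rule nn_integral_PInf_AE) (use fin in auto)
  then show ?thesis by (rule eventually_mono) (auto simp: indicator_def split: if_splits)
qed

lemma upper_gradient_diff_const:
  "upper_gradient g (\<lambda>x. ereal (u x)) \<Longrightarrow> upper_gradient g (\<lambda>x. ereal (u x - k))"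
  by (simp add: upper_gradient_real_iff)

lemma suminf_half_power: "(\<Sum>i. ennreal ((1 / 2) ^ (i + k))) = ennreal (2 * (1 / 2) ^ k)"
proof -
  have "(\<lambda>i. (1 / 2 :: real) ^ i * (1 / 2) ^ k) sums (1 / (1 - 1 / 2) * (1 / 2) ^ k)"
    by (intro sums_mult2 geometric_sums) simp
  then show ?thesis by (intro suminf_ennreal_eq) (simp_all add: power_add)
qed

section \<open>Consequences of the Poincare inequality for integrability and averages on
  balls\<close>

locale poincare_space = borel_exponent +
  fixes C l :: real
  assumes emeasure_ball: "\<And>x r. 0 < r \<Longrightarrow> 0 < emeasure M (ball x r) \<and> emeasure M (ball x r) < \<infinity>"
    and C_pos: "0 < C" and l_ge_1: "1 \<le> l"
    and poincare: "\<And>f g x r. f \<in> borel_measurable (completion M) \<Longrightarrow> upper_gradient g f \<Longrightarrow> 0 < r \<Longrightarrow>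
      (let lhs = nn_average M (ball x r) (\<lambda>y. e2ennreal \<bar>f y - ereal (average M (ball x r) f)\<bar>);
           rhs = ennreal (C * r) *
             ennreal_powr (nn_average M (ball x (l * r)) (\<lambda>y. ennreal_powr (g y) p)) (1 / p)
       in (rhs < \<infinity> \<longrightarrow> integrable_on_set M (ball x r) f) \<and> lhs \<le> rhs)"
begin

abbreviation mu :: "'a \<Rightarrow> real \<Rightarrow> real" where
  "mu x r \<equiv> measure M (ball x r)"

definition avg :: "'a \<Rightarrow> real \<Rightarrow> ('a \<Rightarrow> real) \<Rightarrow> real" where
  "avg x r u = (LINT y:ball x r|completion M. u y) / mu x r"

lemma ball_sets [measurable, simp]: "ball x r \<in> sets M"
  by (simp add: sets_M)

lemma ball_sets_completion [measurable, simp]: "ball x r \<in> sets (completion M)"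
  by (simp add: sets_completionI_sets)

lemma emeasure_ball_eq: "emeasure M (ball x r) = ennreal (mu x r)"
proof (cases "0 < r")
  case True
  then show ?thesis using emeasure_ball[of r x] by (intro emeasure_eq_ennreal_measure) auto
next
  case False
  then have "ball x r = {}" by simp
  then show ?thesis by (simp only: emeasure_empty measure_empty ennreal_0)
qed

lemma mu_pos: "0 < r \<Longrightarrow> 0 < mu x r"
  using emeasure_ball[of r x] by (simp add: emeasure_ball_eq)

text \<open>The Poincare inequality multiplied by the measure of the ball, for real-valued
  functions. The finite norm of \<open>g\<close> makes its right side finite, which activates the
  integrability clause.\<close>

lemma poincare_real:
  assumes u: "u \<in> D_fun M p" and g: "upper_gradient g (\<lambda>x. ereal (u x))" "Lp_norm M p g < top" and r: "0 < r"
  shows "set_integrable (completion M) (ball x r) u"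
    and "(\<integral>\<^sup>+y\<in>ball x r. ennreal \<bar>u y - avg x r u\<bar> \<partial>completion M) \<le>
      ennreal (C * r * mu x r) *
      ennreal_powr ((\<integral>\<^sup>+y\<in>ball x (l * r). ennreal_powr (g y) p \<partial>M) / ennreal (mu x (l * r))) (1 / p)"
proof -
  have um [measurable]: "u \<in> borel_measurable (completion M)" using u by (simp add: D_fun_iff)
  have lr: "0 < l * r" using l_ge_1 r by simp
  let ?f = "\<lambda>x. ereal (u x)"
  let ?I = "\<integral>\<^sup>+y\<in>ball x (l * r). ennreal_powr (g y) p \<partial>M"
  define rhs where "rhs = ennreal (C * r) *
    ennreal_powr (nn_average M (ball x (l * r)) (\<lambda>y. ennreal_powr (g y) p)) (1 / p)"
  have rhs: "rhs = ennreal (C * r) * ennreal_powr (?I / ennreal (mu x (l * r))) (1 / p)"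
    by (simp add: rhs_def nn_average_def nn_integral_completion emeasure_ball_eq)
  have av: "average M (ball x r) ?f = avg x r u"
    by (simp add: average_def avg_def measure_completion)
  have "?I \<le> (\<integral>\<^sup>+y. ennreal_powr (g y) p \<partial>M)"
    by (intro nn_integral_mono) (auto simp: indicator_def)
  then have "?I < top" using g(2) by (simp add: Lp_norm_less_top_iff order_le_less_trans)
  then have "?I / ennreal (mu x (l * r)) < top"
    using mu_pos[OF lr, of x] by (simp add: ennreal_divide_eq_top_iff less_top[symmetric])
  then have "rhs < \<infinity>" using g(2) unfolding rhs by (simp add: ennreal_mult_less_top)
  with poincare[OF borel_measurable_ereal[OF um] g(1) r, of x]
  have int: "integrable_on_set M (ball x r) ?f"
    and le: "nn_average M (ball x r) (\<lambda>y. e2ennreal \<bar>?f y - ereal (average M (ball x r) ?f)\<bar>) \<le> rhs"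
    unfolding rhs_def[symmetric] Let_def by blast+
  have "(\<integral>\<^sup>+y\<in>ball x r. ennreal \<bar>u y\<bar> \<partial>completion M) < \<infinity>"
    using int by (simp add: integrable_on_set_def flip: ennreal.abs_eq)
  also have "(\<integral>\<^sup>+y\<in>ball x r. ennreal \<bar>u y\<bar> \<partial>completion M) =
      (\<integral>\<^sup>+y. ennreal (norm (indicator (ball x r) y *\<^sub>R u y)) \<partial>completion M)"
    by (intro nn_integral_cong) (auto simp: indicator_def)
  finally show "set_integrable (completion M) (ball x r) u"
    unfolding set_integrable_def by (intro integrableI_bounded) auto
  have "(\<integral>\<^sup>+y\<in>ball x r. ennreal \<bar>u y - avg x r u\<bar> \<partial>completion M) / ennreal (mu x r) \<le> rhs"
    using le by (simp add: nn_average_def av emeasure_ball_eq flip: ennreal.abs_eq)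
  then have "ennreal (mu x r) * ((\<integral>\<^sup>+y\<in>ball x r. ennreal \<bar>u y - avg x r u\<bar> \<partial>completion M) / ennreal (mu x r)) \<le>
      ennreal (mu x r) * rhs"
    by (rule mult_left_mono) simp
  also have "ennreal (mu x r) * ((\<integral>\<^sup>+y\<in>ball x r. ennreal \<bar>u y - avg x r u\<bar> \<partial>completion M) / ennreal (mu x r)) =
      (\<integral>\<^sup>+y\<in>ball x r. ennreal \<bar>u y - avg x r u\<bar> \<partial>completion M)"
    using mu_pos[OF r, of x] by (subst ennreal_times_divide, subst mult.commute) (simp add: ennreal_mult_divide_eq)
  also have "ennreal (mu x r) * rhs = ennreal (C * r * mu x r) *
      ennreal_powr (?I / ennreal (mu x (l * r))) (1 / p)"
    unfolding rhs using C_pos r by (simp add: ennreal_mult ac_simps)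
  finally show "(\<integral>\<^sup>+y\<in>ball x r. ennreal \<bar>u y - avg x r u\<bar> \<partial>completion M) \<le>
      ennreal (C * r * mu x r) * ennreal_powr (?I / ennreal (mu x (l * r))) (1 / p)" .
qed

lemma D_fun_set_integrable:
  assumes "u \<in> D_fun M p" "0 < r"
  shows "set_integrable (completion M) (ball x r) u"
proof -
  obtain g where "upper_gradient g (\<lambda>x. ereal (u x))" "Lp_norm M p g < top"
    using assms(1) by (auto simp: D_fun_iff elim: D_seminorm_lessE)
  with poincare_real(1) assms show ?thesis by blast
qed

lemma avg_diff_le:
  assumes u: "u \<in> D_fun M p" and r: "0 < r"
  shows "ennreal (mu x r * \<bar>avg x r u - k\<bar>) \<le> (\<integral>\<^sup>+y\<in>ball x r. ennreal \<bar>u y - k\<bar> \<partial>completion M)"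
proof -
  have int: "set_integrable (completion M) (ball x r) (\<lambda>y. u y - k)"
    by (intro set_integral_diff D_fun_set_integrable D_fun_const u r)
  have "(LINT y:ball x r|completion M. u y - k) = mu x r * (avg x r u - k)"
  proof -
    have "(LINT y:ball x r|completion M. u y - k) =
        (LINT y:ball x r|completion M. u y) - (LINT y:ball x r|completion M. k)"
      by (intro set_integral_diff D_fun_set_integrable D_fun_const u r)
    also have "(LINT y:ball x r|completion M. k) = mu x r * k"
      by (simp add: set_lebesgue_integral_def measure_completion)
    finally show ?thesis using mu_pos[OF r, of x] by (simp add: avg_def right_diff_distrib)
  qed
  then have "mu x r * \<bar>avg x r u - k\<bar> = norm (LINT y:ball x r|completion M. u y - k)"
    using mu_pos[OF r, of x] by (simp add: abs_mult)
  also have "ennreal \<dots> \<le> (\<integral>\<^sup>+y. ennreal (norm (indicator (ball x r) y *\<^sub>R (u y - k))) \<partial>completion M)"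
    unfolding set_lebesgue_integral_def using int
    by (intro integral_norm_bound_ennreal) (simp add: set_integrable_def)
  also have "\<dots> = (\<integral>\<^sup>+y\<in>ball x r. ennreal \<bar>u y - k\<bar> \<partial>completion M)"
    by (intro nn_integral_cong) (auto simp: indicator_def)
  finally show ?thesis .
qed

text \<open>Subtracting the average over the unit ball normalizes \<open>u\<close> once for all
  radii. On \<open>ball x R\<close> the Poincare inequality controls the deviation from the average
  over that ball; since it contains \<open>ball x 1\<close>, the two averages differ by at most the
  same deviation divided by \<open>mu x 1\<close>. The constant depends on \<open>x\<close> and
  \<open>R\<close> but not on \<open>u\<close> or \<open>g\<close>, so the bound can be summed over
  a series.\<close>

lemma local_L1_bound:
  assumes R: "1 \<le> R"
  obtains K where "0 \<le> K" "\<And>u g. u \<in> D_fun M p \<Longrightarrow> upper_gradient g (\<lambda>x. ereal (u x)) \<Longrightarrow> Lp_norm M p g < top \<Longrightarrow>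
    (\<integral>\<^sup>+y\<in>ball x R. ennreal \<bar>u y - avg x 1 u\<bar> \<partial>completion M) \<le> ennreal K * Lp_norm M p g"
proof -
  define A where "A = C * R * mu x R * (1 / mu x (l * R)) powr (1 / p)"
  define K where "K = (1 + mu x R / mu x 1) * A"
  have pos: "0 < R" "0 < mu x R" "0 < mu x 1" "0 < mu x (l * R)" "0 < l * R"
    using R l_ge_1 by (auto intro!: mu_pos)
  have div: "a / ennreal (mu x (l * R)) = ennreal (1 / mu x (l * R)) * a" for a
    using pos(4) by (simp add: divide_ennreal_def inverse_ennreal inverse_eq_divide mult.commute)
  have A0: "0 \<le> A" using pos C_pos by (simp add: A_def)
  show thesis
  proof (rule that[of K])
    show "0 \<le> K" using pos A0 by (simp add: K_def)
    fix u g assume u: "u \<in> D_fun M p" and g: "upper_gradient g (\<lambda>x. ereal (u x))" "Lp_norm M p g < top"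
    define X where "X = (\<integral>\<^sup>+y\<in>ball x R. ennreal \<bar>u y - avg x R u\<bar> \<partial>completion M)"
    have [measurable]: "u \<in> borel_measurable (completion M)" using u by (simp add: D_fun_iff)
    have "X \<le> ennreal (C * R * mu x R) *
        ennreal_powr ((\<integral>\<^sup>+y\<in>ball x (l * R). ennreal_powr (g y) p \<partial>M) / ennreal (mu x (l * R))) (1 / p)"
      unfolding X_def by (rule poincare_real(2)[OF u g pos(1)])
    also have "\<dots> \<le> ennreal (C * R * mu x R) *
        ennreal_powr (ennreal (1 / mu x (l * R)) * (\<integral>\<^sup>+y. ennreal_powr (g y) p \<partial>M)) (1 / p)"
    proof (intro mult_left_mono ennreal_powr_mono)
      have "(\<integral>\<^sup>+y\<in>ball x (l * R). ennreal_powr (g y) p \<partial>M) \<le> (\<integral>\<^sup>+y. ennreal_powr (g y) p \<partial>M)"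
        by (intro nn_integral_mono) (auto simp: indicator_def)
      then show "(\<integral>\<^sup>+y\<in>ball x (l * R). ennreal_powr (g y) p \<partial>M) / ennreal (mu x (l * R)) \<le>
          ennreal (1 / mu x (l * R)) * (\<integral>\<^sup>+y. ennreal_powr (g y) p \<partial>M)"
        unfolding div by (rule mult_left_mono) simp
    qed (use p0 in auto)
    also have "\<dots> = ennreal A * Lp_norm M p g"
      using pos C_pos by (simp add: A_def ennreal_powr_mult Lp_norm_def ennreal_mult mult.assoc)
    finally have X: "X \<le> ennreal A * Lp_norm M p g" .
    have "ennreal (mu x 1 * \<bar>avg x 1 u - avg x R u\<bar>) \<le>
        (\<integral>\<^sup>+y\<in>ball x 1. ennreal \<bar>u y - avg x R u\<bar> \<partial>completion M)"
      by (rule avg_diff_le[OF u]) simp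
    also have "\<dots> \<le> X" unfolding X_def
      using R by (intro nn_integral_mono) (auto simp: indicator_def)
    finally have avgd: "ennreal (mu x 1 * \<bar>avg x 1 u - avg x R u\<bar>) \<le> X" .
    have "(\<integral>\<^sup>+y\<in>ball x R. ennreal \<bar>u y - avg x 1 u\<bar> \<partial>completion M) \<le>
        (\<integral>\<^sup>+y. ennreal \<bar>u y - avg x R u\<bar> * indicator (ball x R) y +
          ennreal \<bar>avg x 1 u - avg x R u\<bar> * indicator (ball x R) y \<partial>completion M)"
      by (intro nn_integral_mono) (auto simp: indicator_def simp flip: ennreal_plus intro!: ennreal_leI)
    also have "\<dots> = X + ennreal \<bar>avg x 1 u - avg x R u\<bar> * ennreal (mu x R)"
      unfolding X_def by (subst nn_integral_add) (auto simp: nn_integral_cmult emeasure_ball_eq)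
    also have "ennreal \<bar>avg x 1 u - avg x R u\<bar> * ennreal (mu x R) =
        ennreal (mu x R / mu x 1) * ennreal (mu x 1 * \<bar>avg x 1 u - avg x R u\<bar>)"
      using pos by (simp flip: ennreal_mult)
    also have "X + \<dots> \<le> X + ennreal (mu x R / mu x 1) * X"
      using avgd by (intro add_left_mono mult_left_mono) auto
    also have "\<dots> = ennreal (1 + mu x R / mu x 1) * X"
      using pos by (simp add: distrib_right)
    also have "\<dots> \<le> ennreal (1 + mu x R / mu x 1) * (ennreal A * Lp_norm M p g)"
      using X by (rule mult_left_mono) simp
    also have "\<dots> = ennreal K * Lp_norm M p g"
      using pos A0 by (simp add: K_def ennreal_mult mult.assoc)
    finally show "(\<integral>\<^sup>+y\<in>ball x R. ennreal \<bar>u y - avg x 1 u\<bar> \<partial>completion M) \<le> ennreal K * Lp_norm M p g" .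
  qed
qed

text \<open>Geometric bounds for the integrals make the sum integrable on each ball, hence finite
  almost everywhere there, and countably many balls around \<open>x0\<close> exhaust the space. It
  serves both the series of differences and the errors of net averages.\<close>

lemma AE_suminf_not_top:
  assumes f [measurable]: "\<And>i. f i \<in> borel_measurable (completion M)"
    and le: "\<And>R. 1 \<le> R \<Longrightarrow> \<exists>K\<ge>0. \<forall>i. (\<integral>\<^sup>+x\<in>ball x0 R. f i x \<partial>completion M) \<le> ennreal (K * (1 / 2) ^ i)"
  shows "AE x in M. (\<Sum>i. f i x) \<noteq> \<infinity>"
proof -
  have "AE x in completion M. x \<in> ball x0 (real n + 1) \<longrightarrow> (\<Sum>i. f i x) \<noteq> \<infinity>" for n
  proof -
    obtain K where K: "0 \<le> K" "\<And>i. (\<integral>\<^sup>+x\<in>ball x0 (real n + 1). f i x \<partial>completion M) \<le> ennreal (K * (1 / 2) ^ i)"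
      using le[of "real n + 1"] by auto
    have "(\<integral>\<^sup>+x. (\<Sum>i. f i x * indicator (ball x0 (real n + 1)) x) \<partial>completion M) =
        (\<Sum>i. \<integral>\<^sup>+x\<in>ball x0 (real n + 1). f i x \<partial>completion M)"
      by (rule nn_integral_suminf) measurable
    also have "\<dots> \<le> (\<Sum>i. ennreal K * ennreal ((1 / 2) ^ (i + 0)))"
      using K by (intro suminf_le summableI) (simp flip: ennreal_mult)
    also have "\<dots> = ennreal K * ennreal (2 * (1 / 2) ^ 0)"
      by (subst ennreal_suminf_cmult) (simp only: suminf_half_power)
    also have "\<dots> < \<infinity>" by (simp add: ennreal_mult_less_top)
    finally have "AE x in completion M. (\<Sum>i. f i x * indicator (ball x0 (real n + 1)) x) \<noteq> \<infinity>"
      by (intro nn_integral_PInf_AE) auto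
    then show ?thesis by (rule eventually_mono) auto
  qed
  then have "AE x in completion M. \<forall>n. x \<in> ball x0 (real n + 1) \<longrightarrow> (\<Sum>i. f i x) \<noteq> \<infinity>"
    unfolding AE_all_countable by blast
  then have "AE x in completion M. (\<Sum>i. f i x) \<noteq> \<infinity>"
  proof (rule eventually_mono)
    fix x assume *: "\<forall>n. x \<in> ball x0 (real n + 1) \<longrightarrow> (\<Sum>i. f i x) \<noteq> \<infinity>"
    obtain n where "dist x0 x < real n" using reals_Archimedean2 by blast
    then have "x \<in> ball x0 (real n + 1)" by simp
    with * show "(\<Sum>i. f i x) \<noteq> \<infinity>" by blast
  qed
  then show ?thesis by (simp only: AE_completion_iff)
qed

lemma D_complete:
  fixes f :: "nat \<Rightarrow> 'a \<Rightarrow> real"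
  assumes f: "\<And>i. f i \<in> D_fun M p"
    and cauchy: "\<And>e. 0 < e \<Longrightarrow> \<exists>n. \<forall>i\<ge>n. \<forall>j\<ge>n. D_norm M p (\<lambda>x. f i x - f j x) < e"
  obtains F where "F \<in> D_fun M p" "(\<lambda>k. D_norm M p (\<lambda>x. f k x - F x)) \<longlonglongrightarrow> 0"
proof -
  have "\<forall>k. \<exists>n. \<forall>i\<ge>n. \<forall>j\<ge>n. D_norm M p (\<lambda>x. f i x - f j x) < (1 / 2) ^ k"
    using cauchy by simp
  then obtain N where N: "\<And>k i j. N k \<le> i \<Longrightarrow> N k \<le> j \<Longrightarrow> D_norm M p (\<lambda>x. f i x - f j x) < (1 / 2) ^ k"
    by metis
  \<comment> \<open>Partial sums put both \<open>s k\<close> and \<open>s (Suc k)\<close> beyond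
    \<open>N k\<close>, so the \<open>k\<close>-th difference has norm below
    \<open>(1 / 2) ^ k\<close>.\<close>
  define s where "s k = (\<Sum>i\<le>k. N i)" for k
  have sN: "N k \<le> s k" "N k \<le> s (Suc k)" for k
    by (auto simp: s_def sum.atMost_Suc intro: member_le_sum trans_le_add1)
  define d where "d i x = f (s (Suc i)) x - f (s i) x" for i x
  have dD: "d i \<in> D_fun M p" for i unfolding d_def by (intro D_fun_diff f)
  have "\<exists>g. upper_gradient g (\<lambda>x. ereal (d i x)) \<and> Lp_norm M p g < ennreal ((1 / 2) ^ i)" for i
    using D_norm_lessE[OF dD[of i], of "(1 / 2) ^ i"] N[OF sN(2) sN(1)] unfolding d_def by metis
  then obtain g where g: "\<And>i. upper_gradient (g i) (\<lambda>x. ereal (d i x))"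
    and Lg: "\<And>i. Lp_norm M p (g i) < ennreal ((1 / 2) ^ i)" by metis
  fix x0 :: 'a
  \<comment> \<open>The seminorm ignores additive constants, so the differences themselves may
    diverge everywhere; removing the average over \<open>ball x0 1\<close> restores local control
    and keeps the upper gradient.\<close>
  define v where "v i x = d i x - avg x0 1 (d i)" for i x
  have gv: "upper_gradient (g i) (\<lambda>x. ereal (v i x))" for i
    unfolding v_def by (rule upper_gradient_diff_const[OF g])
  have [measurable]: "f i \<in> borel_measurable (completion M)" "v i \<in> borel_measurable (completion M)" for i
  proof -
    show "f i \<in> borel_measurable (completion M)" using f by (simp add: D_fun_iff)
    show "v i \<in> borel_measurable (completion M)" unfolding v_def using D_fun_diff[OF dD D_fun_const] by (simp add: D_fun_iff)
  qed
  have [measurable]: "g i \<in> borel_measurable borel" "g i \<in> borel_measurable M" for i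
    using g[of i] upper_gradient_measurable[OF g] by (simp_all add: upper_gradient_def)
  have "AE x in M. (\<Sum>i. ennreal \<bar>v i x\<bar>) \<noteq> \<infinity>"
  proof (rule AE_suminf_not_top)
    fix R :: real assume "1 \<le> R"
    then obtain K where K: "0 \<le> K" "\<And>u g. u \<in> D_fun M p \<Longrightarrow> upper_gradient g (\<lambda>x. ereal (u x)) \<Longrightarrow> Lp_norm M p g < top \<Longrightarrow>
      (\<integral>\<^sup>+y\<in>ball x0 R. ennreal \<bar>u y - avg x0 1 u\<bar> \<partial>completion M) \<le> ennreal K * Lp_norm M p g"
      by (rule local_L1_bound) (rule that)
    have "(\<integral>\<^sup>+x\<in>ball x0 R. ennreal \<bar>v i x\<bar> \<partial>completion M) \<le> ennreal (K * (1 / 2) ^ i)" for i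
    proof -
      have "(\<integral>\<^sup>+x\<in>ball x0 R. ennreal \<bar>v i x\<bar> \<partial>completion M) \<le> ennreal K * Lp_norm M p (g i)"
        unfolding v_def using Lg[of i] by (intro K(2) dD g) (rule order.strict_trans, auto)
      also have "\<dots> \<le> ennreal K * ennreal ((1 / 2) ^ i)"
        using Lg[of i] by (intro mult_left_mono) auto
      finally show ?thesis using K(1) by (simp add: ennreal_mult)
    qed
    with K(1) show "\<exists>K\<ge>0. \<forall>i. (\<integral>\<^sup>+x\<in>ball x0 R. ennreal \<bar>v i x\<bar> \<partial>completion M) \<le> ennreal (K * (1 / 2) ^ i)"
      by (intro exI[of _ K]) simp
  qed measurable
  then obtain E where E: "{x \<in> space M. \<not> (\<Sum>i. ennreal \<bar>v i x\<bar>) \<noteq> \<infinity>} \<subseteq> E" "emeasure M E = 0" "E \<in> sets M"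
    by (rule AE_E)
  have [measurable]: "E \<in> sets borel" "E \<in> sets M" using E(3) sets_M by auto
  have spaceM: "space M = UNIV" using sets_eq_imp_space_eq[OF sets_M] by simp
  have offE: "(\<Sum>i. ennreal \<bar>v i x\<bar>) < \<infinity>" if "x \<notin> E" for x
    using E(1) that by (auto simp: spaceM less_top)
  \<comment> \<open>On \<open>E\<close> the series may diverge, and then \<open>suminf\<close> has
    an unspecified value. This is harmless: every point of a curve with finite
    \<open>h k\<close>-integral will turn out to be a point of convergence.\<close>
  define F where "F x = f (s 0) x + (\<Sum>i. v i x)" for x
  have FM [measurable]: "F \<in> borel_measurable (completion M)" unfolding F_def by measurable
  define h where "h k x = (\<Sum>i. g (i + k) x) + top * indicator E x" for k x
  have ug: "upper_gradient (h k) (\<lambda>x. ereal (F x - f (s k) x))" for k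
  proof (rule upper_gradientI_unit_speed)
    show "h k \<in> borel_measurable borel" unfolding h_def by measurable
    fix c L assume c: "unit_speed c L" and fin: "(\<integral>\<^sup>+x\<in>{0..L}. h k (c x) \<partial>lborel) < \<infinity>"
    have [measurable]: "c \<in> borel_measurable borel" using c by (rule unit_speed_measurable)
    have L: "0 < L" using c by (simp add: unit_speed_def)
    have "(\<integral>\<^sup>+x\<in>{0..L}. top * indicator E (c x) \<partial>lborel) \<le> (\<integral>\<^sup>+x\<in>{0..L}. h k (c x) \<partial>lborel)"
      by (intro nn_integral_mono mult_right_mono) (auto simp: h_def)
    then have "AE x in lborel. x \<in> {0..L} \<longrightarrow> c x \<notin> E"
      using fin by (intro unit_speed_AE_notin[OF c]) auto
    from AE_lborel_Icc_ex[OF this L] obtain r where r: "r \<in> {0..L}" "c r \<notin> E" by blast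
    define J where "J i = (\<integral>\<^sup>+x\<in>{0..L}. g (i + k) (c x) \<partial>lborel)" for i
    have "(\<Sum>i. J i) = (\<integral>\<^sup>+x. (\<Sum>i. g (i + k) (c x) * indicator {0..L} x) \<partial>lborel)"
      unfolding J_def by (rule nn_integral_suminf[symmetric]) measurable
    also have "\<dots> \<le> (\<integral>\<^sup>+x\<in>{0..L}. h k (c x) \<partial>lborel)"
      by (intro nn_integral_mono) (auto simp: h_def indicator_def)
    finally have J: "(\<Sum>i. J i) \<le> (\<integral>\<^sup>+x\<in>{0..L}. h k (c x) \<partial>lborel)" .
    have vdiff: "ennreal \<bar>v (i + k) (c t) - v (i + k) (c t')\<bar> \<le> J i"
      if "0 \<le> t'" "t' \<le> t" "t \<le> L" for i t t'
    proof -
      have "ennreal \<bar>v (i + k) (c t) - v (i + k) (c t')\<bar> \<le> (\<integral>\<^sup>+x\<in>{t'..t}. g (i + k) (c x) \<partial>lborel)"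
        by (rule upper_gradient_unit_speed[OF gv c that])
      also have "\<dots> \<le> J i" unfolding J_def
        using that by (intro nn_integral_mono mult_left_mono) (auto simp: indicator_def)
      finally show ?thesis .
    qed
    \<comment> \<open>Convergence at the single point \<open>c r\<close> outside \<open>E\<close>
      spreads over the curve: the terms at \<open>c t\<close> and \<open>c r\<close> differ by at
      most \<open>J i\<close>, and the \<open>J i\<close> have a finite sum.\<close>
    have summ: "summable (\<lambda>i. \<bar>v (i + k) (c t)\<bar>)" if "t \<in> {0..L}" for t
    proof -
      have "(\<Sum>i. ennreal \<bar>v (i + k) (c r)\<bar>) \<le> (\<Sum>i. ennreal \<bar>v i (c r)\<bar>)"
        by (subst suminf_offset[of "\<lambda>i. ennreal \<bar>v i (c r)\<bar>" k]) auto
      also have "\<dots> < \<infinity>" using r by (intro offE) simp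
      finally have r_fin: "(\<Sum>i. ennreal \<bar>v (i + k) (c r)\<bar>) < \<infinity>" .
      have "(\<Sum>i. ennreal \<bar>v (i + k) (c t)\<bar>) \<le> (\<Sum>i. ennreal \<bar>v (i + k) (c r)\<bar> + J i)"
      proof (intro suminf_le summableI)
        fix i
        have "ennreal \<bar>v (i + k) (c t) - v (i + k) (c r)\<bar> \<le> J i"
          using vdiff[of r t i] vdiff[of t r i] that r by (cases "r \<le> t") (auto simp: abs_minus_commute)
        moreover have "ennreal \<bar>v (i + k) (c t)\<bar> \<le> ennreal \<bar>v (i + k) (c r)\<bar> + ennreal \<bar>v (i + k) (c t) - v (i + k) (c r)\<bar>"
          by (simp flip: ennreal_plus)
        ultimately show "ennreal \<bar>v (i + k) (c t)\<bar> \<le> ennreal \<bar>v (i + k) (c r)\<bar> + J i"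
          by (meson add_left_mono order.trans)
      qed
      also have "\<dots> = (\<Sum>i. ennreal \<bar>v (i + k) (c r)\<bar>) + (\<Sum>i. J i)"
        by (rule suminf_add[symmetric]) (rule summableI)+
      also have "\<dots> < \<infinity>" using r_fin J fin by (simp add: order_le_less_trans)
      finally show ?thesis by (intro summable_suminf_not_top) auto
    qed
    \<comment> \<open>The subtracted averages leave a constant that does not depend on
      \<open>t\<close>, so it cancels between the end points.\<close>
    have Fv: "F (c t) - f (s k) (c t) = (\<Sum>i. v (i + k) (c t)) - (\<Sum>i<k. avg x0 1 (d i))" if "t \<in> {0..L}" for t
    proof -
      have "summable (\<lambda>i. v i (c t))"
        using summable_rabs_cancel[OF summ[OF that]] summable_iff_shift[of "\<lambda>i. v i (c t)" k] by blast
      then have "(\<Sum>i. v i (c t)) = (\<Sum>i. v (i + k) (c t)) + (\<Sum>i<k. v i (c t))"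
        by (rule suminf_split_initial_segment)
      moreover have "(\<Sum>i<k. v i (c t)) = f (s k) (c t) - f (s 0) (c t) - (\<Sum>i<k. avg x0 1 (d i))"
        by (induction k) (simp_all add: v_def d_def[of _ "c t"])
      ultimately show ?thesis by (simp add: F_def)
    qed
    let ?a = "\<lambda>i. v (i + k) (c L) - v (i + k) (c 0)"
    have s0: "summable (\<lambda>i. v (i + k) (c 0))" and sL: "summable (\<lambda>i. v (i + k) (c L))"
      using L by (auto intro!: summable_rabs_cancel[OF summ])
    have abs_a: "summable (\<lambda>i. \<bar>?a i\<bar>)"
    proof (rule summable_comparison_test)
      show "summable (\<lambda>i. \<bar>v (i + k) (c L)\<bar> + \<bar>v (i + k) (c 0)\<bar>)" using L by (intro summable_add summ) auto
      show "\<exists>N. \<forall>n\<ge>N. norm \<bar>?a n\<bar> \<le> \<bar>v (n + k) (c L)\<bar> + \<bar>v (n + k) (c 0)\<bar>" by auto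
    qed
    have "F (c L) - f (s k) (c L) - (F (c 0) - f (s k) (c 0)) = (\<Sum>i. ?a i)"
      using suminf_diff[OF sL s0] Fv[of L] Fv[of 0] L by simp
    then have "ennreal \<bar>F (c L) - f (s k) (c L) - (F (c 0) - f (s k) (c 0))\<bar> \<le> ennreal (\<Sum>i. \<bar>?a i\<bar>)"
      using summable_rabs[OF abs_a] by (intro ennreal_leI) simp
    also have "\<dots> = (\<Sum>i. ennreal \<bar>?a i\<bar>)"
      using abs_a by (intro suminf_ennreal_eq[symmetric]) (auto intro: summable_sums)
    also have "\<dots> \<le> (\<Sum>i. J i)"
      using vdiff[of 0 L] L by (intro suminf_le summableI) auto
    also note J
    finally show "ennreal \<bar>F (c L) - f (s k) (c L) - (F (c 0) - f (s k) (c 0))\<bar> \<le>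
      (\<integral>\<^sup>+x\<in>{0..L}. h k (c x) \<partial>lborel)" .
  qed
  have Lh: "Lp_norm M p (h k) \<le> ennreal (2 * (1 / 2) ^ k)" for k
  proof -
    have "Lp_norm M p (h k) \<le> Lp_norm M p (\<lambda>x. \<Sum>i. g (i + k) x) + Lp_norm M p (\<lambda>x. top * indicator E x)"
      unfolding h_def using p1 by (intro Lp_norm_triangle) measurable
    also have "Lp_norm M p (\<lambda>x. top * indicator E x) = 0"
      using E(2,3) by (intro Lp_norm_null p0) (simp add: null_sets_def)
    also have "Lp_norm M p (\<lambda>x. \<Sum>i. g (i + k) x) + 0 \<le> (\<Sum>i. Lp_norm M p (g (i + k)))"
      using Lp_norm_suminf[OF p1, of "\<lambda>i. g (i + k)" M] by simp
    also have "\<dots> \<le> (\<Sum>i. ennreal ((1 / 2) ^ (i + k)))"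
      using Lg by (intro suminf_le summableI) (auto intro: less_imp_le)
    finally show ?thesis unfolding suminf_half_power .
  qed
  have FD: "F \<in> D_fun M p"
  proof -
    have "D_seminorm M p (\<lambda>x. ereal (F x - f (s 0) x)) \<le> ennreal (2 * (1 / 2) ^ 0)"
      using D_seminorm_le[OF ug] Lh by (rule order.trans)
    then have "(\<lambda>x. F x - f (s 0) x) \<in> D_fun M p"
      by (auto simp: D_fun_iff order_le_less_trans)
    from D_fun_add[OF this f[of "s 0"]] show ?thesis by simp
  qed
  \<comment> \<open>One \<open>(1 / 2) ^ k\<close> comes from the Cauchy property between
    \<open>j\<close> and \<open>s k\<close>, two more from the geometric tail of the gradients in
    \<open>Lh\<close>.\<close>
  have le: "D_norm M p (\<lambda>x. f j x - F x) \<le> 3 * (1 / 2) ^ k" if "N k \<le> j" for j k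
  proof -
    have "D_norm M p (\<lambda>x. f j x - F x) \<le> D_norm M p (\<lambda>x. f j x - f (s k) x) + D_norm M p (\<lambda>x. f (s k) x - F x)"
      by (rule D_norm_diff_triangle[OF f f FD])
    also have "D_norm M p (\<lambda>x. f j x - f (s k) x) \<le> (1 / 2) ^ k"
      using N[OF that sN(1)] by simp
    also have "D_norm M p (\<lambda>x. f (s k) x - F x) \<le> 2 * (1 / 2) ^ k"
      unfolding D_norm_minus_commute[of "f (s k)"] by (rule D_norm_le[OF ug Lh]) simp
    finally show ?thesis by simp
  qed
  have "(\<lambda>k. D_norm M p (\<lambda>x. f k x - F x)) \<longlonglongrightarrow> 0"
  proof (rule LIMSEQ_I)
    fix e :: real assume e: "0 < e"
    obtain k where "(1 / 2) ^ k < e / 3" using real_arch_pow_inv[of "e / 3" "1 / 2"] e by auto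
    then have "norm (D_norm M p (\<lambda>x. f j x - F x) - 0) < e" if "N k \<le> j" for j
      using le[OF that] by simp
    then show "\<exists>n0. \<forall>n\<ge>n0. norm (D_norm M p (\<lambda>x. f n x - F x) - 0) < e" by blast
  qed
  with FD show thesis by (rule that)
qed

end

section \<open>Nets and discrete energies\<close>

definition is_net :: "real \<Rightarrow> 'a::metric_space set \<Rightarrow> bool" where
  "is_net r S \<longleftrightarrow> (\<forall>x\<in>S. \<forall>y\<in>S. x \<noteq> y \<longrightarrow> r \<le> dist x y) \<and> (\<forall>x. \<exists>s\<in>S. dist s x < r)"

text \<open>A maximal separated set, from Zorn's lemma, is also dense at scale \<open>r\<close>: a
  point at distance at least \<open>r\<close> from all of it could be added.\<close>

lemma is_net_exists:
  assumes "0 < r"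
  shows "\<exists>S :: 'a::metric_space set. is_net r S"
proof -
  define A where "A = {S :: 'a set. \<forall>x\<in>S. \<forall>y\<in>S. x \<noteq> y \<longrightarrow> r \<le> dist x y}"
  have "\<exists>S\<in>A. \<forall>X\<in>A. S \<subseteq> X \<longrightarrow> X = S"
  proof (rule subset_Zorn')
    fix \<C> assume ch: "subset.chain A \<C>"
    show "\<Union>\<C> \<in> A" unfolding A_def
    proof (intro CollectI ballI impI)
      fix x y assume "x \<in> \<Union>\<C>" "y \<in> \<Union>\<C>" "x \<noteq> y"
      then obtain X Y where XY: "X \<in> \<C>" "Y \<in> \<C>" "x \<in> X" "y \<in> Y" by blast
      then have "X \<subseteq> Y \<or> Y \<subseteq> X" "X \<in> A" "Y \<in> A"
        using ch unfolding subset.chain_def by blast+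
      then show "r \<le> dist x y" using XY \<open>x \<noteq> y\<close> unfolding A_def by blast
    qed
  qed
  then obtain S where S: "S \<in> A" "\<And>X. X \<in> A \<Longrightarrow> S \<subseteq> X \<Longrightarrow> X = S" by blast
  have "\<exists>s\<in>S. dist s x < r" for x
  proof (rule ccontr)
    assume far: "\<not> ?thesis"
    then have "insert x S \<in> A"
      using S(1) unfolding A_def by (auto simp: not_less dist_commute)
    then have "x \<in> S" using S(2)[of "insert x S"] by blast
    then show False using far assms by force
  qed
  then show ?thesis using S(1) unfolding is_net_def A_def by blast
qed

text \<open>The hypothesis makes all superlevel sets open. It fits \<open>osc\<close>, a sum of
  nonnegative terms whose index set can only gain members under a small move of the point.\<close>

lemma borel_measurable_locally_ge:
  fixes h :: "'a::metric_space \<Rightarrow> real"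
  assumes "\<And>x. \<exists>e>0. \<forall>y. dist x y < e \<longrightarrow> h x \<le> h y"
  shows "h \<in> borel_measurable borel"
proof -
  have "open {x. a < h x}" for a
    unfolding open_dist using assms by (auto simp: dist_commute) (meson less_le_trans)
  then show ?thesis by (simp add: borel_measurable_iff_greater borel_open)
qed

text \<open>Replaces the power \<open>1 / p\<close> in the Poincare inequality by a bound linear in
  the integral, which can be summed over the balls of a net.\<close>

lemma ennreal_powr_le_one_plus:
  assumes "1 \<le> p"
  shows "ennreal_powr a (1 / p) \<le> 1 + a"
proof (cases a)
  case (real x)
  have "x powr (1 / p) \<le> 1 + x"
  proof (cases "x \<le> 1")
    case True
    then have "x powr (1 / p) \<le> 1" using real assms by (intro powr_le1) auto
    then show ?thesis using real by simp
  next
    case False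
    then have "x powr (1 / p) \<le> x powr 1" using assms by (intro powr_mono) auto
    then show ?thesis using False by simp
  qed
  then have "ennreal (x powr (1 / p)) \<le> ennreal (1 + x)" by (rule ennreal_leI)
  then show ?thesis using real by simp
qed simp

locale doubling_poincare_space = poincare_space +
  fixes Cd :: real
  assumes Cd_ge_1: "1 \<le> Cd"
    and mu_doubling: "\<And>x r. 0 < r \<Longrightarrow> mu x (2 * r) \<le> Cd * mu x r"
begin

lemma mu_doubling_pow: "0 < r \<Longrightarrow> mu x (2 ^ k * r) \<le> Cd ^ k * mu x r"
proof (induction k)
  case (Suc k)
  have "mu x (2 * (2 ^ k * r)) \<le> Cd * mu x (2 ^ k * r)"
    using Suc.prems by (intro mu_doubling) auto
  also have "\<dots> \<le> Cd * (Cd ^ k * mu x r)"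
    using Suc Cd_ge_1 by (intro mult_left_mono) auto
  finally show ?case by (simp add: mult.assoc)
qed simp

lemma mu_mono:
  assumes "ball x r \<subseteq> ball y s"
  shows "mu x r \<le> mu y s"
  using assms by (intro measure_mono_fmeasurable) (auto simp: fmeasurable_def emeasure_ball_eq)

lemma nn_integral_set_mono: "A \<subseteq> B \<Longrightarrow> (\<integral>\<^sup>+x\<in>A. f x \<partial>N) \<le> (\<integral>\<^sup>+x\<in>B. f x \<partial>N)"
  by (intro nn_integral_mono mult_left_mono indicator_leI) auto

text \<open>Volume counting. With \<open>R = 2 ^ k * r\<close>, the balls of radius
  \<open>r / 2\<close> around the net points in question are disjoint and lie in
  \<open>ball x (2 * R)\<close>, and each of them enlarged to radius \<open>4 * R\<close> covers
  that ball. The exponent \<open>k + 3\<close> counts the doublings from \<open>r / 2\<close> to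
  \<open>4 * R\<close>.\<close>

lemma net_card:
  fixes S :: "'a set"
  assumes S: "is_net r S" and r: "0 < r"
  shows "finite {s\<in>S. dist s x < 2 ^ k * r} \<and> real (card {s\<in>S. dist s x < 2 ^ k * r}) \<le> Cd ^ (k + 3)"
proof -
  define R where "R = 2 ^ k * r"
  have Rr: "r \<le> R" using r by (simp add: R_def)
  have R0: "0 < R" using r Rr by simp
  have bound: "real (card F) \<le> Cd ^ (k + 3)" if F: "F \<subseteq> {s\<in>S. dist s x < R}" "finite F" for F
  proof -
    have disj: "disjoint_family_on (\<lambda>s. ball s (r / 2)) F"
      unfolding disjoint_family_on_def
    proof (intro ballI impI)
      fix s t assume st: "s \<in> F" "t \<in> F" "s \<noteq> t"
      then have "r \<le> dist s t" using F S unfolding is_net_def by blast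
      show "ball s (r / 2) \<inter> ball t (r / 2) = {}"
      proof (rule ccontr)
        assume "\<not> ?thesis"
        then obtain z where "dist s z < r / 2" "dist t z < r / 2" by auto
        then show False using \<open>r \<le> dist s t\<close> dist_triangle2[of s t z] by linarith
      qed
    qed
    have "real (card F) * mu x (2 * R) = (\<Sum>s\<in>F. mu x (2 * R))" by simp
    also have "\<dots> \<le> (\<Sum>s\<in>F. Cd ^ (k + 3) * mu s (r / 2))"
    proof (rule sum_mono)
      fix s assume "s \<in> F"
      then have "dist s x < R" using F by auto
      have "ball x (2 * R) \<subseteq> ball s (4 * R)"
      proof
        fix y assume "y \<in> ball x (2 * R)"
        then show "y \<in> ball s (4 * R)" using \<open>dist s x < R\<close> R0 dist_triangle[of s y x] by simp
      qed
      then have "mu x (2 * R) \<le> mu s (4 * R)" by (rule mu_mono)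
      also have "4 * R = 2 ^ (k + 3) * (r / 2)" by (simp add: R_def power_add)
      also have "mu s \<dots> \<le> Cd ^ (k + 3) * mu s (r / 2)" using r by (intro mu_doubling_pow) auto
      finally show "mu x (2 * R) \<le> Cd ^ (k + 3) * mu s (r / 2)" .
    qed
    also have "\<dots> = Cd ^ (k + 3) * (\<Sum>s\<in>F. mu s (r / 2))" by (simp add: sum_distrib_left)
    also have "(\<Sum>s\<in>F. mu s (r / 2)) = measure M (\<Union>s\<in>F. ball s (r / 2))"
      using F disj by (intro measure_finite_Union[symmetric]) (auto simp: emeasure_ball_eq)
    also have "\<dots> \<le> mu x (2 * R)"
    proof (rule measure_mono_fmeasurable)
      show "(\<Union>s\<in>F. ball s (r / 2)) \<subseteq> ball x (2 * R)"
      proof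
        fix z assume "z \<in> (\<Union>s\<in>F. ball s (r / 2))"
        then obtain s where "s \<in> F" "dist s z < r / 2" by auto
        then have "dist s x < R" using F by auto
        with \<open>dist s z < r / 2\<close> show "z \<in> ball x (2 * R)"
          using dist_triangle[of x z s] Rr R0 by (simp add: dist_commute)
      qed
    qed (use F in \<open>auto simp: fmeasurable_def emeasure_ball_eq\<close>)
    finally have "real (card F) * mu x (2 * R) \<le> Cd ^ (k + 3) * mu x (2 * R)"
      using Cd_ge_1 by (simp add: mult_left_mono)
    then show ?thesis using mu_pos[of "2 * R" x] R0 by simp
  qed
  have "finite {s\<in>S. dist s x < R} \<and> card {s\<in>S. dist s x < R} \<le> nat \<lfloor>Cd ^ (k + 3)\<rfloor>"
    using bound by (intro finite_if_finite_subsets_card_bdd) (simp add: le_nat_floor)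
  then show ?thesis using bound[of "{s\<in>S. dist s x < R}"] by (simp add: R_def)
qed

lemma net_countable:
  fixes S :: "'a set"
  assumes S: "is_net r S" and r: "0 < r"
  shows "countable S"
proof -
  fix x0 :: 'a
  have "S \<subseteq> (\<Union>k. {s\<in>S. dist s x0 < 2 ^ k * r})"
  proof
    fix s assume "s \<in> S"
    obtain k where "dist s x0 / r < 2 ^ k" using real_arch_pow[of 2 "dist s x0 / r"] by auto
    then show "s \<in> (\<Union>k. {s\<in>S. dist s x0 < 2 ^ k * r})"
      using r \<open>s \<in> S\<close> by (auto simp: pos_divide_less_eq)
  qed
  moreover have "countable (\<Union>k. {s\<in>S. dist s x0 < 2 ^ k * r})"
    using net_card[OF S r] by (intro countable_UN) (auto intro: countable_finite)
  ultimately show ?thesis by (rule countable_subset)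
qed

text \<open>From local bounds to a global one: the enlarged balls overlap at most
  \<open>Cd ^ (k + 3)\<close> times, by \<open>net_card\<close>. Sums over the countable net are
  integrals over \<open>count_space S\<close>, so they can be exchanged with the integral over the
  space.\<close>

lemma net_integral:
  fixes F :: "'a \<Rightarrow> 'a \<Rightarrow> ennreal"
  assumes S: "is_net r S" and r: "0 < r"
    and F [measurable]: "\<And>s. F s \<in> borel_measurable (completion M)"
    and G [measurable]: "G \<in> borel_measurable (completion M)"
    and le: "\<And>s. s \<in> S \<Longrightarrow> (\<integral>\<^sup>+x\<in>ball s r. F s x \<partial>completion M) \<le> c * (\<integral>\<^sup>+x\<in>ball s (2 ^ k * r). G x \<partial>completion M)"
  shows "(\<integral>\<^sup>+x. (\<integral>\<^sup>+s. F s x * indicator (ball s r) x \<partial>count_space S) \<partial>completion M) \<le>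
    c * ennreal (Cd ^ (k + 3)) * (\<integral>\<^sup>+x. G x \<partial>completion M)"
proof -
  have cS: "countable S" by (rule net_countable[OF S r])
  have "(\<integral>\<^sup>+x. (\<integral>\<^sup>+s. F s x * indicator (ball s r) x \<partial>count_space S) \<partial>completion M) =
      (\<integral>\<^sup>+s. (\<integral>\<^sup>+x\<in>ball s r. F s x \<partial>completion M) \<partial>count_space S)"
    by (rule nn_integral_count_space_nn_integral[OF cS]) measurable
  also have "\<dots> \<le> (\<integral>\<^sup>+s. c * (\<integral>\<^sup>+x\<in>ball s (2 ^ k * r). G x \<partial>completion M) \<partial>count_space S)"
    by (intro nn_integral_mono le) simp
  also have "\<dots> = c * (\<integral>\<^sup>+s. (\<integral>\<^sup>+x\<in>ball s (2 ^ k * r). G x \<partial>completion M) \<partial>count_space S)"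
    by (rule nn_integral_cmult) simp
  also have "(\<integral>\<^sup>+s. (\<integral>\<^sup>+x\<in>ball s (2 ^ k * r). G x \<partial>completion M) \<partial>count_space S) =
      (\<integral>\<^sup>+x. (\<integral>\<^sup>+s. G x * indicator (ball s (2 ^ k * r)) x \<partial>count_space S) \<partial>completion M)"
    by (rule nn_integral_count_space_nn_integral[OF cS, symmetric]) measurable
  also have "\<dots> \<le> (\<integral>\<^sup>+x. ennreal (Cd ^ (k + 3)) * G x \<partial>completion M)"
  proof (rule nn_integral_mono)
    fix x
    let ?T = "{s\<in>S. dist s x < 2 ^ k * r}"
    have "(\<integral>\<^sup>+s. indicator (ball s (2 ^ k * r)) x \<partial>count_space S) = (\<integral>\<^sup>+s. indicator ?T s \<partial>count_space S)"
      by (intro nn_integral_cong) (auto simp: indicator_def)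
    also have "\<dots> = emeasure (count_space S) ?T" by (rule nn_integral_indicator) simp
    also have "\<dots> = of_nat (card ?T)" using net_card[OF S r, of x k] by (intro emeasure_count_space_finite) auto
    also have "\<dots> \<le> ennreal (Cd ^ (k + 3))"
      using net_card[OF S r, of x k] by (simp add: ennreal_of_nat_eq_real_of_nat ennreal_leI)
    finally have "G x * (\<integral>\<^sup>+s. indicator (ball s (2 ^ k * r)) x \<partial>count_space S) \<le> G x * ennreal (Cd ^ (k + 3))"
      by (rule mult_left_mono) simp
    moreover have "(\<integral>\<^sup>+s. G x * indicator (ball s (2 ^ k * r)) x \<partial>count_space S) =
        G x * (\<integral>\<^sup>+s. indicator (ball s (2 ^ k * r)) x \<partial>count_space S)"
      by (rule nn_integral_cmult) simp
    ultimately show "(\<integral>\<^sup>+s. G x * indicator (ball s (2 ^ k * r)) x \<partial>count_space S) \<le> ennreal (Cd ^ (k + 3)) * G x"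
      by (simp add: mult.commute)
  qed
  also have "\<dots> = ennreal (Cd ^ (k + 3)) * (\<integral>\<^sup>+x. G x \<partial>completion M)" by (rule nn_integral_cmult) measurable
  finally show ?thesis by (simp add: mult.assoc mult_left_mono)
qed

section \<open>Discrete gradients on a net and their energies\<close>

definition near :: "'a set \<Rightarrow> real \<Rightarrow> 'a \<Rightarrow> 'a set" where
  "near S r x = {s\<in>S. dist s x < 4 * r}"

text \<open>The \<open>p\<close>-th power of a discrete gradient at scale \<open>r\<close>: it
  collects the difference quotients of all pairs of net averages near \<open>x\<close>. The radius
  \<open>4 * r\<close> in \<open>near\<close> exceeds the \<open>3 * r\<close> that a curve piece of
  length \<open>2 * r\<close> demands in \<open>avg_curve_le\<close>, and it has the form
  \<open>2 ^ 2 * r\<close> counted by \<open>net_card\<close>.\<close>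

definition osc :: "'a set \<Rightarrow> real \<Rightarrow> ('a \<Rightarrow> real) \<Rightarrow> 'a \<Rightarrow> real" where
  "osc S r u x = (\<Sum>s\<in>near S r x. \<Sum>t\<in>near S r x. (\<bar>avg s r u - avg t r u\<bar> / r) powr p)"

definition energy :: "'a set \<Rightarrow> real \<Rightarrow> ('a \<Rightarrow> real) \<Rightarrow> ennreal" where
  "energy S r u = (\<integral>\<^sup>+x. ennreal (osc S r u x) \<partial>M)"

lemma near_card:
  assumes "is_net r S" "0 < r"
  shows "finite (near S r x)" "real (card (near S r x)) \<le> Cd ^ 5"
  using net_card[OF assms, of x 2] by (simp_all add: near_def)

lemma osc_nonneg: "0 \<le> osc S r u x"
  unfolding osc_def by (intro sum_nonneg) auto

lemma osc_measurable:
  assumes S: "is_net r S" "0 < r"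
  shows "osc S r u \<in> borel_measurable borel"
proof (rule borel_measurable_locally_ge)
  fix x
  have fin: "finite (near S r x)" by (rule near_card[OF S])
  \<comment> \<open>\<open>near\<close> is defined by finitely many strict inequalities, and
    \<open>e\<close> is the smallest slack among them.\<close>
  have "\<exists>e>0. \<forall>s\<in>near S r x. dist s x + e \<le> 4 * r"
  proof (cases "near S r x = {}")
    case False
    let ?e = "Min ((\<lambda>s. 4 * r - dist s x) ` near S r x)"
    have "0 < ?e" using fin False by (auto simp: near_def)
    moreover have "?e \<le> 4 * r - dist s x" if "s \<in> near S r x" for s
      using that fin by (intro Min_le) auto
    ultimately show ?thesis by (intro exI[of _ ?e]) force
  qed (use zero_less_one in blast)
  then obtain e where e: "0 < e" "\<And>s. s \<in> near S r x \<Longrightarrow> dist s x + e \<le> 4 * r" by blast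
  have "osc S r u x \<le> osc S r u y" if "dist x y < e" for y
  proof -
    have sub: "near S r x \<subseteq> near S r y"
    proof
      fix s assume s: "s \<in> near S r x"
      have "dist s y < 4 * r" using e(2)[OF s] that dist_triangle[of s y x] by linarith
      then show "s \<in> near S r y" using s by (simp add: near_def)
    qed
    have "osc S r u x \<le> (\<Sum>s\<in>near S r x. \<Sum>t\<in>near S r y. (\<bar>avg s r u - avg t r u\<bar> / r) powr p)"
      unfolding osc_def using sub near_card[OF S] by (intro sum_mono sum_mono2) auto
    also have "\<dots> \<le> osc S r u y"
      unfolding osc_def using sub near_card[OF S] by (intro sum_mono2 sum_nonneg) auto
    finally show ?thesis .
  qed
  then show "\<exists>e>0. \<forall>y. dist x y < e \<longrightarrow> osc S r u x \<le> osc S r u y" using e(1) by blast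
qed

lemma osc_ge:
  assumes S: "is_net r S" "0 < r" and st: "s \<in> near S r x" "t \<in> near S r x"
  shows "(\<bar>avg s r u - avg t r u\<bar> / r) powr p \<le> osc S r u x"
proof -
  have fin: "finite (near S r x)" by (rule near_card[OF S])
  have "(\<bar>avg s r u - avg t r u\<bar> / r) powr p \<le> (\<Sum>t\<in>near S r x. (\<bar>avg s r u - avg t r u\<bar> / r) powr p)"
    using fin st by (intro member_le_sum) auto
  also have "\<dots> \<le> osc S r u x"
    unfolding osc_def using fin st
    by (intro member_le_sum[of s _ "\<lambda>s. \<Sum>t\<in>near S r x. (\<bar>avg s r u - avg t r u\<bar> / r) powr p"]) (auto intro: sum_nonneg)
  finally show ?thesis .
qed

text \<open>\<open>ball s r\<close> lies in \<open>ball q (8 * r)\<close>, because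
  \<open>5 + 1 \<le> 8\<close>, so the Poincare inequality on the larger ball controls the
  difference of averages. Conversely \<open>ball q (8 * r)\<close> lies in
  \<open>ball s (16 * r)\<close>, and four doublings compare the measures, whence
  \<open>Cd ^ 4\<close>.\<close>

lemma avg_dist_le:
  assumes u: "u \<in> D_fun M p" and g: "upper_gradient g (\<lambda>x. ereal (u x))" "Lp_norm M p g < top"
    and r: "0 < r" and sq: "dist s q < 5 * r"
  shows "ennreal \<bar>avg s r u - avg q (8 * r) u\<bar> \<le> ennreal (8 * C * Cd ^ 4 * r) *
    ennreal_powr ((\<integral>\<^sup>+y\<in>ball q (l * (8 * r)). ennreal_powr (g y) p \<partial>M) / ennreal (mu q (l * (8 * r)))) (1 / p)"
    (is "_ \<le> _ * ?P")
proof -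
  let ?k = "avg q (8 * r) u"
  have pos: "0 < mu s r" using r by (rule mu_pos)
  have "ennreal (mu s r) * ennreal \<bar>avg s r u - ?k\<bar> = ennreal (mu s r * \<bar>avg s r u - ?k\<bar>)"
    by (simp add: ennreal_mult)
  also have "\<dots> \<le> (\<integral>\<^sup>+y\<in>ball s r. ennreal \<bar>u y - ?k\<bar> \<partial>completion M)"
    by (rule avg_diff_le[OF u r])
  also have "\<dots> \<le> (\<integral>\<^sup>+y\<in>ball q (8 * r). ennreal \<bar>u y - ?k\<bar> \<partial>completion M)"
  proof -
    have "y \<in> ball q (8 * r)" if "y \<in> ball s r" for y
      using that sq r dist_triangle[of q y s] by (simp add: dist_commute)
    then show ?thesis by (intro nn_integral_mono) (auto simp: indicator_def)
  qed
  also have "\<dots> \<le> ennreal (C * (8 * r) * mu q (8 * r)) * ?P"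
    using r by (intro poincare_real(2)[OF u g]) simp
  also have "\<dots> \<le> ennreal (mu s r * (8 * C * Cd ^ 4 * r)) * ?P"
  proof (intro mult_right_mono ennreal_leI)
    have "ball q (8 * r) \<subseteq> ball s (16 * r)"
    proof
      fix y assume "y \<in> ball q (8 * r)"
      then show "y \<in> ball s (16 * r)" using sq r dist_triangle[of s y q] by simp
    qed
    then have "mu q (8 * r) \<le> mu s (2 ^ 4 * r)" by (simp add: mu_mono)
    also have "\<dots> \<le> Cd ^ 4 * mu s r" using r by (rule mu_doubling_pow)
    finally have "(C * 8 * r) * mu q (8 * r) \<le> (C * 8 * r) * (Cd ^ 4 * mu s r)"
      using C_pos r by (intro mult_left_mono) auto
    then show "C * (8 * r) * mu q (8 * r) \<le> mu s r * (8 * C * Cd ^ 4 * r)" by (simp add: ac_simps)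
  qed simp
  also have "\<dots> = ennreal (mu s r) * (ennreal (8 * C * Cd ^ 4 * r) * ?P)"
    using pos C_pos Cd_ge_1 r by (simp add: ennreal_mult mult.assoc)
  finally show ?thesis using pos by (simp add: ennreal_mult_le_mult_iff)
qed

text \<open>Points of \<open>near S r x\<close> are within \<open>5 * r\<close> of \<open>q\<close>,
  so both averages of a pair are compared with the one over \<open>ball q (8 * r)\<close>; two
  comparisons turn the factor 8 into 16. The two factors \<open>Cd ^ 5\<close> count the pairs. The
  bound is the same for all \<open>x\<close> in \<open>ball q r\<close> and can be integrated
  there.\<close>

lemma osc_le_average:
  assumes S: "is_net r S" "0 < r"
    and u: "u \<in> D_fun M p" and g: "upper_gradient g (\<lambda>x. ereal (u x))" "Lp_norm M p g < top"
    and qx: "dist q x < r"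
  shows "ennreal (osc S r u x) \<le> ennreal (Cd ^ 5 * (Cd ^ 5 * (16 * C * Cd ^ 4) powr p)) *
    ((\<integral>\<^sup>+y\<in>ball q (l * (8 * r)). ennreal_powr (g y) p \<partial>M) / ennreal (mu q (l * (8 * r))))"
    (is "_ \<le> _ * ?A")
proof -
  define K where "K = 16 * C * Cd ^ 4"
  define Q where "Q = Cd ^ 5"
  have K0: "0 \<le> K" and Q0: "0 \<le> Q" using C_pos Cd_ge_1 by (simp_all add: K_def Q_def)
  have pair: "ennreal ((\<bar>avg s r u - avg t r u\<bar> / r) powr p) \<le> ennreal (K powr p) * ?A"
    if st: "s \<in> near S r x" "t \<in> near S r x" for s t
  proof -
    have d: "dist s q < 5 * r" "dist t q < 5 * r"
      using st qx dist_triangle[of s q x] dist_triangle[of t q x] by (auto simp: near_def dist_commute)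
    have "ennreal \<bar>avg s r u - avg t r u\<bar> \<le>
        ennreal \<bar>avg s r u - avg q (8 * r) u\<bar> + ennreal \<bar>avg t r u - avg q (8 * r) u\<bar>"
      by (simp flip: ennreal_plus)
    also have "\<dots> \<le> ennreal (8 * C * Cd ^ 4 * r) * ennreal_powr ?A (1 / p) +
        ennreal (8 * C * Cd ^ 4 * r) * ennreal_powr ?A (1 / p)"
      by (intro add_mono avg_dist_le u g S d)
    also have "\<dots> = ennreal (8 * C * Cd ^ 4 * r + 8 * C * Cd ^ 4 * r) * ennreal_powr ?A (1 / p)"
      using C_pos Cd_ge_1 S(2) by (subst ennreal_plus) (auto simp: distrib_right)
    also have "8 * C * Cd ^ 4 * r + 8 * C * Cd ^ 4 * r = r * K" by (simp add: K_def)
    finally have "ennreal (1 / r) * ennreal \<bar>avg s r u - avg t r u\<bar> \<le>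
        ennreal (1 / r) * (ennreal (r * K) * ennreal_powr ?A (1 / p))"
      by (rule mult_left_mono) simp
    also have "\<dots> = ennreal (1 / r * (r * K)) * ennreal_powr ?A (1 / p)"
      using S(2) K0 by (subst ennreal_mult[of "1 / r"]) (auto simp: mult.assoc)
    also have "1 / r * (r * K) = K" using S(2) by simp
    also have "ennreal (1 / r) * ennreal \<bar>avg s r u - avg t r u\<bar> = ennreal (\<bar>avg s r u - avg t r u\<bar> / r)"
      using S(2) by (simp flip: ennreal_mult)
    finally have "ennreal_powr (ennreal (\<bar>avg s r u - avg t r u\<bar> / r)) p \<le>
        ennreal_powr (ennreal K * ennreal_powr ?A (1 / p)) p"
      using p0 by (intro ennreal_powr_mono) auto
    then show ?thesis using S(2) K0 p0 by (simp add: ennreal_powr_mult ennreal_powr_inverse)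
  qed
  let ?N = "near S r x"
  have fin: "finite ?N" and card: "real (card ?N) \<le> Q" using near_card[OF S] unfolding Q_def by blast+
  have cardle: "of_nat (card ?N) * a \<le> ennreal (Q) * a" for a
    using card by (intro mult_right_mono) (auto simp: ennreal_of_nat_eq_real_of_nat intro: ennreal_leI)
  have "ennreal (osc S r u x) = (\<Sum>s\<in>?N. \<Sum>t\<in>?N. ennreal ((\<bar>avg s r u - avg t r u\<bar> / r) powr p))"
    unfolding osc_def by (subst sum_ennreal[symmetric], simp add: sum_nonneg, subst sum_ennreal) auto
  also have "\<dots> \<le> (\<Sum>s\<in>?N. \<Sum>t\<in>?N. ennreal (K powr p) * ?A)"
    by (intro sum_mono pair)
  also have "\<dots> = of_nat (card ?N) * (of_nat (card ?N) * (ennreal (K powr p) * ?A))" by simp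
  also have "\<dots> \<le> ennreal (Q) * (ennreal (Q) * (ennreal (K powr p) * ?A))"
    by (intro order.trans[OF cardle] mult_left_mono cardle) auto
  also have "\<dots> = ennreal (Q * (Q * K powr p)) * ?A"
    using Q0 by (simp add: ennreal_mult mult.assoc)
  finally show ?thesis unfolding K_def Q_def .
qed

lemma two_powr_ge: "\<exists>K. a \<le> (2 :: real) ^ K"
  using real_arch_pow[of 2 a] by (auto intro: less_imp_le)

text \<open>Integrating \<open>osc_le_average\<close> over \<open>ball q r\<close> cancels the mean
  on its right side, since that ball has no more measure than the ball of the mean;
  \<open>net_integral\<close> then sums over the net. The constant is independent of the net and of
  its mesh.\<close>

lemma energy_le:
  obtains B where "0 \<le> B" "\<And>S r u g. is_net r S \<Longrightarrow> 0 < r \<Longrightarrow> u \<in> D_fun M p \<Longrightarrow>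
    upper_gradient g (\<lambda>x. ereal (u x)) \<Longrightarrow> Lp_norm M p g < top \<Longrightarrow>
    energy S r u \<le> ennreal B * (\<integral>\<^sup>+x. ennreal_powr (g x) p \<partial>M)"
proof -
  define B1 where "B1 = Cd ^ 5 * (Cd ^ 5 * (16 * C * Cd ^ 4) powr p)"
  \<comment> \<open>The Poincare ball of radius \<open>l * (8 * r)\<close> must fit into a ball of
    radius \<open>2 ^ K * r\<close>, the form that \<open>net_integral\<close> accepts.\<close>
  obtain K where K: "8 * l \<le> 2 ^ K" using two_powr_ge by blast
  have B1: "0 \<le> B1" using Cd_ge_1 by (simp add: B1_def)
  show thesis
  proof (rule that[of "B1 * Cd ^ (K + 3)"])
    show "0 \<le> B1 * Cd ^ (K + 3)" using B1 Cd_ge_1 by simp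
    fix S :: "'a set" and r u g
    assume S: "is_net r S" "0 < r"
      and u: "u \<in> D_fun M p" and g: "upper_gradient g (\<lambda>x. ereal (u x))" "Lp_norm M p g < top"
    have [measurable]: "osc S r u \<in> borel_measurable (completion M)"
      using osc_measurable[OF S] measurable_cong_sets[OF sets_M refl] by (intro measurable_completion) blast
    have [measurable]: "g \<in> borel_measurable M" using upper_gradient_measurable[OF g(1)] .
    have [measurable]: "(\<lambda>x. ennreal_powr (g x) p) \<in> borel_measurable (completion M)"
      by (intro measurable_completion) measurable
    let ?I = "\<lambda>q R. \<integral>\<^sup>+y\<in>ball q R. ennreal_powr (g y) p \<partial>completion M"
    have le: "(\<integral>\<^sup>+x\<in>ball q r. ennreal (osc S r u x) \<partial>completion M) \<le> ennreal B1 * ?I q (2 ^ K * r)" for q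
    proof -
      let ?m = "mu q (l * (8 * r))"
      have R: "r \<le> l * (8 * r)" "l * (8 * r) \<le> 2 ^ K * r"
        using mult_right_mono[OF K, of r] mult_right_mono[OF l_ge_1, of r] S(2) by linarith+
      have m: "mu q r \<le> ?m" "0 < ?m"
        using mu_mono[OF subset_ball[OF R(1)]] mu_pos[OF less_le_trans[OF S(2) R(1)]] by blast+
      have "(\<integral>\<^sup>+x\<in>ball q r. ennreal (osc S r u x) \<partial>completion M) \<le>
          (\<integral>\<^sup>+x\<in>ball q r. ennreal B1 * (?I q (l * (8 * r)) / ennreal ?m) \<partial>completion M)"
        using osc_le_average[OF S u g, of q]
        by (intro nn_integral_mono) (auto simp: indicator_def B1_def nn_integral_completion)
      also have "\<dots> = ennreal B1 * (?I q (l * (8 * r)) / ennreal ?m) * ennreal (mu q r)"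
        by (simp add: nn_integral_cmult_indicator emeasure_ball_eq)
      also have "\<dots> \<le> ennreal B1 * (?I q (l * (8 * r)) / ennreal ?m) * ennreal ?m"
        using m by (intro mult_left_mono ennreal_leI) auto
      also have "\<dots> = ennreal B1 * (ennreal ?m * (?I q (l * (8 * r)) / ennreal ?m))"
        by (simp only: ac_simps)
      also have "ennreal ?m * (?I q (l * (8 * r)) / ennreal ?m) = ?I q (l * (8 * r))"
        using m(2) by (subst ennreal_times_divide, subst mult.commute) (simp add: ennreal_mult_divide_eq)
      also have "ennreal B1 * ?I q (l * (8 * r)) \<le> ennreal B1 * ?I q (2 ^ K * r)"
        by (intro mult_left_mono nn_integral_set_mono subset_ball[OF R(2)]) simp
      finally show ?thesis .
    qed
    have "energy S r u = (\<integral>\<^sup>+x. ennreal (osc S r u x) \<partial>completion M)"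
      by (simp add: energy_def nn_integral_completion)
    also have "\<dots> \<le> (\<integral>\<^sup>+x. (\<integral>\<^sup>+s. ennreal (osc S r u x) * indicator (ball s r) x \<partial>count_space S) \<partial>completion M)"
    proof (rule nn_integral_mono)
      fix x
      obtain q where q: "q \<in> S" "dist q x < r" using S(1) unfolding is_net_def by blast
      then have "ennreal (osc S r u x) = ennreal (osc S r u x) * indicator (ball q r) x" by simp
      also have "\<dots> \<le> (\<integral>\<^sup>+s. ennreal (osc S r u x) * indicator (ball s r) x \<partial>count_space S)"
        by (rule nn_integral_ge_point[OF q(1)])
      finally show "ennreal (osc S r u x) \<le> (\<integral>\<^sup>+s. ennreal (osc S r u x) * indicator (ball s r) x \<partial>count_space S)" .
    qed
    also have "\<dots> \<le> ennreal B1 * ennreal (Cd ^ (K + 3)) * (\<integral>\<^sup>+x. ennreal_powr (g x) p \<partial>completion M)"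
      by (rule net_integral[OF S]) (measurable, rule le)
    also have "\<dots> = ennreal (B1 * Cd ^ (K + 3)) * (\<integral>\<^sup>+x. ennreal_powr (g x) p \<partial>M)"
      using B1 Cd_ge_1 by (simp add: ennreal_mult nn_integral_completion)
    finally show "energy S r u \<le> ennreal (B1 * Cd ^ (K + 3)) * (\<integral>\<^sup>+x. ennreal_powr (g x) p \<partial>M)" .
  qed
qed

section \<open>Almost everywhere convergence of the net averages\<close>

definition net_err :: "'a set \<Rightarrow> real \<Rightarrow> ('a \<Rightarrow> real) \<Rightarrow> 'a \<Rightarrow> ennreal" where
  "net_err S r u x = (\<integral>\<^sup>+s. ennreal \<bar>u x - avg s r u\<bar> * indicator (ball s r) x \<partial>count_space S)"

text \<open>Because \<open>net_err\<close> sums over all net balls containing \<open>x\<close>, it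
  bounds the error for every nearby net point, and no net point has to be selected
  measurably.\<close>

lemma net_err_ge:
  assumes "s \<in> S" "dist s x < r"
  shows "ennreal \<bar>u x - avg s r u\<bar> \<le> net_err S r u x"
proof -
  have "ennreal \<bar>u x - avg s r u\<bar> = ennreal \<bar>u x - avg s r u\<bar> * indicator (ball s r) x"
    using assms by simp
  also have "\<dots> \<le> net_err S r u x" unfolding net_err_def by (rule nn_integral_ge_point[OF assms(1)])
  finally show ?thesis .
qed

lemma net_err_measurable:
  assumes S: "is_net r S" "0 < r" and u: "u \<in> D_fun M p"
  shows "net_err S r u \<in> borel_measurable (completion M)"
proof -
  have [measurable]: "u \<in> borel_measurable (completion M)" using u by (simp add: D_fun_iff)
  have cS: "countable S" by (rule net_countable[OF S])
  interpret sigma_finite_measure "count_space S" by (rule sigma_finite_measure_count_space_countable[OF cS])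
  show ?thesis unfolding net_err_def
  proof (rule borel_measurable_nn_integral)
    have "(\<lambda>(s, x). ennreal \<bar>u x - avg s r u\<bar> * indicator (ball s r) x) \<in>
        borel_measurable (count_space S \<Otimes>\<^sub>M completion M)"
      by (rule measurable_pair_measure_countable1[OF cS]) simp
    from measurable_pair_swap[OF this]
    show "(\<lambda>(x, s). ennreal \<bar>u x - avg s r u\<bar> * indicator (ball s r) x) \<in>
        borel_measurable (completion M \<Otimes>\<^sub>M count_space S)"
      by simp
  qed
qed

text \<open>The Poincare inequality on balls of radius \<open>r\<close> gains the factor
  \<open>r\<close>, and \<open>net_integral\<close> preserves it. Along the meshes
  \<open>(1 / 2) ^ n\<close> the errors on a fixed ball therefore have a convergent sum.\<close>

lemma net_err_integral:
  assumes u: "u \<in> D_fun M p"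
  obtains K where "0 \<le> K" "\<And>S r. is_net r S \<Longrightarrow> 0 < r \<Longrightarrow> r \<le> 1 \<Longrightarrow>
    (\<integral>\<^sup>+x\<in>ball x0 R. net_err S r u x \<partial>completion M) \<le> ennreal (K * r)"
proof -
  obtain g where g: "upper_gradient g (\<lambda>x. ereal (u x))" "Lp_norm M p g < top"
    using u by (auto simp: D_fun_iff elim: D_seminorm_lessE)
  obtain k where k: "l \<le> 2 ^ k" using two_powr_ge by blast
  have um [measurable]: "u \<in> borel_measurable (completion M)" using u by (simp add: D_fun_iff)
  have [measurable]: "g \<in> borel_measurable M" using upper_gradient_measurable[OF g(1)] .
  have [measurable]: "(\<lambda>x. ennreal_powr (g x) p) \<in> borel_measurable (completion M)"
    by (intro measurable_completion) measurable
  \<comment> \<open>If \<open>ball s r\<close> meets \<open>ball x0 R\<close> and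
    \<open>r \<le> 1\<close>, then \<open>ball s (2 ^ k * r)\<close> lies within distance
    \<open>R + 1 + 2 ^ k\<close> of \<open>x0\<close>. The cutoff keeps the constant 1 in
    \<open>G\<close> integrable.\<close>
  define R' where "R' = R + 2 ^ k + 1"
  define G where "G x = (1 + ennreal_powr (g x) p) * indicator (ball x0 R') x" for x
  have [measurable]: "G \<in> borel_measurable (completion M)" unfolding G_def by measurable
  have "(\<integral>\<^sup>+x. G x \<partial>completion M) \<le>
      (\<integral>\<^sup>+x. indicator (ball x0 R') x + ennreal_powr (g x) p \<partial>completion M)"
    by (intro nn_integral_mono) (auto simp: G_def indicator_def)
  also have "\<dots> = ennreal (mu x0 R') + (\<integral>\<^sup>+x. ennreal_powr (g x) p \<partial>M)"
    by (subst nn_integral_add) (auto simp: emeasure_ball_eq nn_integral_completion)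
  also have "\<dots> < top" using g(2) by (simp add: Lp_norm_less_top_iff)
  finally obtain J where J: "(\<integral>\<^sup>+x. G x \<partial>completion M) = ennreal J" "0 \<le> J"
    by (cases "\<integral>\<^sup>+x. G x \<partial>completion M") auto
  show thesis
  proof (rule that[of "C * Cd ^ (k + 3) * J"])
    show "0 \<le> C * Cd ^ (k + 3) * J" using C_pos Cd_ge_1 J by simp
    fix S :: "'a set" and r assume S: "is_net r S" "0 < r" and r1: "r \<le> 1"
    let ?F = "\<lambda>s x. ennreal \<bar>u x - avg s r u\<bar> * indicator (ball x0 R) x"
    have le: "(\<integral>\<^sup>+x\<in>ball s r. ?F s x \<partial>completion M) \<le> ennreal (C * r) * (\<integral>\<^sup>+x\<in>ball s (2 ^ k * r). G x \<partial>completion M)" for s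
    proof (cases "ball s r \<inter> ball x0 R = {}")
      case True
      then have "(\<integral>\<^sup>+x\<in>ball s r. ?F s x \<partial>completion M) = (\<integral>\<^sup>+x. 0 \<partial>completion M)"
        by (intro nn_integral_cong) (auto simp: indicator_def)
      then show ?thesis by simp
    next
      case False
      then obtain z where z: "dist s z < r" "dist x0 z < R" by auto
      have lr: "r \<le> l * r" "l * r \<le> 2 ^ k * r"
        using mult_right_mono[OF l_ge_1, of r] mult_right_mono[OF k, of r] S(2) by linarith+
      have sub: "y \<in> ball x0 R'" if "dist s y < 2 ^ k * r" for y
      proof -
        have "dist x0 y \<le> dist x0 z + dist s z + dist s y"
          using dist_triangle[of x0 y s] dist_triangle[of x0 s z] by (simp add: dist_commute)
        moreover have "2 ^ k * r \<le> (2 :: real) ^ k" using r1 by simp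
        ultimately show ?thesis using z that r1 unfolding R'_def mem_ball by linarith
      qed
      let ?I = "\<integral>\<^sup>+y\<in>ball s (l * r). ennreal_powr (g y) p \<partial>M"
      let ?m = "mu s (l * r)"
      have m: "mu s r \<le> ?m" "0 < ?m"
        using mu_mono[OF subset_ball[OF lr(1)]] mu_pos[OF less_le_trans[OF S(2) lr(1)]] by blast+
      have "(\<integral>\<^sup>+x\<in>ball s r. ?F s x \<partial>completion M) \<le> (\<integral>\<^sup>+x\<in>ball s r. ennreal \<bar>u x - avg s r u\<bar> \<partial>completion M)"
        by (intro nn_integral_mono) (auto simp: indicator_def)
      also have "\<dots> \<le> ennreal (C * r * mu s r) * ennreal_powr (?I / ennreal ?m) (1 / p)"
        by (rule poincare_real(2)[OF u g S(2)])
      also have "\<dots> \<le> ennreal (C * r * ?m) * (1 + ?I / ennreal ?m)"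
        using m C_pos S(2) p1 by (intro mult_mono ennreal_leI ennreal_powr_le_one_plus mult_left_mono) auto
      also have "\<dots> = ennreal (C * r) * (ennreal ?m + ennreal ?m * (?I / ennreal ?m))"
        using C_pos S(2) by (simp add: ennreal_mult distrib_left mult.assoc)
      also have "ennreal ?m * (?I / ennreal ?m) = ?I"
        using m(2) by (subst ennreal_times_divide, subst mult.commute) (simp add: ennreal_mult_divide_eq)
      also have "ennreal ?m + ?I = (\<integral>\<^sup>+y. indicator (ball s (l * r)) y + ennreal_powr (g y) p * indicator (ball s (l * r)) y \<partial>completion M)"
        by (subst nn_integral_add) (auto simp: emeasure_ball_eq nn_integral_completion)
      also have "\<dots> \<le> (\<integral>\<^sup>+x\<in>ball s (2 ^ k * r). G x \<partial>completion M)"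
      proof (rule nn_integral_mono)
        fix y
        show "indicator (ball s (l * r)) y + ennreal_powr (g y) p * indicator (ball s (l * r)) y
          \<le> G y * indicator (ball s (2 ^ k * r)) y"
        proof (cases "y \<in> ball s (l * r)")
          case True
          then have "y \<in> ball s (2 ^ k * r)" using subset_ball[OF lr(2)] by blast
          then have "y \<in> ball x0 R'" "y \<in> ball s (2 ^ k * r)" using sub unfolding mem_ball by blast+
          then show ?thesis using True by (simp add: G_def)
        qed simp
      qed
      finally show ?thesis by (simp add: mult_left_mono)
    qed
    have "(\<integral>\<^sup>+x\<in>ball x0 R. net_err S r u x \<partial>completion M) =
        (\<integral>\<^sup>+x. (\<integral>\<^sup>+s. ?F s x * indicator (ball s r) x \<partial>count_space S) \<partial>completion M)"
    proof (rule nn_integral_cong)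
      fix x
      show "net_err S r u x * indicator (ball x0 R) x = (\<integral>\<^sup>+s. ?F s x * indicator (ball s r) x \<partial>count_space S)"
        unfolding net_err_def by (subst nn_integral_multc[symmetric]) (auto intro!: nn_integral_cong simp: ac_simps)
    qed
    also have "\<dots> \<le> ennreal (C * r) * ennreal (Cd ^ (k + 3)) * (\<integral>\<^sup>+x. G x \<partial>completion M)"
      by (rule net_integral[OF S]) (measurable, rule le)
    also have "\<dots> = ennreal (C * Cd ^ (k + 3) * J * r)"
      unfolding J(1) using C_pos Cd_ge_1 J(2) S(2) by (simp add: ac_simps flip: ennreal_mult)
    finally show "(\<integral>\<^sup>+x\<in>ball x0 R. net_err S r u x \<partial>completion M) \<le> ennreal (C * Cd ^ (k + 3) * J * r)" .
  qed
qed

text \<open>On a piece of parameter length between \<open>r\<close> and \<open>2 * r\<close> the net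
  points at both ends are near every point of the piece. Their difference quotient is thus bounded
  by \<open>osc powr (1 / p)\<close> all along it, and a length of at least \<open>r\<close> turns
  the integrated quotient into the full difference. Longer curves are cut into such pieces.\<close>

lemma avg_curve_le:
  assumes S: "is_net r S" "0 < r" and c: "1-lipschitz_on UNIV c"
    and "s \<in> S" "t \<in> S" "dist s (c a) < r" "dist t (c b) < r" "r \<le> b - a"
  shows "ennreal \<bar>avg s r u - avg t r u\<bar> \<le> (\<integral>\<^sup>+x\<in>{a..b}. ennreal (osc S r u (c x) powr (1 / p)) \<partial>lborel)"
proof -
  have lip: "dist (c x) (c y) \<le> \<bar>x - y\<bar>" for x y
    using lipschitz_onD[OF c, of x y] by (simp add: dist_real_def)
  have cm [measurable]: "c \<in> borel_measurable borel"
    using c by (intro borel_measurable_continuous_onI lipschitz_on_continuous_on)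
  have [measurable]: "osc S r u \<in> borel_measurable borel" by (rule osc_measurable[OF S])
  have short: "ennreal \<bar>avg s r u - avg t r u\<bar> \<le> (\<integral>\<^sup>+x\<in>{a..b}. ennreal (osc S r u (c x) powr (1 / p)) \<partial>lborel)"
    if st: "s \<in> S" "t \<in> S" "dist s (c a) < r" "dist t (c b) < r" and ab: "r \<le> b - a" "b - a \<le> 2 * r" for s t a b
  proof -
    let ?d = "\<bar>avg s r u - avg t r u\<bar> / r"
    have "?d \<le> osc S r u (c x) powr (1 / p)" if x: "x \<in> {a..b}" for x
    proof -
      have "dist s (c x) < 4 * r" "dist t (c x) < 4 * r"
        using st ab x lip[of a x] lip[of b x] dist_triangle[of s "c x" "c a"] dist_triangle[of t "c x" "c b"] by auto
      then have "?d powr p \<le> osc S r u (c x)" using st by (intro osc_ge[OF S]) (auto simp: near_def)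
      then have "(?d powr p) powr (1 / p) \<le> osc S r u (c x) powr (1 / p)"
        using p0 by (intro powr_mono2) auto
      then show ?thesis using p0 S(2) by (simp add: powr_powr)
    qed
    note ptw = this
    have "\<bar>avg s r u - avg t r u\<bar> \<le> ?d * (b - a)"
      using mult_left_mono[OF ab(1), of ?d] S(2) by simp
    then have "ennreal \<bar>avg s r u - avg t r u\<bar> \<le> ennreal (?d * (b - a))" by (rule ennreal_leI)
    also have "\<dots> = (\<integral>\<^sup>+x\<in>{a..b}. ennreal ?d \<partial>lborel)"
      using ab S(2) by (subst ennreal_mult) (auto simp: nn_integral_cmult_indicator)
    also have "\<dots> \<le> (\<integral>\<^sup>+x\<in>{a..b}. ennreal (osc S r u (c x) powr (1 / p)) \<partial>lborel)"
      using ptw by (intro nn_integral_mono) (auto simp: indicator_def intro: ennreal_leI)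
    finally show ?thesis .
  qed
  \<comment> \<open>Each step splits off an initial piece of length \<open>r\<close>, and only while
    \<open>b - a > 2 * r\<close>, so the rest still has length at least \<open>r\<close>.\<close>
  have "b - a \<le> real n * r \<Longrightarrow> ?thesis" for n
    using assms(4-)
  proof (induction n arbitrary: a s)
    case (Suc n)
    show ?case
    proof (cases "b - a \<le> 2 * r")
      case True
      then show ?thesis using Suc.prems by (intro short) auto
    next
      case False
      obtain q where q: "q \<in> S" "dist q (c (a + r)) < r" using S(1) unfolding is_net_def by blast
      have "ennreal \<bar>avg s r u - avg t r u\<bar> \<le> ennreal \<bar>avg s r u - avg q r u\<bar> + ennreal \<bar>avg q r u - avg t r u\<bar>"
        by (simp flip: ennreal_plus)
      also have "\<dots> \<le> (\<integral>\<^sup>+x\<in>{a..a + r}. ennreal (osc S r u (c x) powr (1 / p)) \<partial>lborel) +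
          (\<integral>\<^sup>+x\<in>{a + r..b}. ennreal (osc S r u (c x) powr (1 / p)) \<partial>lborel)"
      proof (rule add_mono)
        show "ennreal \<bar>avg s r u - avg q r u\<bar> \<le> (\<integral>\<^sup>+x\<in>{a..a + r}. ennreal (osc S r u (c x) powr (1 / p)) \<partial>lborel)"
          using Suc.prems q S(2) by (intro short) auto
        show "ennreal \<bar>avg q r u - avg t r u\<bar> \<le> (\<integral>\<^sup>+x\<in>{a + r..b}. ennreal (osc S r u (c x) powr (1 / p)) \<partial>lborel)"
          using Suc.prems q False by (intro Suc.IH) (auto simp: algebra_simps)
      qed
      also have "\<dots> = (\<integral>\<^sup>+x. ennreal (osc S r u (c x) powr (1 / p)) * indicator {a..a + r} x +
          ennreal (osc S r u (c x) powr (1 / p)) * indicator {a + r..b} x \<partial>lborel)"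
        by (rule nn_integral_add[symmetric]) measurable
      \<comment> \<open>The two intervals overlap only in the point \<open>a + r\<close>, which is a
        null set.\<close>
      also have "\<dots> \<le> (\<integral>\<^sup>+x\<in>{a..b}. ennreal (osc S r u (c x) powr (1 / p)) \<partial>lborel)"
        using AE_lborel_singleton[of "a + r"] False S(2)
        by (intro nn_integral_mono_AE) (auto elim!: eventually_mono simp: indicator_def)
      finally show ?thesis .
    qed
  qed (use S(2) in auto)
  moreover obtain n where "(b - a) / r < real n" using reals_Archimedean2 by blast
  then have "b - a \<le> real n * r" using S(2) by (simp add: pos_divide_less_eq)
  ultimately show ?thesis by blast
qed

end

section \<open>Small integrals near a point and strongly Cauchy convex combinations in Lp\<close>

lemma Lp_norm_sum:
  assumes p: "1 \<le> p" and f: "\<And>i. i \<in> I \<Longrightarrow> f i \<in> borel_measurable M"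
  shows "Lp_norm M p (\<lambda>x. \<Sum>i\<in>I. f i x) \<le> (\<Sum>i\<in>I. Lp_norm M p (f i))"
  using f
proof (induction I rule: infinite_finite_induct)
  case (insert i I)
  have "Lp_norm M p (\<lambda>x. f i x + (\<Sum>i\<in>I. f i x)) \<le> Lp_norm M p (f i) + Lp_norm M p (\<lambda>x. \<Sum>i\<in>I. f i x)"
    using insert.prems by (intro Lp_norm_triangle[OF p] borel_measurable_sum) auto
  also have "\<dots> \<le> Lp_norm M p (f i) + (\<Sum>i\<in>I. Lp_norm M p (f i))"
    using insert by (intro add_left_mono) auto
  finally show ?case using insert by simp
qed (simp_all add: Lp_norm_def)

text \<open>Continuity from above of the measure with density \<open>f\<close> along intervals that
  shrink to a point. It will allow the end points of a curve to be moved off an exceptional set at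
  small cost.\<close>

lemma nn_integral_small_near_point:
  fixes f :: "real \<Rightarrow> ennreal"
  assumes [measurable]: "f \<in> borel_measurable borel" and fin: "(\<integral>\<^sup>+x. f x \<partial>lborel) < \<infinity>" and "0 < \<delta>"
  shows "\<exists>\<eta>>0. (\<integral>\<^sup>+x\<in>{a - \<eta>..a + \<eta>}. f x \<partial>lborel) \<le> \<delta>"
proof -
  define A where "A n = {a - 1 / (real n + 1)..a + 1 / (real n + 1)}" for n
  let ?\<nu> = "density lborel f"
  have e: "emeasure ?\<nu> B = (\<integral>\<^sup>+x\<in>B. f x \<partial>lborel)" if "B \<in> sets borel" for B
    using that by (simp add: emeasure_density)
  have "(\<lambda>n. emeasure ?\<nu> (A n)) \<longlonglongrightarrow> emeasure ?\<nu> (\<Inter>n. A n)"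
  proof (rule Lim_emeasure_decseq)
    show "decseq A"
    proof (rule decseq_SucI)
      fix n
      have "1 / (real (Suc n) + 1) \<le> 1 / (real n + 1)" by (intro divide_left_mono) auto
      then show "A (Suc n) \<subseteq> A n" unfolding A_def by (intro atLeastatMost_subset_iff[THEN iffD2] disjI2) linarith
    qed
    fix n
    have "emeasure ?\<nu> (A n) \<le> emeasure ?\<nu> UNIV" by (rule emeasure_mono) auto
    also have "\<dots> < \<infinity>" using fin by (simp add: e)
    finally show "emeasure ?\<nu> (A n) \<noteq> \<infinity>" by simp
  qed (auto simp: A_def)
  also have "(\<Inter>n. A n) = {a}"
  proof (intro equalityI subsetI)
    fix x assume x: "x \<in> (\<Inter>n. A n)"
    show "x \<in> {a}"
    proof (rule ccontr)
      assume "x \<notin> {a}"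
      then have "0 < \<bar>x - a\<bar>" by simp
      then obtain n where "1 / (real n + 1) < \<bar>x - a\<bar>"
        using nat_approx_posE[of "\<bar>x - a\<bar>"] by (auto simp: add.commute)
      moreover have "x \<in> A n" using x by blast
      ultimately show False unfolding A_def by (auto simp: abs_if split: if_splits)
    qed
  qed (auto simp: A_def)
  also have "emeasure ?\<nu> {a} = 0"
  proof -
    have "AE x in lborel. f x * indicator {a} x = 0"
      using AE_lborel_singleton[of a] by (rule eventually_mono) simp
    then have "(\<integral>\<^sup>+x\<in>{a}. f x \<partial>lborel) = 0" by (subst nn_integral_0_iff_AE) simp_all
    then show ?thesis by (simp add: e)
  qed
  finally have "\<forall>\<^sub>F n in sequentially. emeasure ?\<nu> (A n) < \<delta>"
    using \<open>0 < \<delta>\<close> by (rule order_tendstoD)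
  then obtain n where "emeasure ?\<nu> (A n) < \<delta>" by (auto simp: eventually_sequentially)
  then show ?thesis by (intro exI[of _ "1 / (real n + 1)"]) (auto simp: e A_def)
qed

text \<open>Besides passing to the reals, the convexity inequality itself yields that the energy
  \<open>X\<close> of the difference is finite, so that \<open>enn2real\<close> does not collapse it
  to 0.\<close>

lemma enn2real_convexity:
  assumes "X + ennreal K * Y \<le> ennreal c * (Z + W)" "0 < K" "0 \<le> c" "Z < top" "W < top"
  shows "enn2real X + K * enn2real Y \<le> c * (enn2real Z + enn2real W)" "X < top"
proof -
  have "ennreal c * (Z + W) < top" using assms by (simp add: ennreal_mult_less_top)
  with assms(1) have fin: "X + ennreal K * Y < top" by (rule order.strict_trans1)
  then have X: "X < top" and Y: "Y < top"
    using assms(2) by (auto simp: ennreal_mult_less_top)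
  show "X < top" by (rule X)
  obtain x y z v where "X = ennreal x" "Y = ennreal y" "Z = ennreal z" "W = ennreal v"
    "0 \<le> x" "0 \<le> y" "0 \<le> z" "0 \<le> v"
    using X Y assms(4,5) by (cases X; cases Y; cases Z; cases W) auto
  then show "enn2real X + K * enn2real Y \<le> c * (enn2real Z + enn2real W)"
    using assms by (simp flip: ennreal_plus ennreal_mult)
qed

lemma conv_tail_measurable:
  assumes "w \<in> conv_tail G k" "\<And>j. G j \<in> borel_measurable M"
  shows "w \<in> borel_measurable M"
  using assms(1)
proof (rule conv_tailE)
  fix n l assume "w = (\<lambda>x. \<Sum>j\<le>n. l j * G (k + j) x)"
  then show ?thesis using assms(2) by simp
qed

lemma conv_tail_nonneg:
  assumes "w \<in> conv_tail G k" "\<And>j x. 0 \<le> G j x"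
  shows "0 \<le> w x"
  using assms(1)
proof (rule conv_tailE)
  fix n l assume "\<And>j. 0 \<le> l j" "w = (\<lambda>x. \<Sum>j\<le>n. l j * G (k + j) x)"
  then show ?thesis using assms(2) by (simp add: sum_nonneg)
qed

lemma conv_tail_Lp_norm_le:
  assumes p: "1 \<le> p" and G: "\<And>j. G j \<in> borel_measurable M" "\<And>j x. 0 \<le> G j x"
    and A: "\<And>j. Lp_norm M p (\<lambda>x. ennreal (G j x)) \<le> A" and w: "w \<in> conv_tail G k"
  shows "Lp_norm M p (\<lambda>x. ennreal (w x)) \<le> A"
  using w
proof (rule conv_tailE)
  fix n l assume l: "\<And>j. 0 \<le> l j" "(\<Sum>j\<le>n. l j) = 1" "w = (\<lambda>x. \<Sum>j\<le>n. l j * G (k + j) x)"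
  have "Lp_norm M p (\<lambda>x. ennreal (w x)) = Lp_norm M p (\<lambda>x. \<Sum>j\<le>n. ennreal (l j) * ennreal (G (k + j) x))"
    using l(1) G(2) by (simp add: l(3) ennreal_mult flip: sum_ennreal)
  also have "\<dots> \<le> (\<Sum>j\<le>n. Lp_norm M p (\<lambda>x. ennreal (l j) * ennreal (G (k + j) x)))"
    using G(1) by (intro Lp_norm_sum p) auto
  also have "\<dots> = (\<Sum>j\<le>n. ennreal (l j) * Lp_norm M p (\<lambda>x. ennreal (G (k + j) x)))"
    using p G(1) by (intro sum.cong Lp_norm_cmult) auto
  also have "\<dots> \<le> (\<Sum>j\<le>n. ennreal (l j) * A)"
    by (intro sum_mono mult_left_mono A) auto
  also have "\<dots> = ennreal (\<Sum>j\<le>n. l j) * A"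
    using l(1) by (simp flip: sum_distrib_right sum_ennreal)
  finally show ?thesis using l(2) by simp
qed

text \<open>The scalar inequality integrates to the \<open>p\<close>-th power of the Lp norm, so the
  minimizing argument applies with a functional that does not depend on \<open>n\<close>; "for
  infinitely many \<open>n\<close>" then simply means truth.\<close>

lemma Lp_mazur:
  fixes G :: "nat \<Rightarrow> 'a \<Rightarrow> real"
  assumes p: "1 < p" and G [measurable]: "\<And>j. G j \<in> borel_measurable M" and G0: "\<And>j x. 0 \<le> G j x"
    and A: "\<And>j. Lp_norm M p (\<lambda>x. ennreal (G j x)) \<le> ennreal A" "0 \<le> A"
  obtains w where "\<And>k. w k \<in> conv_tail G k"
    "\<And>e. 0 < e \<Longrightarrow> \<exists>m. \<forall>i\<ge>m. \<forall>j\<ge>m. Lp_norm M p (\<lambda>x. ennreal \<bar>w i x - w j x\<bar>) \<le> ennreal e"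
proof -
  define I where "I w = (\<integral>\<^sup>+x. ennreal (\<bar>w x\<bar> powr p) \<partial>M)" for w :: "'a \<Rightarrow> real"
  have Lp_I: "Lp_norm M p (\<lambda>x. ennreal \<bar>w x\<bar>) = ennreal_powr (I w) (1 / p)" for w
    by (simp add: Lp_norm_def I_def)
  let ?mid = "\<lambda>u v x. (u x + v x) / 2"
  let ?C = "conv_tail G"
  have m [measurable]: "w \<in> borel_measurable M" if "w \<in> ?C k" for w k
    using that G by (rule conv_tail_measurable)
  have IA: "I w \<le> ennreal (A powr p)" if "w \<in> ?C 0" for w
  proof -
    have "Lp_norm M p (\<lambda>x. ennreal (w x)) \<le> ennreal A"
      by (rule conv_tail_Lp_norm_le[OF _ G G0 A(1) that]) (use p in simp)
    moreover have "\<bar>w x\<bar> = w x" for x using conv_tail_nonneg[OF that G0] by simp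
    ultimately show ?thesis using p A(2) by (simp add: Lp_norm_le_iff I_def conv_tail_nonneg[OF that G0])
  qed
  have Ifin: "I w < top" if "w \<in> ?C 0" for w using IA[OF that] by (simp add: order_le_less_trans)
  have key: "\<exists>K>0. \<forall>x\<in>?C 0. \<forall>y\<in>?C 0. I (\<lambda>z. x z - y z) + ennreal K * I (?mid x y) \<le> ennreal (e + K / 2) * (I x + I y)"
    if e: "0 < e" for e
  proof -
    obtain K where K: "0 < K" "\<And>a b. \<bar>a - b\<bar> powr p + K * \<bar>(a + b) / 2\<bar> powr p \<le> (e + K / 2) * (\<bar>a\<bar> powr p + \<bar>b\<bar> powr p)"
      using powr_abs_uniformly_convex[OF p e] by blast
    have "I (\<lambda>z. x z - y z) + ennreal K * I (?mid x y) \<le> ennreal (e + K / 2) * (I x + I y)"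
      if xy: "x \<in> ?C 0" "y \<in> ?C 0" for x y
    proof -
      note [measurable] = m[OF xy(1)] m[OF xy(2)]
      have "I (\<lambda>z. x z - y z) + ennreal K * I (?mid x y) =
          (\<integral>\<^sup>+z. ennreal (\<bar>x z - y z\<bar> powr p) + ennreal K * ennreal (\<bar>(x z + y z) / 2\<bar> powr p) \<partial>M)"
        unfolding I_def by (subst nn_integral_add) (auto simp: nn_integral_cmult)
      also have "\<dots> \<le> (\<integral>\<^sup>+z. ennreal (e + K / 2) * (ennreal (\<bar>x z\<bar> powr p) + ennreal (\<bar>y z\<bar> powr p)) \<partial>M)"
      proof (rule nn_integral_mono)
        fix z
        have "ennreal (\<bar>x z - y z\<bar> powr p + K * \<bar>(x z + y z) / 2\<bar> powr p) \<le>
            ennreal ((e + K / 2) * (\<bar>x z\<bar> powr p + \<bar>y z\<bar> powr p))"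
          by (intro ennreal_leI K)
        then show "ennreal (\<bar>x z - y z\<bar> powr p) + ennreal K * ennreal (\<bar>(x z + y z) / 2\<bar> powr p) \<le>
            ennreal (e + K / 2) * (ennreal (\<bar>x z\<bar> powr p) + ennreal (\<bar>y z\<bar> powr p))"
          using K(1) e by (simp only: ennreal_plus ennreal_mult powr_ge_zero mult_nonneg_nonneg add_nonneg_nonneg
            less_imp_le half_gt_zero)
      qed
      also have "\<dots> = ennreal (e + K / 2) * (I x + I y)"
        unfolding I_def by (subst nn_integral_cmult) (auto simp: nn_integral_add)
      finally show ?thesis .
    qed
    then show ?thesis using K(1) by blast
  qed
  have sub: "?C k \<subseteq> ?C 0" for k
    using lift_Suc_antimono_le[of ?C 0 k] conv_tail_Suc by blast
  obtain w where w: "\<And>k. w k \<in> ?C k"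
    "\<And>e. 0 < e \<Longrightarrow> \<exists>m. \<forall>i\<ge>m. \<forall>j\<ge>m. \<exists>\<^sub>F n in sequentially. enn2real (I (\<lambda>z. w i z - w j z)) \<le> e"
  proof (rule uniformly_convex_minimizing_sequence[of ?C ?mid "\<lambda>_ w. enn2real (I w)" "A powr p"
        "\<lambda>_ x y. enn2real (I (\<lambda>z. x z - y z))"])
    show "?C k \<noteq> {}" for k using conv_tail_self by blast
    show "?C (Suc k) \<subseteq> ?C k" for k by (rule conv_tail_Suc)
    show "?mid x y \<in> ?C k" if "x \<in> ?C k" "y \<in> ?C k" for k x y using that by (rule conv_tail_mid)
    show "enn2real (I x) \<le> A powr p" if "x \<in> ?C 0" for x using IA[OF that] by (intro enn2real_leI) auto
    fix e :: real assume e: "0 < e"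
    then obtain K where K: "0 < K" "\<And>x y. x \<in> ?C 0 \<Longrightarrow> y \<in> ?C 0 \<Longrightarrow>
        I (\<lambda>z. x z - y z) + ennreal K * I (?mid x y) \<le> ennreal (e + K / 2) * (I x + I y)"
      using key by blast
    have "enn2real (I (\<lambda>z. x z - y z)) + K * enn2real (I (?mid x y)) \<le> (e + K / 2) * (enn2real (I x) + enn2real (I y))"
      if "x \<in> ?C 0" "y \<in> ?C 0" for x y
      using that K(1) e by (intro enn2real_convexity(1) K(2) Ifin) auto
    then show "\<exists>K>0. \<forall>n::nat. \<forall>x\<in>?C 0. \<forall>y\<in>?C 0. enn2real (I (\<lambda>z. x z - y z)) + K * enn2real (I (?mid x y)) \<le>
        (e + K / 2) * (enn2real (I x) + enn2real (I y))"
      using K(1) by blast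
  qed auto
  show thesis
  proof (rule that[OF w(1)])
    fix e :: real assume e: "0 < e"
    then obtain m where m: "\<And>i j. m \<le> i \<Longrightarrow> m \<le> j \<Longrightarrow> enn2real (I (\<lambda>z. w i z - w j z)) \<le> e powr p"
      using w(2)[of "e powr p"] by auto
    \<comment> \<open>The inequality for \<open>e = 1\<close> gives finiteness of the integral of
      the difference, which the bound on its \<open>enn2real\<close> does not.\<close>
    obtain K where K: "0 < K" "\<And>x y. x \<in> ?C 0 \<Longrightarrow> y \<in> ?C 0 \<Longrightarrow>
        I (\<lambda>z. x z - y z) + ennreal K * I (?mid x y) \<le> ennreal (1 + K / 2) * (I x + I y)"
      using key[of 1] by auto
    have "Lp_norm M p (\<lambda>x. ennreal \<bar>w i x - w j x\<bar>) \<le> ennreal e" if ij: "m \<le> i" "m \<le> j" for i j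
    proof -
      have "w i \<in> ?C 0" "w j \<in> ?C 0" using w(1) sub by blast+
      then have "I (\<lambda>z. w i z - w j z) < top"
        using K(1) by (intro enn2real_convexity(2)[OF K(2)] Ifin) auto
      then have "I (\<lambda>z. w i z - w j z) \<le> ennreal (e powr p)"
        using m[OF ij] by (cases "I (\<lambda>z. w i z - w j z)") auto
      then have "ennreal_powr (I (\<lambda>z. w i z - w j z)) (1 / p) \<le> ennreal_powr (ennreal (e powr p)) (1 / p)"
        using p by (intro ennreal_powr_mono) auto
      then show ?thesis using Lp_I[of "\<lambda>z. w i z - w j z"] p e by (simp add: powr_powr)
    qed
    then show "\<exists>m. \<forall>i\<ge>m. \<forall>j\<ge>m. Lp_norm M p (\<lambda>x. ennreal \<bar>w i x - w j x\<bar>) \<le> ennreal e" by blast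
  qed
qed

section \<open>Bounding the norm by the lower limit of the discrete energies\<close>

context doubling_poincare_space
begin

lemma net_err_tendsto_0:
  assumes S: "\<And>n. is_net ((1 / 2) ^ n) (S n)" and u: "u \<in> D_fun M p"
  shows "AE x in M. (\<lambda>n. net_err (S n) ((1 / 2) ^ n) u x) \<longlonglongrightarrow> 0"
proof -
  fix x0 :: 'a
  let ?D = "\<lambda>n. net_err (S n) ((1 / 2) ^ n) u"
  have [measurable]: "?D n \<in> borel_measurable (completion M)" for n
    by (rule net_err_measurable[OF S _ u]) simp
  have "AE x in M. (\<Sum>n. ?D n x) \<noteq> \<infinity>"
  proof (rule AE_suminf_not_top)
    fix R :: real
    obtain K where K: "0 \<le> K" "\<And>S r. is_net r S \<Longrightarrow> 0 < r \<Longrightarrow> r \<le> 1 \<Longrightarrow>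
        (\<integral>\<^sup>+x\<in>ball x0 R. net_err S r u x \<partial>completion M) \<le> ennreal (K * r)"
      by (rule net_err_integral[OF u]) (rule that)
    have "(\<integral>\<^sup>+x\<in>ball x0 R. ?D n x \<partial>completion M) \<le> ennreal (K * (1 / 2) ^ n)" for n
      by (intro K(2) S) (auto simp: power_le_one)
    with K(1) show "\<exists>K\<ge>0. \<forall>n. (\<integral>\<^sup>+x\<in>ball x0 R. ?D n x \<partial>completion M) \<le> ennreal (K * (1 / 2) ^ n)"
      by (intro exI[of _ K]) simp
  qed measurable
  then show ?thesis
  proof (rule eventually_mono)
    fix x assume fin: "(\<Sum>n. ?D n x) \<noteq> \<infinity>"
    have Dn: "?D n x = ennreal (enn2real (?D n x))" for n
    proof -
      have "?D n x \<le> (\<Sum>n. ?D n x)" using sum_le_suminf[of "\<lambda>n. ?D n x" "{n}"] by simp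
      then have "?D n x < top" using fin by (simp add: less_top order_le_less_trans)
      then show ?thesis by simp
    qed
    have "(\<Sum>n. ennreal (enn2real (?D n x))) \<noteq> top" using fin by (simp flip: Dn)
    then have "summable (\<lambda>n. enn2real (?D n x))" by (intro summable_suminf_not_top) auto
    then have "(\<lambda>n. ennreal (enn2real (?D n x))) \<longlonglongrightarrow> ennreal 0"
      by (intro tendsto_ennrealI summable_LIMSEQ_zero)
    then show "(\<lambda>n. ?D n x) \<longlonglongrightarrow> 0" by (simp flip: Dn)
  qed
qed

text \<open>
  The functions \<open>osc\<close> of the nets act as upper gradients of \<open>u\<close> on scales above the mesh.  A Mazur
  sequence of them is dominated by a function \<open>H m\<close> of almost the same norm, which is an upper
  gradient of \<open>u\<close> along curves that meet the exceptional null set in length zero.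
\<close>

lemma D_norm_le_energy:
  assumes p: "1 < p" and S: "\<And>n. is_net ((1 / 2) ^ n) (S n)" and u: "u \<in> D_fun M p"
    and L: "0 \<le> L" "\<exists>\<^sub>F n in sequentially. energy (S n) ((1 / 2) ^ n) u \<le> ennreal L"
  shows "D_norm M p u \<le> L powr (1 / p)"
proof -
  define r where "r n = (1 / 2 :: real) ^ n" for n :: nat
  have r0: "0 < r n" for n by (simp add: r_def)
  have S': "is_net (r n) (S n)" for n using S by (simp add: r_def)
  have "infinite {n. energy (S n) (r n) u \<le> ennreal L}"
    using L(2) by (simp add: r_def frequently_cofinite[symmetric] cofinite_eq_sequentially)
  \<comment> \<open>A subsequence along which all energies are at most \<open>L\<close>, so the
    discrete gradients \<open>G j\<close> are bounded in Lp by
    \<open>A = L powr (1 / p)\<close>.\<close>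
  from infinite_enumerate[OF this] obtain \<phi> :: "nat \<Rightarrow> nat"
    where \<phi>: "strict_mono \<phi>" "\<And>n. energy (S (\<phi> n)) (r (\<phi> n)) u \<le> ennreal L"
    by blast
  define G where "G j x = osc (S (\<phi> j)) (r (\<phi> j)) u x powr (1 / p)" for j x
  have Gb [measurable]: "G j \<in> borel_measurable borel" for j
    unfolding G_def using osc_measurable[OF S' r0, of "\<phi> j" u] by measurable
  have GM: "G j \<in> borel_measurable M" for j
    using Gb measurable_cong_sets[OF sets_M refl] by blast
  have G0: "0 \<le> G j x" for j x by (simp add: G_def)
  define A where "A = L powr (1 / p)"
  have A0: "0 \<le> A" by (simp add: A_def)
  have GA: "Lp_norm M p (\<lambda>x. ennreal (G j x)) \<le> ennreal A" for j
  proof -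
    have "Lp_norm M p (\<lambda>x. ennreal (G j x)) = ennreal_powr (energy (S (\<phi> j)) (r (\<phi> j)) u) (1 / p)"
      using p0 by (simp add: Lp_norm_def energy_def G_def powr_powr osc_nonneg)
    also have "\<dots> \<le> ennreal_powr (ennreal L) (1 / p)"
      using p0 \<phi>(2) by (intro ennreal_powr_mono) auto
    finally show ?thesis using L(1) by (simp add: A_def)
  qed
  obtain w where w: "\<And>k. w k \<in> conv_tail G k"
    "\<And>e. 0 < e \<Longrightarrow> \<exists>m. \<forall>i\<ge>m. \<forall>j\<ge>m. Lp_norm M p (\<lambda>x. ennreal \<bar>w i x - w j x\<bar>) \<le> ennreal e"
    by (rule Lp_mazur[OF p GM G0 GA A0]) (rule that)
  have wb [measurable]: "w k \<in> borel_measurable borel" for k using w(1) Gb by (rule conv_tail_measurable)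
  have wM [measurable]: "w k \<in> borel_measurable M" for k using w(1) GM by (rule conv_tail_measurable)
  have w0: "0 \<le> w k x" for k x using w(1) G0 by (rule conv_tail_nonneg)
  have wA: "Lp_norm M p (\<lambda>x. ennreal (w k x)) \<le> ennreal A" for k
    using conv_tail_Lp_norm_le[OF p1 GM G0 GA w(1)] .
  have "\<forall>i. \<exists>m. \<forall>j\<ge>m. \<forall>k\<ge>m. Lp_norm M p (\<lambda>x. ennreal \<bar>w j x - w k x\<bar>) \<le> ennreal ((1 / 2) ^ i)"
    using w(2) by simp
  then obtain N where N: "\<And>i j k. N i \<le> j \<Longrightarrow> N i \<le> k \<Longrightarrow>
      Lp_norm M p (\<lambda>x. ennreal \<bar>w j x - w k x\<bar>) \<le> ennreal ((1 / 2) ^ i)" by metis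
  \<comment> \<open>The sum puts both \<open>\<kappa> k\<close> and \<open>\<kappa> (Suc k)\<close>
    beyond \<open>N k\<close>; the summand \<open>k\<close> gives \<open>k \<le> \<kappa> k\<close>,
    so these indices reach arbitrarily fine meshes.\<close>
  define \<kappa> where "\<kappa> k = (\<Sum>i\<le>k. N i) + k" for k
  have \<kappa>N: "N k \<le> \<kappa> k" "N k \<le> \<kappa> (Suc k)" "k \<le> \<kappa> k" for k
  proof -
    have "N k \<le> (\<Sum>i\<le>k. N i)" by (rule member_le_sum) auto
    then show "N k \<le> \<kappa> k" "N k \<le> \<kappa> (Suc k)" "k \<le> \<kappa> k" by (simp_all add: \<kappa>_def)
  qed
  \<comment> \<open>By telescoping, \<open>H m\<close> dominates all \<open>w (\<kappa> i)\<close>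
    with \<open>i \<ge> m\<close>, at an additional norm of at most
    \<open>2 * (1 / 2) ^ m\<close>.\<close>
  define H where "H m x = ennreal (w (\<kappa> m) x) + (\<Sum>i. ennreal \<bar>w (\<kappa> (Suc (i + m))) x - w (\<kappa> (i + m)) x\<bar>)" for m x
  have [measurable]: "H m \<in> borel_measurable borel" "H m \<in> borel_measurable M" for m
    unfolding H_def by measurable
  have HA: "Lp_norm M p (H m) \<le> ennreal (A + 2 * (1 / 2) ^ m)" for m
  proof -
    have "Lp_norm M p (H m) \<le> Lp_norm M p (\<lambda>x. ennreal (w (\<kappa> m) x)) +
        Lp_norm M p (\<lambda>x. \<Sum>i. ennreal \<bar>w (\<kappa> (Suc (i + m))) x - w (\<kappa> (i + m)) x\<bar>)"
      unfolding H_def by (intro Lp_norm_triangle p1) measurable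
    also have "\<dots> \<le> ennreal A + (\<Sum>i. Lp_norm M p (\<lambda>x. ennreal \<bar>w (\<kappa> (Suc (i + m))) x - w (\<kappa> (i + m)) x\<bar>))"
      by (intro add_mono wA Lp_norm_suminf p1) measurable
    also have "\<dots> \<le> ennreal A + (\<Sum>i. ennreal ((1 / 2) ^ (i + m)))"
      by (intro add_left_mono suminf_le summableI N \<kappa>N)
    also have "\<dots> = ennreal (A + 2 * (1 / 2) ^ m)" unfolding suminf_half_power using A0 by simp
    finally show ?thesis .
  qed
  have wH: "ennreal (w (\<kappa> i) x) \<le> H m x" if "m \<le> i" for i m x
  proof -
    have "ennreal (w (\<kappa> (n + m)) x) \<le> ennreal (w (\<kappa> m) x) +
        (\<Sum>i<n. ennreal \<bar>w (\<kappa> (Suc (i + m))) x - w (\<kappa> (i + m)) x\<bar>)" for n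
    proof (induction n)
      case (Suc n)
      have "ennreal (w (\<kappa> (Suc n + m)) x) \<le>
          ennreal (w (\<kappa> (n + m)) x) + ennreal \<bar>w (\<kappa> (Suc (n + m))) x - w (\<kappa> (n + m)) x\<bar>"
        using w0 by (simp flip: ennreal_plus)
      also have "\<dots> \<le> (ennreal (w (\<kappa> m) x) + (\<Sum>i<n. ennreal \<bar>w (\<kappa> (Suc (i + m))) x - w (\<kappa> (i + m)) x\<bar>)) +
          ennreal \<bar>w (\<kappa> (Suc (n + m))) x - w (\<kappa> (n + m)) x\<bar>"
        by (rule add_right_mono[OF Suc.IH])
      finally show ?case by (simp add: add.assoc)
    qed simp
    from this[of "i - m"] have "ennreal (w (\<kappa> i) x) \<le> ennreal (w (\<kappa> m) x) +
        (\<Sum>j<i - m. ennreal \<bar>w (\<kappa> (Suc (j + m))) x - w (\<kappa> (j + m)) x\<bar>)" using that by simp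
    also have "\<dots> \<le> H m x" unfolding H_def by (intro add_left_mono sum_le_suminf) auto
    finally show ?thesis .
  qed
  obtain E where E: "{x \<in> space M. \<not> (\<lambda>n. net_err (S n) (r n) u x) \<longlonglongrightarrow> 0} \<subseteq> E" "emeasure M E = 0" "E \<in> sets M"
    using net_err_tendsto_0[OF S u] unfolding r_def by (rule AE_E)
  have spaceM: "space M = UNIV" using sets_eq_imp_space_eq[OF sets_M] by simp
  have [measurable]: "E \<in> sets borel" "E \<in> sets M" using E(3) sets_M by auto
  have offE: "\<forall>\<^sub>F n in sequentially. net_err (S n) (r n) u x \<le> ennreal e" if "x \<notin> E" "0 < e" for x e
  proof -
    have "(\<lambda>n. net_err (S n) (r n) u x) \<longlonglongrightarrow> 0" using E(1) that(1) spaceM by blast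
    then have "\<forall>\<^sub>F n in sequentially. net_err (S n) (r n) u x < ennreal e"
      by (rule order_tendstoD) (use that in simp)
    then show ?thesis by (rule eventually_mono) simp
  qed
  \<comment> \<open>Both ends lie outside \<open>E\<close>, so \<open>u\<close> is close to the
    averages of nearby net points there for all fine meshes, and \<open>avg_curve_le\<close> applies
    to each \<open>G j\<close> with \<open>j \<ge> \<kappa> i\<close>. The left side does not depend
    on \<open>j\<close>, so the bound passes to the convex combination \<open>w (\<kappa> i)\<close>
    and then to \<open>H m\<close>.\<close>
  have inner: "ennreal \<bar>u (c t) - u (c s)\<bar> \<le> (\<integral>\<^sup>+x\<in>{s..t}. H m (c x) \<partial>lborel)"
    if c: "1-lipschitz_on UNIV c" and st: "s < t" "c s \<notin> E" "c t \<notin> E" for c and s t :: real and m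
  proof (rule ennreal_le_epsilon)
    fix e :: real assume e: "0 < e"
    have [measurable]: "c \<in> borel_measurable borel"
      using c by (intro borel_measurable_continuous_onI lipschitz_on_continuous_on)
    have "(\<lambda>n. r n) \<longlonglongrightarrow> 0" unfolding r_def by (rule LIMSEQ_power_zero) simp
    then have "\<forall>\<^sub>F n in sequentially. r n < t - s" by (rule order_tendstoD) (use st in simp)
    then have "\<forall>\<^sub>F n in sequentially. r n < t - s \<and>
        (net_err (S n) (r n) u (c s) \<le> ennreal (e / 2) \<and> net_err (S n) (r n) u (c t) \<le> ennreal (e / 2))"
      using offE[OF st(2), of "e / 2"] offE[OF st(3), of "e / 2"] e by (intro eventually_conj) auto
    then obtain n0 where n0: "\<And>n. n0 \<le> n \<Longrightarrow> r n < t - s"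
      "\<And>n. n0 \<le> n \<Longrightarrow> net_err (S n) (r n) u (c s) \<le> ennreal (e / 2)"
      "\<And>n. n0 \<le> n \<Longrightarrow> net_err (S n) (r n) u (c t) \<le> ennreal (e / 2)"
      unfolding eventually_sequentially by blast
    define i where "i = max m n0"
    have ki: "n0 \<le> \<kappa> i" using \<kappa>N(3)[of i] by (simp add: i_def)
    have one: "ennreal \<bar>u (c t) - u (c s)\<bar> \<le> ennreal e + (\<integral>\<^sup>+x\<in>{s..t}. ennreal (G j (c x)) \<partial>lborel)"
      if j: "\<kappa> i \<le> j" for j
    proof -
      let ?n = "\<phi> j"
      \<comment> \<open>A strictly increasing \<open>\<phi>\<close> satisfies
        \<open>j \<le> \<phi> j\<close>, so the mesh selected by \<open>j\<close> is fine enough as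
        well.\<close>
      have nn: "n0 \<le> ?n" using seq_suble[OF \<phi>(1), of j] ki j by linarith
      obtain a where a: "a \<in> S ?n" "dist a (c s) < r ?n" using S'[of ?n] unfolding is_net_def by blast
      obtain b where b: "b \<in> S ?n" "dist b (c t) < r ?n" using S'[of ?n] unfolding is_net_def by blast
      have "ennreal \<bar>u (c t) - u (c s)\<bar> \<le> ennreal \<bar>u (c s) - avg a (r ?n) u\<bar> + ennreal \<bar>u (c t) - avg b (r ?n) u\<bar> +
          ennreal \<bar>avg a (r ?n) u - avg b (r ?n) u\<bar>"
        by (simp flip: ennreal_plus)
      also have "\<dots> \<le> ennreal (e / 2) + ennreal (e / 2) + (\<integral>\<^sup>+x\<in>{s..t}. ennreal (G j (c x)) \<partial>lborel)"
        unfolding G_def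
        by (intro add_mono order.trans[OF net_err_ge[OF a] n0(2)[OF nn]] order.trans[OF net_err_ge[OF b] n0(3)[OF nn]]
          avg_curve_le[OF S' r0 c a(1) b(1) a(2) b(2)] less_imp_le[OF n0(1)[OF nn]])
      also have "ennreal (e / 2) + ennreal (e / 2) = ennreal e" using e by (simp flip: ennreal_plus)
      finally show ?thesis .
    qed
    obtain n l where l: "\<And>j. 0 \<le> l j" "\<And>j. n < j \<Longrightarrow> l j = 0" "(\<Sum>j\<le>n. l j) = 1"
      "w (\<kappa> i) = (\<lambda>x. \<Sum>j\<le>n. l j * G (\<kappa> i + j) x)" using w(1) by (rule conv_tailE) (rule that)
    have l1: "(\<Sum>j\<le>n. ennreal (l j)) = 1" using l(1,3) by simp
    have "ennreal \<bar>u (c t) - u (c s)\<bar> = (\<Sum>j\<le>n. ennreal (l j) * ennreal \<bar>u (c t) - u (c s)\<bar>)"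
      by (simp add: l1 flip: sum_distrib_right)
    also have "\<dots> \<le> (\<Sum>j\<le>n. ennreal (l j) * (ennreal e + (\<integral>\<^sup>+x\<in>{s..t}. ennreal (G (\<kappa> i + j) (c x)) \<partial>lborel)))"
      by (intro sum_mono mult_left_mono one) auto
    also have "\<dots> = ennreal e + (\<Sum>j\<le>n. ennreal (l j) * (\<integral>\<^sup>+x\<in>{s..t}. ennreal (G (\<kappa> i + j) (c x)) \<partial>lborel))"
      by (simp add: distrib_left sum.distrib l1 flip: sum_distrib_right)
    also have "(\<Sum>j\<le>n. ennreal (l j) * (\<integral>\<^sup>+x\<in>{s..t}. ennreal (G (\<kappa> i + j) (c x)) \<partial>lborel)) =
        (\<integral>\<^sup>+x. (\<Sum>j\<le>n. ennreal (l j) * (ennreal (G (\<kappa> i + j) (c x)) * indicator {s..t} x)) \<partial>lborel)"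
      by (subst nn_integral_sum) (auto simp: nn_integral_cmult)
    also have "\<dots> = (\<integral>\<^sup>+x\<in>{s..t}. ennreal (w (\<kappa> i) (c x)) \<partial>lborel)"
      using l(1) G0 by (intro nn_integral_cong)
        (simp add: l(4) ennreal_mult sum_distrib_right mult.assoc flip: sum_ennreal)
    also have "\<dots> \<le> (\<integral>\<^sup>+x\<in>{s..t}. H m (c x) \<partial>lborel)"
      by (intro nn_integral_mono mult_right_mono wH) (auto simp: i_def)
    finally show "ennreal \<bar>u (c t) - u (c s)\<bar> \<le> (\<integral>\<^sup>+x\<in>{s..t}. H m (c x) \<partial>lborel) + ennreal e"
      by (simp add: add.commute add_left_mono)
  qed
  obtain g where g: "upper_gradient g (\<lambda>x. ereal (u x))" "Lp_norm M p g < top"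
    using u by (auto simp: D_fun_iff elim: D_seminorm_lessE)
  have [measurable]: "g \<in> borel_measurable borel" "g \<in> borel_measurable M"
    using g(1) upper_gradient_measurable[OF g(1)] by (simp_all add: upper_gradient_def)
  \<comment> \<open>The infinite part makes admissible curves avoid \<open>E\<close> at almost every
    parameter. The multiple of \<open>g\<close> makes the \<open>g\<close>-integral along them
    finite, which gives continuity of \<open>u\<close> along the curve at its end points, where
    \<open>E\<close> may be met; its norm vanishes as \<open>m\<close> grows.\<close>
  define \<Gamma> where "\<Gamma> m x = H m x + (top * indicator E x + ennreal ((1 / 2) ^ m) * g x)" for m x
  have ug: "upper_gradient (\<Gamma> m) (\<lambda>x. ereal (u x))" for m
  proof (rule upper_gradientI_unit_speed)
    show "\<Gamma> m \<in> borel_measurable borel" unfolding \<Gamma>_def by measurable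
    fix c L assume c: "unit_speed c L" and fin: "(\<integral>\<^sup>+x\<in>{0..L}. \<Gamma> m (c x) \<partial>lborel) < \<infinity>"
    have [measurable]: "c \<in> borel_measurable borel" using c by (rule unit_speed_measurable)
    have L: "0 < L" and lip: "1-lipschitz_on UNIV c" using c by (simp_all only: unit_speed_def)
    have "(\<integral>\<^sup>+x\<in>{0..L}. top * indicator E (c x) \<partial>lborel) \<le> (\<integral>\<^sup>+x\<in>{0..L}. \<Gamma> m (c x) \<partial>lborel)"
      by (intro nn_integral_mono mult_right_mono) (auto simp: \<Gamma>_def indicator_def)
    then have AE: "AE x in lborel. x \<in> {0..L} \<longrightarrow> c x \<notin> E"
      using fin by (intro unit_speed_AE_notin[OF c]) auto
    let ?f = "\<lambda>x. g (c x) * indicator {0..L} x"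
    have "ennreal ((1 / 2) ^ m) * (\<integral>\<^sup>+x. ?f x \<partial>lborel) = (\<integral>\<^sup>+x\<in>{0..L}. ennreal ((1 / 2) ^ m) * g (c x) \<partial>lborel)"
      by (subst nn_integral_cmult[symmetric]) (auto simp: mult.assoc)
    also have "\<dots> \<le> (\<integral>\<^sup>+x\<in>{0..L}. \<Gamma> m (c x) \<partial>lborel)"
      by (intro nn_integral_mono mult_right_mono) (auto simp: \<Gamma>_def intro: order.trans[OF _ add_increasing])
    finally have "ennreal ((1 / 2) ^ m) * (\<integral>\<^sup>+x. ?f x \<partial>lborel) < \<infinity>" using fin by (rule order.strict_trans1)
    then have ffin: "(\<integral>\<^sup>+x. ?f x \<partial>lborel) < \<infinity>" by (auto simp: ennreal_mult_less_top)
    show "ennreal \<bar>u (c L) - u (c 0)\<bar> \<le> (\<integral>\<^sup>+x\<in>{0..L}. \<Gamma> m (c x) \<partial>lborel)"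
    proof (rule ennreal_le_epsilon)
      fix e :: real assume e: "0 < e"
      then have e2: "0 < ennreal (e / 2)" by simp
      obtain \<eta>1 where \<eta>1: "0 < \<eta>1" "(\<integral>\<^sup>+x\<in>{0 - \<eta>1..0 + \<eta>1}. ?f x \<partial>lborel) \<le> ennreal (e / 2)"
        using nn_integral_small_near_point[OF _ ffin e2, of 0] by auto
      obtain \<eta>2 where \<eta>2: "0 < \<eta>2" "(\<integral>\<^sup>+x\<in>{L - \<eta>2..L + \<eta>2}. ?f x \<partial>lborel) \<le> ennreal (e / 2)"
        using nn_integral_small_near_point[OF _ ffin e2, of L] by auto
      \<comment> \<open>Capping by \<open>L / 3\<close> keeps the two chosen parameters in order,
        \<open>s < t\<close>.\<close>
      have "0 < min \<eta>1 (L / 3)" "L - min \<eta>2 (L / 3) < L" using \<eta>1 \<eta>2 L by auto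
      then obtain s t where s: "s \<in> {0..min \<eta>1 (L / 3)}" "s \<in> {0..L} \<longrightarrow> c s \<notin> E"
        and t: "t \<in> {L - min \<eta>2 (L / 3)..L}" "t \<in> {0..L} \<longrightarrow> c t \<notin> E"
        using AE_lborel_Icc_ex[OF AE] by metis
      have st: "0 \<le> s" "s < t" "t \<le> L" "s \<le> \<eta>1" "L - \<eta>2 \<le> t" using s(1) t(1) L by auto
      have notE: "c s \<notin> E" "c t \<notin> E" using s(2) t(2) st by auto
      have "ennreal \<bar>u (c s) - u (c 0)\<bar> \<le> (\<integral>\<^sup>+x\<in>{0..s}. g (c x) \<partial>lborel)"
        using st by (intro upper_gradient_unit_speed[OF g(1) c]) auto
      also have "\<dots> \<le> (\<integral>\<^sup>+x\<in>{0 - \<eta>1..0 + \<eta>1}. ?f x \<partial>lborel)"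
        using st \<eta>1 by (intro nn_integral_mono) (auto simp: indicator_def)
      finally have 1: "ennreal \<bar>u (c s) - u (c 0)\<bar> \<le> ennreal (e / 2)" using \<eta>1(2) by (rule order.trans)
      have "ennreal \<bar>u (c L) - u (c t)\<bar> \<le> (\<integral>\<^sup>+x\<in>{t..L}. g (c x) \<partial>lborel)"
        using st by (intro upper_gradient_unit_speed[OF g(1) c]) auto
      also have "\<dots> \<le> (\<integral>\<^sup>+x\<in>{L - \<eta>2..L + \<eta>2}. ?f x \<partial>lborel)"
        using st \<eta>2 by (intro nn_integral_mono) (auto simp: indicator_def)
      finally have 2: "ennreal \<bar>u (c L) - u (c t)\<bar> \<le> ennreal (e / 2)" using \<eta>2(2) by (rule order.trans)
      have "ennreal \<bar>u (c t) - u (c s)\<bar> \<le> (\<integral>\<^sup>+x\<in>{s..t}. H m (c x) \<partial>lborel)"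
        by (rule inner[OF lip st(2) notE])
      also have "\<dots> \<le> (\<integral>\<^sup>+x\<in>{0..L}. \<Gamma> m (c x) \<partial>lborel)"
        using st by (intro nn_integral_mono) (auto simp: \<Gamma>_def indicator_def)
      finally have 3: "ennreal \<bar>u (c t) - u (c s)\<bar> \<le> (\<integral>\<^sup>+x\<in>{0..L}. \<Gamma> m (c x) \<partial>lborel)" .
      have "ennreal \<bar>u (c L) - u (c 0)\<bar> \<le> ennreal \<bar>u (c t) - u (c s)\<bar> + (ennreal \<bar>u (c s) - u (c 0)\<bar> + ennreal \<bar>u (c L) - u (c t)\<bar>)"
        by (simp flip: ennreal_plus)
      also have "\<dots> \<le> (\<integral>\<^sup>+x\<in>{0..L}. \<Gamma> m (c x) \<partial>lborel) + (ennreal (e / 2) + ennreal (e / 2))"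
        by (intro add_mono 1 2 3)
      also have "ennreal (e / 2) + ennreal (e / 2) = ennreal e" using e by (simp flip: ennreal_plus)
      finally show "ennreal \<bar>u (c L) - u (c 0)\<bar> \<le> (\<integral>\<^sup>+x\<in>{0..L}. \<Gamma> m (c x) \<partial>lborel) + ennreal e" .
    qed
  qed
  define B where "B = enn2real (Lp_norm M p g)"
  have B: "Lp_norm M p g = ennreal B" "0 \<le> B" using g(2) by (simp_all add: B_def)
  have "D_norm M p u \<le> A + 2 * (1 / 2) ^ m + (1 / 2) ^ m * B" for m
  proof (rule D_norm_le[OF ug])
    have "Lp_norm M p (\<Gamma> m) \<le> Lp_norm M p (H m) + Lp_norm M p (\<lambda>x. top * indicator E x + ennreal ((1 / 2) ^ m) * g x)"
      unfolding \<Gamma>_def by (intro Lp_norm_triangle p1) measurable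
    also have "\<dots> \<le> Lp_norm M p (H m) + (Lp_norm M p (\<lambda>x. top * indicator E x) + Lp_norm M p (\<lambda>x. ennreal ((1 / 2) ^ m) * g x))"
      by (intro add_left_mono Lp_norm_triangle p1) measurable
    also have "Lp_norm M p (\<lambda>x. top * indicator E x) = 0"
      using E(2,3) by (intro Lp_norm_null p0) (simp add: null_sets_def)
    also have "Lp_norm M p (\<lambda>x. ennreal ((1 / 2) ^ m) * g x) = ennreal ((1 / 2) ^ m) * ennreal B"
      unfolding B(1)[symmetric] by (rule Lp_norm_cmult[OF p0]) measurable
    also have "Lp_norm M p (H m) + (0 + ennreal ((1 / 2) ^ m) * ennreal B) \<le>
        ennreal (A + 2 * (1 / 2) ^ m) + (0 + ennreal ((1 / 2) ^ m) * ennreal B)"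
      by (rule add_right_mono[OF HA])
    also have "\<dots> = ennreal (A + 2 * (1 / 2) ^ m + (1 / 2) ^ m * B)"
      using A0 B(2) by (simp add: ennreal_mult)
    finally show "Lp_norm M p (\<Gamma> m) \<le> ennreal (A + 2 * (1 / 2) ^ m + (1 / 2) ^ m * B)" .
  qed (use A0 B(2) in auto)
  moreover have "(\<lambda>m. A + 2 * (1 / 2) ^ m + (1 / 2) ^ m * B) \<longlonglongrightarrow> A + 2 * 0 + 0 * B"
    by (intro tendsto_intros LIMSEQ_power_zero) auto
  ultimately have "D_norm M p u \<le> A + 2 * 0 + 0 * B"
    by (intro LIMSEQ_le_const) auto
  then show ?thesis by (simp add: A_def)
qed

end

section \<open>Convex combinations in the homogeneous space\<close>

context borel_exponent
begin

lemma D_norm_sum: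
  "(\<And>i. i \<in> I \<Longrightarrow> f i \<in> D_fun M p) \<Longrightarrow> D_norm M p (\<lambda>x. \<Sum>i\<in>I. f i x) \<le> (\<Sum>i\<in>I. D_norm M p (f i))"
proof (induction I rule: infinite_finite_induct)
  case (insert i I)
  have "D_norm M p (\<lambda>x. f i x + (\<Sum>i\<in>I. f i x)) \<le> D_norm M p (f i) + D_norm M p (\<lambda>x. \<Sum>i\<in>I. f i x)"
    using insert.prems by (intro D_norm_add D_fun_sum) auto
  with insert show ?case by simp
qed simp_all

lemma conv_tail_D_fun:
  assumes w: "w \<in> conv_tail f k" and f: "\<And>j. f j \<in> D_fun M p" "\<And>j. D_norm M p (f j) \<le> K"
  shows "w \<in> D_fun M p" "D_norm M p w \<le> K"
proof -
  obtain n l where l: "\<And>j. 0 \<le> l j" "\<And>j. n < j \<Longrightarrow> l j = 0" "(\<Sum>j\<le>n. l j) = 1"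
    "w = (\<lambda>x. \<Sum>j\<le>n. l j * f (k + j) x)" using w by (rule conv_tailE) (rule that)
  show "w \<in> D_fun M p" unfolding l(4) by (intro D_fun_sum D_fun_scale f)
  have "D_norm M p w \<le> (\<Sum>j\<le>n. D_norm M p (\<lambda>x. l j * f (k + j) x))"
    unfolding l(4) by (intro D_norm_sum D_fun_scale f)
  also have "\<dots> = (\<Sum>j\<le>n. l j * D_norm M p (f (k + j)))"
    using l(1) by (simp add: D_norm_scale)
  also have "\<dots> \<le> (\<Sum>j\<le>n. l j * K)" by (intro sum_mono mult_left_mono f l)
  also have "\<dots> = K" using l(3) by (simp flip: sum_distrib_right)
  finally show "D_norm M p w \<le> K" .
qed

end

context doubling_poincare_space
begin

lemma avg_diff:
  assumes "u \<in> D_fun M p" "v \<in> D_fun M p" "0 < r"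
  shows "avg x r (\<lambda>y. u y - v y) = avg x r u - avg x r v"
  using set_integral_diff(2)[OF D_fun_set_integrable[OF assms(1,3)] D_fun_set_integrable[OF assms(2,3)], of x]
  by (simp add: avg_def diff_divide_distrib)

lemma avg_midpoint:
  assumes "u \<in> D_fun M p" "v \<in> D_fun M p" "0 < r"
  shows "avg x r (\<lambda>y. (u y + v y) / 2) = (avg x r u + avg x r v) / 2"
  using set_integral_add(2)[OF D_fun_set_integrable[OF assms(1,3)] D_fun_set_integrable[OF assms(2,3)], of x]
  unfolding avg_def set_integral_divide_zero by (simp add: add_divide_distrib)

text \<open>Averages are linear in the function, so the scalar inequality holds in each summand of
  \<open>osc\<close>, with \<open>a\<close> and \<open>b\<close> the difference quotients of
  \<open>u\<close> and \<open>v\<close>. Summation and integration keep its constant, which is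
  therefore the same for all nets and meshes.\<close>

lemma energy_uniformly_convex:
  assumes "1 < p" "0 < e"
  obtains K where "0 < K" "\<And>S r u v. is_net r S \<Longrightarrow> 0 < r \<Longrightarrow> u \<in> D_fun M p \<Longrightarrow> v \<in> D_fun M p \<Longrightarrow>
    energy S r (\<lambda>x. u x - v x) + ennreal K * energy S r (\<lambda>x. (u x + v x) / 2) \<le>
    ennreal (e + K / 2) * (energy S r u + energy S r v)"
proof -
  obtain K where K: "0 < K" "\<And>a b. \<bar>a - b\<bar> powr p + K * \<bar>(a + b) / 2\<bar> powr p \<le> (e + K / 2) * (\<bar>a\<bar> powr p + \<bar>b\<bar> powr p)"
    using powr_abs_uniformly_convex[OF assms] by blast
  show thesis
  proof (rule that[OF K(1)])
    fix S :: "'a set" and r u v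
    assume S: "is_net r S" "0 < r" and u: "u \<in> D_fun M p" and v: "v \<in> D_fun M p"
    have [measurable]: "osc S r w \<in> borel_measurable M" for w
      using osc_measurable[OF S, of w] measurable_cong_sets[OF sets_M refl] by blast
    have osc: "osc S r (\<lambda>x. u x - v x) x + K * osc S r (\<lambda>x. (u x + v x) / 2) x \<le> (e + K / 2) * (osc S r u x + osc S r v x)" for x
    proof -
      have summand: "(\<bar>avg s r (\<lambda>x. u x - v x) - avg t r (\<lambda>x. u x - v x)\<bar> / r) powr p +
          K * (\<bar>avg s r (\<lambda>x. (u x + v x) / 2) - avg t r (\<lambda>x. (u x + v x) / 2)\<bar> / r) powr p \<le>
          (e + K / 2) * ((\<bar>avg s r u - avg t r u\<bar> / r) powr p + (\<bar>avg s r v - avg t r v\<bar> / r) powr p)" for s t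
      proof -
        let ?a = "(avg s r u - avg t r u) / r" and ?b = "(avg s r v - avg t r v) / r"
        have "\<bar>avg s r (\<lambda>x. u x - v x) - avg t r (\<lambda>x. u x - v x)\<bar> / r = \<bar>?a - ?b\<bar>"
          using S(2) unfolding avg_diff[OF u v S(2)] by (simp add: abs_divide algebra_simps flip: diff_divide_distrib)
        moreover have "\<bar>avg s r (\<lambda>x. (u x + v x) / 2) - avg t r (\<lambda>x. (u x + v x) / 2)\<bar> / r = \<bar>(?a + ?b) / 2\<bar>"
        proof -
          have mid: "(?a + ?b) / 2 = ((avg s r u + avg s r v) / 2 - (avg t r u + avg t r v) / 2) / r"
            by (simp add: add_divide_distrib diff_divide_distrib)
          show ?thesis unfolding avg_midpoint[OF u v S(2)] mid using S(2) by (simp only: abs_divide abs_of_pos)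
        qed
        moreover have "\<bar>avg s r u - avg t r u\<bar> / r = \<bar>?a\<bar>" "\<bar>avg s r v - avg t r v\<bar> / r = \<bar>?b\<bar>"
          using S(2) by (simp_all add: abs_divide)
        ultimately show ?thesis using K(2)[of ?a ?b] by (simp only:)
      qed
      show ?thesis
        unfolding osc_def sum_distrib_left sum.distrib[symmetric]
        by (intro sum_mono) (use summand in \<open>simp only: sum.distrib[symmetric] sum_distrib_left\<close>)
    qed
    have "energy S r (\<lambda>x. u x - v x) + ennreal K * energy S r (\<lambda>x. (u x + v x) / 2) =
        (\<integral>\<^sup>+x. ennreal (osc S r (\<lambda>x. u x - v x) x) + ennreal K * ennreal (osc S r (\<lambda>x. (u x + v x) / 2) x) \<partial>M)"
      unfolding energy_def by (subst nn_integral_add) (auto simp: nn_integral_cmult)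
    also have "\<dots> \<le> (\<integral>\<^sup>+x. ennreal (e + K / 2) * (ennreal (osc S r u x) + ennreal (osc S r v x)) \<partial>M)"
    proof (rule nn_integral_mono)
      fix x
      have "ennreal (osc S r (\<lambda>x. u x - v x) x + K * osc S r (\<lambda>x. (u x + v x) / 2) x) \<le>
          ennreal ((e + K / 2) * (osc S r u x + osc S r v x))"
        by (intro ennreal_leI osc)
      then show "ennreal (osc S r (\<lambda>x. u x - v x) x) + ennreal K * ennreal (osc S r (\<lambda>x. (u x + v x) / 2) x) \<le>
          ennreal (e + K / 2) * (ennreal (osc S r u x) + ennreal (osc S r v x))"
        using K(1) assms(2) by (simp only: ennreal_plus ennreal_mult osc_nonneg mult_nonneg_nonneg add_nonneg_nonneg
          less_imp_le half_gt_zero)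
    qed
    also have "\<dots> = ennreal (e + K / 2) * (energy S r u + energy S r v)"
      unfolding energy_def by (subst nn_integral_cmult) (auto simp: nn_integral_add)
    finally show "energy S r (\<lambda>x. u x - v x) + ennreal K * energy S r (\<lambda>x. (u x + v x) / 2) \<le>
      ennreal (e + K / 2) * (energy S r u + energy S r v)" .
  qed
qed

text \<open>\<open>energy_le\<close> bounds the energies on the convex hull, and their uniform
  convexity yields combinations whose differences have small energy for infinitely many meshes.
  \<open>D_norm_le_energy\<close> turns this into smallness of the norm, and completeness supplies
  the limit.\<close>

lemma D_mazur:
  fixes f :: "nat \<Rightarrow> 'a \<Rightarrow> real"
  assumes p: "1 < p" and f: "\<And>k. f k \<in> D_fun M p" "\<And>k. D_norm M p (f k) \<le> K"
  obtains w F where "\<And>k. w k \<in> conv_tail f k" "F \<in> D_fun M p" "(\<lambda>k. D_norm M p (\<lambda>x. w k x - F x)) \<longlonglongrightarrow> 0"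
proof -
  let ?C = "conv_tail f" and ?mid = "\<lambda>u v x. (u x + v x) / 2"
  note CD = conv_tail_D_fun[where f = f, OF _ f]
  have "\<forall>n. \<exists>S :: 'a set. is_net ((1 / 2) ^ n) S" by (intro allI is_net_exists) simp
  then obtain S :: "nat \<Rightarrow> 'a set" where S: "\<And>n. is_net ((1 / 2) ^ n) (S n)" by metis
  define E where "E n u = energy (S n) ((1 / 2) ^ n) u" for n u
  obtain B where B: "0 \<le> B" "\<And>S r u g. is_net r S \<Longrightarrow> 0 < r \<Longrightarrow> u \<in> D_fun M p \<Longrightarrow>
    upper_gradient g (\<lambda>x. ereal (u x)) \<Longrightarrow> Lp_norm M p g < top \<Longrightarrow>
    energy S r u \<le> ennreal B * (\<integral>\<^sup>+x. ennreal_powr (g x) p \<partial>M)" by (rule energy_le) (rule that)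
  have K0: "0 \<le> K" using f(2)[of 0] D_norm_nonneg[of "f 0"] by linarith
  \<comment> \<open>The norm is an infimum that need not be attained; \<open>K + 1\<close> leaves
    room for an actual upper gradient.\<close>
  have EB: "E n u \<le> ennreal (B * (K + 1) powr p)" if u: "u \<in> ?C 0" for n u
  proof -
    have "D_norm M p u < K + 1" using CD(2)[OF u] by simp
    then obtain g where g: "upper_gradient g (\<lambda>x. ereal (u x))" "Lp_norm M p g < ennreal (K + 1)"
      using D_norm_lessE[OF CD(1)[OF u]] by blast
    have "Lp_norm M p g < top" using g(2) ennreal_less_top by (rule order.strict_trans)
    then have "E n u \<le> ennreal B * (\<integral>\<^sup>+x. ennreal_powr (g x) p \<partial>M)"
      unfolding E_def by (intro B(2) S CD(1)[OF u] g(1)) auto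
    also have "\<dots> \<le> ennreal B * ennreal_powr (ennreal (K + 1)) p"
      using g(2) p0 by (intro mult_left_mono Lp_norm_le_iff[THEN iffD1]) auto
    also have "\<dots> = ennreal (B * (K + 1) powr p)" using B(1) K0 by (simp add: ennreal_mult del: ennreal_plus)
    finally show ?thesis .
  qed
  have Efin: "E n u < top" if "u \<in> ?C 0" for n u
    using EB[OF that, of n] ennreal_less_top by (rule order.strict_trans1)
  have sub: "?C k \<subseteq> ?C 0" for k
    using lift_Suc_antimono_le[of ?C 0 k] conv_tail_Suc by blast
  have key: "\<exists>K>0. \<forall>n. \<forall>x\<in>?C 0. \<forall>y\<in>?C 0. E n (\<lambda>z. x z - y z) + ennreal K * E n (?mid x y) \<le> ennreal (e + K / 2) * (E n x + E n y)"
    if e: "0 < e" for e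
  proof -
    obtain K where K: "0 < K" "\<And>S r u v. is_net r S \<Longrightarrow> 0 < r \<Longrightarrow> u \<in> D_fun M p \<Longrightarrow> v \<in> D_fun M p \<Longrightarrow>
        energy S r (\<lambda>x. u x - v x) + ennreal K * energy S r (?mid u v) \<le> ennreal (e + K / 2) * (energy S r u + energy S r v)"
      by (rule energy_uniformly_convex[OF p e]) (rule that)
    have "E n (\<lambda>z. x z - y z) + ennreal K * E n (?mid x y) \<le> ennreal (e + K / 2) * (E n x + E n y)"
      if "x \<in> ?C 0" "y \<in> ?C 0" for n x y
      unfolding E_def by (intro K(2) S CD(1)[OF that(1)] CD(1)[OF that(2)]) simp
    then show ?thesis using K(1) by blast
  qed
  have Edfin: "E n (\<lambda>z. x z - y z) < top" if "x \<in> ?C 0" "y \<in> ?C 0" for n x y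
  proof -
    from key[OF zero_less_one] obtain K where K: "0 < K" "\<And>n x y. x \<in> ?C 0 \<Longrightarrow> y \<in> ?C 0 \<Longrightarrow>
        E n (\<lambda>z. x z - y z) + ennreal K * E n (?mid x y) \<le> ennreal (1 + K / 2) * (E n x + E n y)" by blast
    show ?thesis
      by (rule enn2real_convexity(2)[OF K(2)[OF that] K(1) _ Efin[OF that(1)] Efin[OF that(2)]]) (use K(1) in simp)
  qed
  obtain w where w: "\<And>k. w k \<in> ?C k"
    "\<And>e. 0 < e \<Longrightarrow> \<exists>m. \<forall>i\<ge>m. \<forall>j\<ge>m. \<exists>\<^sub>F n in sequentially. enn2real (E n (\<lambda>z. w i z - w j z)) \<le> e"
  proof (rule uniformly_convex_minimizing_sequence[of ?C ?mid "\<lambda>n u. enn2real (E n u)" "B * (K + 1) powr p"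
        "\<lambda>n x y. enn2real (E n (\<lambda>z. x z - y z))"])
    show "?C k \<noteq> {}" for k using conv_tail_self by blast
    show "?C (Suc k) \<subseteq> ?C k" for k by (rule conv_tail_Suc)
    show "?mid x y \<in> ?C k" if "x \<in> ?C k" "y \<in> ?C k" for k x y using that by (rule conv_tail_mid)
    show "enn2real (E n x) \<le> B * (K + 1) powr p" if "x \<in> ?C 0" for n x
      using EB[OF that] B(1) by (intro enn2real_leI) auto
    fix e :: real assume e: "0 < e"
    from key[OF e] obtain K where K: "0 < K" "\<And>n x y. x \<in> ?C 0 \<Longrightarrow> y \<in> ?C 0 \<Longrightarrow>
        E n (\<lambda>z. x z - y z) + ennreal K * E n (?mid x y) \<le> ennreal (e + K / 2) * (E n x + E n y)" by blast
    have "enn2real (E n (\<lambda>z. x z - y z)) + K * enn2real (E n (?mid x y)) \<le> (e + K / 2) * (enn2real (E n x) + enn2real (E n y))"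
      if "x \<in> ?C 0" "y \<in> ?C 0" for n x y
      using that K(1) e by (intro enn2real_convexity(1) K(2) Efin) auto
    then show "\<exists>K>0. \<forall>n. \<forall>x\<in>?C 0. \<forall>y\<in>?C 0. enn2real (E n (\<lambda>z. x z - y z)) + K * enn2real (E n (?mid x y)) \<le>
        (e + K / 2) * (enn2real (E n x) + enn2real (E n y))"
      using K(1) by blast
  qed auto
  have wD: "w k \<in> D_fun M p" for k using w(1) by (rule CD(1))
  have cauchy: "\<exists>n. \<forall>i\<ge>n. \<forall>j\<ge>n. D_norm M p (\<lambda>x. w i x - w j x) < e" if e: "0 < e" for e
  proof -
    \<comment> \<open>The \<open>p\<close>-th root in \<open>D_norm_le_energy\<close> turns this
      threshold into \<open>e / 2\<close>.\<close>
    obtain m where m: "\<And>i j. m \<le> i \<Longrightarrow> m \<le> j \<Longrightarrow> \<exists>\<^sub>F n in sequentially. enn2real (E n (\<lambda>z. w i z - w j z)) \<le> (e / 2) powr p"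
      using w(2)[of "(e / 2) powr p"] e by auto
    have "D_norm M p (\<lambda>x. w i x - w j x) < e" if ij: "m \<le> i" "m \<le> j" for i j
    proof -
      have "w i \<in> ?C 0" "w j \<in> ?C 0" using w(1) sub by blast+
      then have fin: "E n (\<lambda>z. w i z - w j z) < top" for n by (rule Edfin)
      have "\<exists>\<^sub>F n in sequentially. energy (S n) ((1 / 2) ^ n) (\<lambda>z. w i z - w j z) \<le> ennreal ((e / 2) powr p)"
        using m[OF ij]
      proof (rule frequently_mono[rotated], intro allI impI)
        fix n assume "enn2real (E n (\<lambda>z. w i z - w j z)) \<le> (e / 2) powr p"
        then show "energy (S n) ((1 / 2) ^ n) (\<lambda>z. w i z - w j z) \<le> ennreal ((e / 2) powr p)"
          using fin[of n] unfolding E_def by (metis ennreal_enn2real ennreal_leI)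
      qed
      then have "D_norm M p (\<lambda>x. w i x - w j x) \<le> ((e / 2) powr p) powr (1 / p)"
        by (intro D_norm_le_energy[OF p S] D_fun_diff wD) auto
      then show ?thesis using e p by (simp add: powr_powr)
    qed
    then show ?thesis by blast
  qed
  obtain F where "F \<in> D_fun M p" "(\<lambda>k. D_norm M p (\<lambda>x. w k x - F x)) \<longlonglongrightarrow> 0"
    by (rule D_complete[of w, OF wD cauchy]) (assumption, rule that)
  with w(1) show thesis by (rule that)
qed

end

section \<open>Passage from real-valued representatives to the classes of
  \<open>HN M p\<close>\<close>

theorem theorem1p1:
  fixes M :: "'a::metric_space measure" and p :: real
  assumes "1 \<le> p"
    and "radon_measure M"
    and "\<And>x r. 0 < r \<Longrightarrow> 0 < emeasure M (ball x r) \<and> emeasure M (ball x r) < \<infinity>"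
    and "doubling_measure M"
    and "supports_poincare M p"
  shows "banach_space_on (HN M p) (HN_norm M p) \<and>
    (1 < p \<longrightarrow>
      (\<forall>u. range u \<subseteq> carrier (HN M p) \<and> (\<exists>K. \<forall>k. HN_norm M p (u k) \<le> K) \<longrightarrow>
        (\<exists>w v. convex_combination_subseq (HN M p) u w \<and> norm_converges (HN M p) (HN_norm M p) w v)))"
proof -
  have sets_M: "sets M = sets borel" using assms(2) by (simp add: radon_measure_def)
  obtain C l where C: "0 < C" "1 \<le> l" and
    P: "\<forall>f g x r. f \<in> borel_measurable (completion M) \<and> upper_gradient g f \<and> 0 < r \<longrightarrow>
         (let lhs = nn_average M (ball x r) (\<lambda>y. e2ennreal \<bar>f y - ereal (average M (ball x r) f)\<bar>);
              rhs = ennreal (C * r) *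
                    ennreal_powr (nn_average M (ball x (l * r)) (\<lambda>y. ennreal_powr (g y) p)) (1 / p)
          in (rhs < \<infinity> \<longrightarrow> integrable_on_set M (ball x r) f) \<and> lhs \<le> rhs)"
    using assms(5) unfolding supports_poincare_def by blast
  obtain Cd where Cd: "1 \<le> Cd" "\<And>x r. 0 < r \<Longrightarrow> emeasure M (ball x (2 * r)) \<le> ennreal Cd * emeasure M (ball x r)"
    using assms(4) unfolding doubling_measure_def by blast
  interpret poincare_space M p C l
  proof
    fix f g x and r :: real
    assume "f \<in> borel_measurable (completion M)" "upper_gradient g f" "0 < r"
    then show "let lhs = nn_average M (ball x r) (\<lambda>y. e2ennreal \<bar>f y - ereal (average M (ball x r) f)\<bar>);
              rhs = ennreal (C * r) *
                    ennreal_powr (nn_average M (ball x (l * r)) (\<lambda>y. ennreal_powr (g y) p)) (1 / p)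
          in (rhs < \<infinity> \<longrightarrow> integrable_on_set M (ball x r) f) \<and> lhs \<le> rhs"
      using P by blast
  qed (use assms(1,3) sets_M C in auto)
  interpret doubling_poincare_space M p C l Cd
  proof
    fix x and r :: real assume r: "0 < r"
    have "ennreal (mu x (2 * r)) \<le> ennreal (Cd * mu x r)"
      using Cd(2)[OF r, of x] Cd(1) by (simp add: emeasure_ball_eq ennreal_mult)
    then show "mu x (2 * r) \<le> Cd * mu x r" using Cd(1) by simp
  qed (rule Cd(1))
  have reps: "\<exists>f. \<forall>k. f k \<in> D_fun M p \<and> u k = D_class M p (f k)" if "range u \<subseteq> carrier (HN M p)" for u :: "nat \<Rightarrow> ('a \<Rightarrow> ereal) set"
    using that unfolding HN_carrier by (intro choice) blast
  have conv: "norm_converges (HN M p) (HN_norm M p) (\<lambda>k. D_class M p (f k)) (D_class M p F)"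
    if "\<And>k. f k \<in> D_fun M p" "F \<in> D_fun M p" "(\<lambda>k. D_norm M p (\<lambda>x. f k x - F x)) \<longlonglongrightarrow> 0" for f F
    using that by (simp add: norm_converges_def HN_carrier HN_minus HN_norm_class D_fun_diff)
  have "banach_space_on (HN M p) (HN_norm M p)"
    unfolding banach_space_on_def
  proof (intro conjI allI impI HN_normed_space, elim conjE)
    fix u :: "nat \<Rightarrow> ('a \<Rightarrow> ereal) set" assume u: "range u \<subseteq> carrier (HN M p)"
      and cauchy: "\<forall>e>0. \<exists>n. \<forall>i\<ge>n. \<forall>j\<ge>n. HN_norm M p (u i \<ominus>\<^bsub>HN M p\<^esub> u j) < e"
    obtain f where f: "\<And>k. f k \<in> D_fun M p" "\<And>k. u k = D_class M p (f k)" using reps[OF u] by blast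
    have "HN_norm M p (u i \<ominus>\<^bsub>HN M p\<^esub> u j) = D_norm M p (\<lambda>x. f i x - f j x)" for i j
      by (simp add: f HN_minus HN_norm_class D_fun_diff)
    with cauchy have cauchy': "\<exists>n. \<forall>i\<ge>n. \<forall>j\<ge>n. D_norm M p (\<lambda>x. f i x - f j x) < e" if "0 < e" for e
      using that by simp
    obtain F where "F \<in> D_fun M p" "(\<lambda>k. D_norm M p (\<lambda>x. f k x - F x)) \<longlonglongrightarrow> 0"
      by (rule D_complete[of f, OF f(1) cauchy']) (assumption, rule that)
    then show "\<exists>v. norm_converges (HN M p) (HN_norm M p) u v"
      using conv[OF f(1)] f(2) by (intro exI[of _ "D_class M p F"]) (simp add: norm_converges_def)
  qed
  moreover have "\<exists>w v. convex_combination_subseq (HN M p) u w \<and> norm_converges (HN M p) (HN_norm M p) w v"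
    if p: "1 < p" and u: "range u \<subseteq> carrier (HN M p)" and K: "\<And>k. HN_norm M p (u k) \<le> K" for u :: "nat \<Rightarrow> ('a \<Rightarrow> ereal) set" and K
  proof -
    obtain f where f: "\<And>k. f k \<in> D_fun M p" "\<And>k. u k = D_class M p (f k)" using reps[OF u] by blast
    have fK: "D_norm M p (f k) \<le> K" for k using K[of k] f HN_norm_class by simp
    obtain w F where w: "\<And>k. w k \<in> conv_tail f k" "F \<in> D_fun M p" "(\<lambda>k. D_norm M p (\<lambda>x. w k x - F x)) \<longlonglongrightarrow> 0"
      by (rule D_mazur[OF p f(1) fK]) (rule that)
    have "convex_combination_subseq (HN M p) u (\<lambda>k. D_class M p (w k))"
      unfolding convex_combination_subseq_def
    proof
      fix k
      obtain n l where l: "\<And>j. 0 \<le> l j" "\<And>j. n < j \<Longrightarrow> l j = 0" "(\<Sum>j\<le>n. l j) = 1"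
        "w k = (\<lambda>x. \<Sum>j\<le>n. l j * f (k + j) x)" using w(1) by (rule conv_tailE) (rule that)
      have "D_class M p (w k) = (\<Oplus>\<^bsub>HN M p\<^esub>j\<in>{..n}. l j \<odot>\<^bsub>HN M p\<^esub> u (k + j))"
        unfolding l(4) f(2) by (rule HN_finsum[symmetric]) (rule f(1))
      with l show "\<exists>n l. (\<forall>j\<le>n. 0 \<le> l j) \<and> (\<Sum>j\<le>n. l j) = 1 \<and>
          D_class M p (w k) = (\<Oplus>\<^bsub>HN M p\<^esub>j\<in>{..n}. l j \<odot>\<^bsub>HN M p\<^esub> u (k + j))"
        by blast
    qed
    moreover have "norm_converges (HN M p) (HN_norm M p) (\<lambda>k. D_class M p (w k)) (D_class M p F)"
      using conv[OF conv_tail_D_fun(1)[OF w(1) f(1) fK] w(2,3)] .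
    ultimately show ?thesis by blast
  qed
  ultimately show ?thesis by blast
qed

end
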